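(* Let $k\ge2$, $a\ge2$, and let $T\in\mathbb{R}^{n_1\times\cdots\times n_k}$. For each $j\in[k]$ let $A^{(j)}=\operatorname{unfold}_j(T)\in\mathbb{R}^{n_j\times N_j}$, $N_j=\prod_{t\ne j}n_t$, assume $\operatorname{rank}(A^{(j)})=r$, with compact SVD $A^{(j)}=U^{(j)}\Sigma^{(j)}(V^{(j)})^\top$, and assume \[ \|U^{(j)}\|_{2,\infty}^2\le\mu_1\frac r{n_j},\qquad\|V^{(j)}\|_{2,\infty}^2\le\mu_2\frac r{N_j}\qquad(j=1,\dots,k). \] Let $\kappa=\max_j\sigma_1(A^{(j)})/\sigma_r(A^{(j)})$, $\lambda_r^{(j)}=\sigma_r(A^{(j)})^2$, $n_{\mathrm{tot}}=\prod_tn_t$, $n_{\max}=\max_tn_t$. For each $j$ let $Z^{(j)}$ be the wedge matrix of $A^{(j)}$ at rate $p$, $\hat U^{(j)}\in\mathbb{R}^{n_j\times r}$ orthonormal eigenvectors of $Z^{(j)}$ for its $r$ largest eigenvalues, and $Q^{(j)}=\hat U^{(j)}(\hat U^{(j)})^\top$. Independently of the wedge samples, let $\Omega$ include each entry of $[n_1]\times\cdots\times[n_k]$ independently with probability $q$, let $Y=q^{-1}\mathcal P_\Omega(T)$, and $\hat T=Y\times_1Q^{(1)}\times_2Q^{(2)}\cdots\times_kQ^{(k)}$. Assume \[ p\ge C_0\kappa^4a\mu_1\mu_2\frac{r^2\log n_{\max}}{n_{\mathrm{tot}}},\qquad q\ge\frac{a(k-1)\log n_{\max}}{n_{\mathrm{tot}}}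 \] for a sufficiently large absolute constant $C_0$, and that $\lambda_r^{(j)}\ge4\|Z^{(j)}-A^{(j)}(A^{(j)})^\top\|$ for all $j$. Then with probability at least $1-O(n_{\max}^{-a})$, \[ \|T-\hat T\|_F\le C\left(k\sqrt r\,\kappa^2\sqrt{\frac{a\mu_1\mu_2r^2\log n_{\max}}{p\,n_{\mathrm{tot}}}}+2^kr^{1.5+k/2}\kappa^{2k}\sqrt{\frac{a(k-1)\mu_1^{k+1}\mu_2\log n_{\max}}{q\,n_{\mathrm{tot}}}}\right)\|T\|_F \] for an absolute constant $C$.
   Context: $\operatorname{unfold}_j(T)$ has entries $[\operatorname{unfold}_j(T)]_{i_j,(i_t)_{t\ne j}}=T_{i_1,\dots,i_k}$. $\|M\|_{2,\infty}=\max_i\|M_{i,\cdot}\|_2$; $\mathcal P_\Omega(T)$ equals $T$ on $\Omega$ and $0$ elsewhere; $\times_j$ is the mode-$j$ tensor–matrix product, so that $\operatorname{unfold}_j(\hat T)=Q^{(j)}\operatorname{unfold}_j(Y)\big(\bigotimes_{t\ne j}Q^{(t)}\big)$. Wedge matrix of $A\in\mathbb{R}^{n\times m}$ at rate $p$: each triple of $\{(i,\ell,j):1\le i\le j\le n,\ \ell\in[m]\}$ is sampled independently with probability $p$ (set $\tilde{\mathcal W}$); with $Z_{i\ell j}=p^{-1}A_{i\ell}A_{j\ell}e_ie_j^\top\mathbf 1\{(i,\ell,j)\in\tilde{\mathcal W}\}$, $Z=\sum_{i<j,\ell}(Z_{i\ell j}+Z_{i\ell j}^\top)+\sum_{i,\ell}Z_{i\ell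 i}$. *)

theory Defs
  imports "Jordan_Normal_Form.DL_Rank" "HOL-Probability.Product_PMF"
begin

text \<open>A k-way tensor with dimensions n = [n_1,...,n_k] is a function on index lists
  (only its values on idx n matter).\<close>

type_synonym tensor = "nat list \<Rightarrow> real"

definition idx :: "nat list \<Rightarrow> nat list set" where
  "idx n = {i. length i = length n \<and> (\<forall>t<length n. i ! t < n ! t)}"

definition remove_at :: "nat \<Rightarrow> 'a list \<Rightarrow> 'a list" where
  "remove_at j xs = take j xs @ drop (Suc j) xs"

definition insert_at :: "nat \<Rightarrow> 'a \<Rightarrow> 'a list \<Rightarrow> 'a list" where
  "insert_at j x xs = take j xs @ x # drop j xs"

text \<open>Mixed-radix decoding of a column number into the remaining indices.\<close>
fun dec :: "nat list \<Rightarrow> nat \<Rightarrow> nat list" where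
  "dec [] c = []"
| "dec (m # ms) c = (c mod m) # dec ms (c div m)"

definition Ndim :: "nat list \<Rightarrow> nat \<Rightarrow> nat" where
  "Ndim n j = prod_list (remove_at j n)"

definition unfold :: "nat list \<Rightarrow> nat \<Rightarrow> tensor \<Rightarrow> real mat" where
  "unfold n j T = Matrix.mat (n ! j) (Ndim n j)
      (\<lambda>(r, c). T (insert_at j r (dec (remove_at j n) c)))"

definition mode_prod :: "nat list \<Rightarrow> tensor \<Rightarrow> nat \<Rightarrow> real mat \<Rightarrow> tensor" where
  "mode_prod n X j M = (\<lambda>i. \<Sum>s<n ! j. M $$ (i ! j, s) * X (i[j := s]))"

definition multi_mode_prod :: "nat list \<Rightarrow> tensor \<Rightarrow> (nat \<Rightarrow> real mat) \<Rightarrow> tensor" where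
  "multi_mode_prod n Y Q = foldl (\<lambda>X j. mode_prod n X j (Q j)) Y [0..<length n]"

definition fro_norm :: "nat list \<Rightarrow> tensor \<Rightarrow> real" where
  "fro_norm n T = sqrt (\<Sum>i\<in>idx n. (T i)\<^sup>2)"

definition P_Omega :: "nat list set \<Rightarrow> tensor \<Rightarrow> tensor" where
  "P_Omega Om T = (\<lambda>i. if i \<in> Om then T i else 0)"

definition vnorm :: "real Matrix.vec \<Rightarrow> real" where
  "vnorm x = sqrt (x \<bullet> x)"

definition spec_norm :: "real mat \<Rightarrow> real" where
  "spec_norm M = Sup {vnorm (M *\<^sub>v x) | x. x \<in> carrier_vec (dim_col M) \<and> vnorm x \<le> 1}"

definition norm_2inf :: "real mat \<Rightarrow> real" where
  "norm_2inf M = Max {vnorm (Matrix.row M i) | i. i < dim_row M}"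

definition compact_svd :: "real mat \<Rightarrow> nat \<Rightarrow> real mat \<Rightarrow> real mat \<Rightarrow> real mat \<Rightarrow> bool" where
  "compact_svd A r U S V \<longleftrightarrow>
     U \<in> carrier_mat (dim_row A) r \<and> V \<in> carrier_mat (dim_col A) r \<and> S \<in> carrier_mat r r \<and>
     transpose_mat U * U = 1\<^sub>m r \<and> transpose_mat V * V = 1\<^sub>m r \<and>
     (\<forall>i<r. \<forall>l<r. i \<noteq> l \<longrightarrow> S $$ (i, l) = 0) \<and>
     (\<forall>i<r. S $$ (i, i) > 0) \<and>
     (\<forall>i l. i \<le> l \<and> l < r \<longrightarrow> S $$ (l, l) \<le> S $$ (i, i)) \<and>
     A = U * S * transpose_mat V"

definition top_eigvecs :: "real mat \<Rightarrow> nat \<Rightarrow> real mat \<Rightarrow> bool" where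
  "top_eigvecs Z r Uh \<longleftrightarrow>
     (\<exists>W mu. W \<in> carrier_mat (dim_row Z) (dim_row Z) \<and>
        transpose_mat W * W = 1\<^sub>m (dim_row Z) \<and>
        (\<forall>i l. i \<le> l \<and> l < dim_row Z \<longrightarrow> mu l \<le> mu i) \<and>
        Z = W * Matrix.mat (dim_row Z) (dim_row Z) (\<lambda>(i, l). if i = l then mu i else 0) * transpose_mat W \<and>
        r \<le> dim_row Z \<and>
        Uh = Matrix.mat (dim_row Z) r (\<lambda>(i, l). W $$ (i, l)))"

definition wedge_triples :: "nat \<Rightarrow> nat \<Rightarrow> (nat \<times> nat \<times> nat) set" where
  "wedge_triples n m = {(i, l, j). i \<le> j \<and> j < n \<and> l < m}"

text \<open>Z = \<Sum>_{i<j,l} (Z_ilj + Z_ilj^T) + \<Sum>_{i,l} Z_ili, written entrywise: entry (a,b) receives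
  p^{-1} A_{al} A_{bl} for every sampled triple (min a b, l, max a b).\<close>
definition wedge_matrix :: "real mat \<Rightarrow> real \<Rightarrow> (nat \<times> nat \<times> nat) set \<Rightarrow> real mat" where
  "wedge_matrix A p W = Matrix.mat (dim_row A) (dim_row A) (\<lambda>(a, b).
      \<Sum>l<dim_col A. if (min a b, l, max a b) \<in> W
                     then A $$ (a, l) * A $$ (b, l) / p else 0)"

definition rand_subset :: "'a set \<Rightarrow> real \<Rightarrow> 'a set pmf" where
  "rand_subset S p = map_pmf (\<lambda>f. {x \<in> S. f x}) (Pi_pmf S False (\<lambda>_. bernoulli_pmf p))"

end

theory Submission
  imports Defs
begin

text \<open>
  Only two quantities of the wedge noise \<open>E = Z - AA\<^sup>T\<close> of a mode have to be controlled. Since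
  \<open>\<parallel>E\<parallel> \<le> \<lambda>\<^sub>r/4\<close> is part of the event, the sin-theta argument applied to \<open>ZU - U\<Sigma>\<^sup>2 = EU\<close> gives
  \<open>\<parallel>(I - Q)A\<parallel>\<^sub>F \<le> 4/(3\<lambda>\<^sub>r) \<parallel>EU\<parallel>\<^sub>F \<parallel>A\<parallel>\<^sub>F\<close>, and \<open>\<parallel>EU\<parallel>\<^sub>F\<close> is the norm of a sum of independent vectors, so a
  Bernstein inequality in Hilbert space (Pinelis' \<open>cosh\<close> argument) suffices and no matrix concentration
  is needed. The bias of the estimator is bounded by the sum of these residuals over the modes;
  convexity of \<open>cosh\<close> bounds their average without a union bound over the \<open>k\<close> modes.

  The second quantity is the incoherence of the estimated eigenvectors, obtained by leaving out
  row and column \<open>a\<close> of \<open>E\<close>: the eigenvectors of the remaining matrix are independent of row \<open>a\<close>, so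
  Bernstein applies to the product of that row with them, and the sin-theta bound transfers the
  estimate back. The incoherence may fail in a few modes, whose number is controlled by Markov's
  inequality. Given incoherence, conditionally on the wedge samples the sampling error of \<open>\<Omega>\<close> is once
  more a sum of independent vectors.
\<close>

section \<open>A Bernstein bound for vector-valued Bernoulli sums\<close>

text \<open>The failure probability must not grow with \<open>k\<close>, and \<open>k\<close> is not
  bounded in terms of \<open>nmax\<close>: all dimensions may equal 2. So not even a tiny failure
  probability per mode can be summed over the modes. What saves the incoherence is that a failed
  mode still has eigenvector rows of norm at most 1, which exceeds the desired squared bound by a
  factor of at most \<open>nmax\<close>. If at most \<open>k / (4 * ln nmax)\<close> modes fail,
  their total loss is \<open>exp (k / 4)\<close>, at most \<open>(4 / 3) ^ k\<close>. Together with
  a factor 3 per mode this gives \<open>4 ^ k\<close>, whose square root is the \<open>2 ^ k\<close>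
  of the theorem. The constants follow backwards: the factor 3 comes from
  \<open>(17 / 10)^2\<close>, that from row noise at relative level \<open>lam / 40\<close>, and
  this level from the constant 20000 in the lower bound on \<open>p\<close>. A second obstacle is
  that the eigenvectors are not determined by the wedge sample, while the event quantifies over all
  choices, which might depend on \<open>Om\<close>. The spectral gap makes the projection unique, so
  one choice per wedge sample suffices.\<close>

lemma cosh_sqrt_convex:
  fixes a b t :: real
  assumes "0 \<le> t" "t \<le> 1"
  shows "cosh (sqrt ((1 - t) * a^2 + t * b^2)) \<le> (1 - t) * cosh a + t * cosh b"
proof -
  define s where "s = (1 - t) * a^2 + t * b^2"
  have s0: "0 \<le> s" using assms by (simp add: s_def)
  \<comment> \<open>The series of \<open>cosh\<close> has only even powers, with nonnegative
    coefficients; hence \<open>cosh (sqrt s)\<close> is a series in \<open>s\<close> of convex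
    functions on the half-line.\<close>
  define h where "h x n = (if even n then x ^ n /\<^sub>R fact n else 0)" for x :: real and n
  have h: "h x sums cosh x" for x using cosh_converges[of x] by (simp add: h_def[abs_def])
  have r1: "(\<lambda>n. (1 - t) * h a n + t * h b n) sums ((1 - t) * cosh a + t * cosh b)"
    by (intro sums_add sums_mult h)
  have r2: "h (sqrt s) n \<le> (1 - t) * h a n + t * h b n" for n
  proof (cases "even n")
    case True
    then obtain m where m: "n = 2 * m" by blast
    have cv: "convex_on {0..} (\<lambda>x::real. x ^ m)"
      by (cases "even m") (auto intro: convex_power_odd convex_on_subset[OF convex_power_even])
    have "s ^ m \<le> (1 - t) * (a^2) ^ m + t * (b^2) ^ m"
      using convex_onD[OF cv assms, of "a^2" "b^2"] by (simp add: s_def)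
    moreover have "(sqrt s) ^ n = s ^ m" using s0 by (simp add: m power_mult)
    moreover have "(a^2) ^ m = a ^ n" "(b^2) ^ m = b ^ n" by (simp_all add: m power_mult)
    ultimately have "(sqrt s) ^ n / fact n \<le> ((1 - t) * a ^ n + t * b ^ n) / fact n"
      by (intro divide_right_mono) auto
    then show ?thesis using True by (simp add: h_def field_simps)
  qed (simp add: h_def)
  have "cosh (sqrt s) \<le> (1 - t) * cosh a + t * cosh b"
    by (rule sums_le[OF r2 h r1])
  then show ?thesis by (simp add: s_def)
qed

lemma sinh_ge_self:
  fixes y :: real
  assumes "0 \<le> y"
  shows "y \<le> sinh y"
proof -
  have "\<exists>z. 0 < z \<and> z < y \<and> sinh y - sinh 0 = (y - 0) * cosh z" if "0 < y"
    by (intro MVT2 that) (auto intro!: derivative_eq_intros)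
  then show ?thesis using assms cosh_real_ge_1
    by (cases "y = 0") (auto simp: mult_le_cancel_left1 less_eq_real_def[of 0 y])
qed

text \<open>For fixed norms \<open>x\<close>, \<open>y\<close> of two vectors the left-hand side is convex in their inner product \<open>B\<close>
  and the right-hand side affine, so only the collinear cases \<open>B = \<plusminus>xy\<close> need checking.\<close>
lemma cosh_norm_add_bound:
  fixes x y B :: real
  assumes "0 \<le> x" "0 \<le> y" and B: "\<bar>B\<bar> \<le> x * y"
  shows "cosh (sqrt (x^2 + 2 * B + y^2)) \<le> cosh x * (exp y - y) + B * (sinh x / x)"
proof (cases "x * y = 0")
  case True
  then have xy: "x = 0 \<or> y = 0" by simp
  then have B0: "B = 0" using B by auto
  have "cosh y \<le> exp y - y" using sinh_ge_self[OF assms(2)] by (simp add: cosh_def sinh_def)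
  moreover have "1 \<le> exp y - y" using exp_ge_add_one_self[of y] by linarith
  ultimately show ?thesis using xy B0 by auto
next
  case False
  then have pos: "0 < x" "0 < y" using assms by auto
  \<comment> \<open>The weight that writes \<open>x^2 + 2 * B + y^2\<close> as a mean of
    \<open>(x - y)^2\<close> and \<open>(x + y)^2\<close>.\<close>
  define t where "t = (1 + B / (x * y)) / 2"
  have Bt: "B = (2 * t - 1) * (x * y)" using pos by (simp add: t_def field_simps)
  have "\<bar>B / (x * y)\<bar> \<le> 1" using B pos by (simp add: abs_mult)
  then have t: "0 \<le> t" "t \<le> 1" unfolding t_def abs_le_iff by auto
  have "x^2 + 2 * B + y^2 = (1 - t) * (x - y)^2 + t * (x + y)^2"
    unfolding Bt by (simp add: power2_eq_square algebra_simps)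
  then have "cosh (sqrt (x^2 + 2 * B + y^2)) \<le> (1 - t) * cosh (x - y) + t * cosh (x + y)"
    using cosh_sqrt_convex[OF t] by simp
  also have "\<dots> = cosh x * cosh y + (2 * t - 1) * (sinh x * sinh y)"
    by (simp add: cosh_add cosh_diff algebra_simps)
  \<comment> \<open>Split \<open>sinh y\<close> into \<open>y\<close> and \<open>sinh y - y\<close>.
    The first part stays linear in \<open>B\<close>; the second is absorbed because
    \<open>(2 * t - 1) * sinh x \<le> cosh x\<close>.\<close>
  also have "\<dots> \<le> cosh x * (exp y - y) + (2 * t - 1) * (y * sinh x)"
  proof -
    have d: "0 \<le> sinh y - y" using sinh_ge_self pos by simp
    have "(2 * t - 1) * sinh x \<le> 1 * sinh x" using t pos by (intro mult_right_mono) auto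
    also have "\<dots> \<le> cosh x" by (simp add: cosh_def sinh_def)
    finally have "(2 * t - 1) * sinh x * (sinh y - y) \<le> cosh x * (sinh y - y)"
      using d by (rule mult_right_mono)
    moreover have "exp y = cosh y + sinh y" by (simp add: cosh_plus_sinh)
    ultimately show ?thesis by (simp add: algebra_simps)
  qed
  also have "(2 * t - 1) * (y * sinh x) = B * (sinh x / x)" using pos by (simp add: Bt)
  finally show ?thesis .
qed

lemma L2_set_squared: "(L2_set f I)^2 = (\<Sum>i\<in>I. (f i)^2)"
  by (simp add: L2_set_def sum_nonneg)

lemma L2_set_scale: "L2_set (\<lambda>i. c * f i) I = \<bar>c\<bar> * L2_set f I"
  by (simp add: L2_set_def power_mult_distrib sum_distrib_left[symmetric] real_sqrt_mult)

lemma abs_sum_le_L2_set: "\<bar>\<Sum>i\<in>I. f i * g i\<bar> \<le> L2_set f I * L2_set g I"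
proof -
  have "\<bar>\<Sum>i\<in>I. f i * g i\<bar> \<le> (\<Sum>i\<in>I. \<bar>f i\<bar> * \<bar>g i\<bar>)"
    by (rule order_trans[OF sum_abs]) (simp add: abs_mult)
  then show ?thesis using L2_set_mult_ineq order_trans by blast
qed

text \<open>The last summand is the first-order term: \<open>sinh (L2_set v I) / L2_set v I\<close>
  times the inner product is the derivative of \<open>cosh\<close> of the norm in direction
  \<open>z\<close>. It is kept exact because it cancels when \<open>c\<close> is averaged over a
  centred variable.\<close>

lemma cosh_L2_set_add:
  "cosh (L2_set (\<lambda>i. v i + c * z i) I) \<le>
     cosh (L2_set v I) * (exp (\<bar>c\<bar> * L2_set z I) - \<bar>c\<bar> * L2_set z I)
     + c * ((\<Sum>i\<in>I. v i * z i) * (sinh (L2_set v I) / L2_set v I))"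
proof -
  let ?x = "L2_set v I" and ?y = "\<bar>c\<bar> * L2_set z I" and ?B = "c * (\<Sum>i\<in>I. v i * z i)"
  have "L2_set (\<lambda>i. v i + c * z i) I = sqrt (?x^2 + 2 * ?B + ?y^2)"
    unfolding L2_set_squared power_mult_distrib L2_set_def
    by (simp add: power2_sum sum.distrib sum_distrib_left power_mult_distrib sum_nonneg algebra_simps)
  moreover have "\<bar>?B\<bar> \<le> ?x * ?y"
    using mult_left_mono[OF abs_sum_le_L2_set[of v z I], of "\<bar>c\<bar>"]
    by (simp add: abs_mult algebra_simps)
  ultimately show ?thesis
    using cosh_norm_add_bound[of ?x ?y ?B] by (simp add: mult.assoc)
qed

text \<open>One step of the exponential supermartingale: the coefficient of \<open>z\<close> is
  \<open>1 / p - 1\<close> with probability \<open>p\<close> and \<open>-1\<close> otherwise, so it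
  has mean 0 and variance \<open>1 / p - 1\<close>.\<close>

lemma cosh_L2_set_bernoulli:
  assumes p: "0 < p" "p \<le> 1" and z: "L2_set z I / p \<le> 1"
  shows "p * cosh (L2_set (\<lambda>i. v i + (1 / p - 1) * z i) I)
         + (1 - p) * cosh (L2_set (\<lambda>i. v i + (-1) * z i) I)
         \<le> cosh (L2_set v I) * exp ((L2_set z I)^2 / p)"
proof -
  define x where "x = L2_set v I"
  define y where "y = L2_set z I"
  define H where "H = (\<Sum>i\<in>I. v i * z i) * (sinh x / x)"
  have y0: "0 \<le> y" "y / p \<le> 1" using z by (simp_all add: y_def)
  have pm: "0 \<le> 1 / p - 1" using p by simp
  have yp: "y \<le> y / p" using p y0 by (simp add: field_simps mult_left_le_one_le)
  \<comment> \<open>Both possible increments have norm at most 1, the range in which this quadratic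
    bound applies.\<close>
  have e: "exp u - u \<le> 1 + u^2" if "0 \<le> u" "u \<le> 1" for u :: real
    using exp_bound[OF that] by simp
  have u1: "(1 / p - 1) * y \<le> 1"
  proof -
    have "(1 / p - 1) * y = y / p - y" by (simp add: algebra_simps)
    then show ?thesis using y0 by linarith
  qed
  have 1: "cosh (L2_set (\<lambda>i. v i + (1 / p - 1) * z i) I)
      \<le> cosh x * (1 + ((1 / p - 1) * y)^2) + (1 / p - 1) * H"
  proof -
    have "cosh x * (exp ((1 / p - 1) * y) - (1 / p - 1) * y) \<le> cosh x * (1 + ((1 / p - 1) * y)^2)"
      using pm y0 u1 by (intro mult_left_mono e) auto
    then show ?thesis using cosh_L2_set_add[of v "1 / p - 1" z I]
      unfolding x_def[symmetric] y_def[symmetric] H_def[symmetric] abs_of_nonneg[OF pm] by linarith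
  qed
  have 2: "cosh (L2_set (\<lambda>i. v i + (-1) * z i) I) \<le> cosh x * (1 + y^2) - H"
  proof -
    have "cosh x * (exp y - y) \<le> cosh x * (1 + y^2)"
      using y0 yp by (intro mult_left_mono e) auto
    then show ?thesis using cosh_L2_set_add[of v "-1" z I]
      unfolding x_def[symmetric] y_def[symmetric] H_def[symmetric] abs_minus_cancel abs_one mult_1_left by linarith
  qed
  have "p * cosh (L2_set (\<lambda>i. v i + (1 / p - 1) * z i) I)
         + (1 - p) * cosh (L2_set (\<lambda>i. v i + (-1) * z i) I)
     \<le> p * (cosh x * (1 + ((1 / p - 1) * y)^2) + (1 / p - 1) * H) + (1 - p) * (cosh x * (1 + y^2) - H)"
    using p by (intro add_mono mult_left_mono 1 2) auto
  also have "\<dots> = cosh x * (1 + (1 / p - 1) * y^2)"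
  proof -
    have "p * (cosh x * (1 + (e * y)^2) + e * H) + (1 - p) * (cosh x * (1 + y^2) - H)
      = cosh x * (1 + (p * e * e + (1 - p)) * y^2) + (p * e - (1 - p)) * H" for e
      by (simp add: power2_eq_square algebra_simps)
    moreover have "p * (1 / p - 1) = 1 - p" using p by (simp add: right_diff_distrib)
    moreover have "(1 - p) * (1 / p - 1) + (1 - p) = 1 / p - 1" using p by (simp add: field_simps)
    ultimately show ?thesis by simp
  qed
  also have "\<dots> \<le> cosh x * exp (y^2 / p)"
  proof (intro mult_left_mono)
    have "1 + (1 / p - 1) * y^2 \<le> 1 + y^2 / p" by (simp add: algebra_simps)
    also have "\<dots> \<le> exp (y^2 / p)" by (rule exp_ge_add_one_self)
    finally show "1 + (1 / p - 1) * y^2 \<le> exp (y^2 / p)" .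
  qed simp
  finally show ?thesis by (simp add: x_def y_def)
qed

section \<open>Bernoulli random subsets and the tail of their vector-valued noise\<close>

abbreviation expect :: "'a pmf \<Rightarrow> ('a \<Rightarrow> real) \<Rightarrow> real" where
  "expect M \<equiv> measure_pmf.expectation M"

abbreviation pr :: "'a pmf \<Rightarrow> 'a set \<Rightarrow> real" where
  "pr M \<equiv> measure_pmf.prob M"

lemma finite_set_rand_subset: "finite S \<Longrightarrow> finite (set_pmf (rand_subset S p))"
  by (rule finite_subset[of _ "Pow S"]) (auto simp: rand_subset_def)

lemma set_rand_subset: "W \<in> set_pmf (rand_subset S p) \<Longrightarrow> W \<subseteq> S"
  by (auto simp: rand_subset_def)

text \<open>Independence of the restrictions to disjoint sets. It serves twice: to reveal one
  element in the moment induction, and to separate the triples of one row in the leave-one-out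
  argument.\<close>

lemma rand_subset_union:
  assumes "finite A" "finite B" "A \<inter> B = {}"
  shows "rand_subset (A \<union> B) p = map_pmf (\<lambda>(X, Y). X \<union> Y) (pair_pmf (rand_subset A p) (rand_subset B p))"
proof -
  have "{x \<in> A \<union> B. if x \<in> A then f x else g x} = {x \<in> A. f x} \<union> {x \<in> B. g x}" for f g
    using assms(3) by auto
  then show ?thesis
    unfolding rand_subset_def Pi_pmf_union[OF assms] map_pair[symmetric]
    by (simp add: map_pmf_comp case_prod_unfold o_def)
qed

lemma rand_subset_singleton: "rand_subset {x} p = map_pmf (\<lambda>b. if b then {x} else {}) (bernoulli_pmf p)"
  unfolding rand_subset_def Pi_pmf_singleton map_pmf_comp
  by (intro map_pmf_cong) auto

lemma expectation_pair_pmf_finite: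
  fixes f :: "'a \<times> 'b \<Rightarrow> real"
  assumes "finite (set_pmf P)" "finite (set_pmf Q)"
  shows "expect (pair_pmf P Q) f
       = expect P (\<lambda>x. expect Q (\<lambda>y. f (x, y)))"
proof -
  have "expect (pair_pmf P Q) f
      = (\<Sum>z\<in>set_pmf P \<times> set_pmf Q. f z * pmf (pair_pmf P Q) z)"
    using assms by (intro integral_measure_pmf_real) auto
  also have "\<dots> = (\<Sum>x\<in>set_pmf P. (\<Sum>y\<in>set_pmf Q. f (x, y) * pmf Q y) * pmf P x)"
    by (simp add: sum.cartesian_product' pmf_pair sum_distrib_left sum_distrib_right mult_ac)
  also have "\<dots> = (\<Sum>x\<in>set_pmf P. expect Q (\<lambda>y. f (x, y)) * pmf P x)"
    using assms by (intro sum.cong refl arg_cong2[where f = "(*)"] integral_measure_pmf_real[symmetric]) auto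
  also have "\<dots> = expect P (\<lambda>x. expect Q (\<lambda>y. f (x, y)))"
    using assms by (intro integral_measure_pmf_real[symmetric]) auto
  finally show ?thesis .
qed

lemma expectation_rand_subset_insert:
  assumes "finite S" "x \<notin> S" "0 \<le> p" "p \<le> 1"
  shows "expect (rand_subset (insert x S) p) f
       = expect (rand_subset S p) (\<lambda>W. p * f (insert x W) + (1 - p) * f W)"
proof -
  have "rand_subset (insert x S) p = map_pmf (\<lambda>(Y, X). X \<union> Y) (pair_pmf (rand_subset S p) (rand_subset {x} p))"
    using rand_subset_union[of S "{x}" p] assms
    by (simp add: Un_commute)
  then show ?thesis
    using assms finite_set_rand_subset[of S p] finite_set_rand_subset[of "{x}" p]
    by (simp add: expectation_pair_pmf_finite rand_subset_singleton case_prod_unfold algebra_simps)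
qed

text \<open>The error of the inverse-probability estimate of the sum of \<open>z s\<close> over
  \<open>S\<close>; each coefficient is centred under \<open>rand_subset S p\<close>.\<close>

definition noise :: "real \<Rightarrow> 's set \<Rightarrow> ('s \<Rightarrow> 'i \<Rightarrow> real) \<Rightarrow> 's set \<Rightarrow> 'i \<Rightarrow> real" where
  "noise p S z W i = (\<Sum>s\<in>S. ((if s \<in> W then 1 / p else 0) - 1) * z s i)"

text \<open>Each revealed element multiplies the moment by at most
  \<open>exp (\<theta>^2 * (L2_set (z s) I)^2 / p)\<close>. The dimension of the index set
  \<open>I\<close> never enters.\<close>

lemma noise_exp_moment:
  assumes S: "finite S" and p: "0 < p" "p \<le> 1" and \<theta>: "0 \<le> \<theta>"
    and b: "\<And>s. s \<in> S \<Longrightarrow> \<theta> * L2_set (z s) I / p \<le> 1"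
  shows "expect (rand_subset S p) (\<lambda>W. cosh (\<theta> * L2_set (noise p S z W) I))
       \<le> exp (\<theta>^2 * (\<Sum>s\<in>S. (L2_set (z s) I)^2) / p)"
  using S b
proof (induction S rule: finite_induct)
  case empty
  then show ?case by (simp add: noise_def L2_set_def)
next
  case (insert x S)
  define N where "N W i = \<theta> * noise p S z W i" for W i
  define zx where "zx i = \<theta> * z x i" for i
  have \<theta>L: "\<theta> * L2_set f I = L2_set (\<lambda>i. \<theta> * f i) I" for f
    using \<theta> by (simp add: L2_set_scale)
  let ?E = "expect (rand_subset S p)"
  have fin: "integrable (measure_pmf (rand_subset S p)) f" for f :: "_ \<Rightarrow> real"
    by (intro integrable_measure_pmf_finite finite_set_rand_subset insert)
  have "expect (rand_subset (insert x S) p) (\<lambda>W. cosh (\<theta> * L2_set (noise p (insert x S) z W) I))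
      = ?E (\<lambda>W. p * cosh (\<theta> * L2_set (noise p (insert x S) z (insert x W)) I)
           + (1 - p) * cosh (\<theta> * L2_set (noise p (insert x S) z W) I))"
    using insert p by (intro expectation_rand_subset_insert) auto
  also have "\<dots> \<le> ?E (\<lambda>W. cosh (L2_set (N W) I) * exp ((L2_set zx I)^2 / p))"
  proof (intro integral_mono_AE fin, rule AE_pmfI)
    fix W assume "W \<in> set_pmf (rand_subset S p)"
    then have W: "x \<notin> W" using set_rand_subset insert.hyps by blast
    have "(\<Sum>s\<in>S. ((if s = x \<or> s \<in> W then 1 / p else 0) - 1) * z s i)
        = (\<Sum>s\<in>S. ((if s \<in> W then 1 / p else 0) - 1) * z s i)" for i
      using insert.hyps by (intro sum.cong) auto
    then have 1: "\<theta> * noise p (insert x S) z (insert x W) i = N W i + (1 / p - 1) * zx i" for i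
      using insert.hyps by (simp add: noise_def N_def zx_def algebra_simps)
    have 2: "\<theta> * noise p (insert x S) z W i = N W i + (-1) * zx i" for i
      using insert.hyps W by (simp add: noise_def N_def zx_def algebra_simps)
    show "p * cosh (\<theta> * L2_set (noise p (insert x S) z (insert x W)) I)
           + (1 - p) * cosh (\<theta> * L2_set (noise p (insert x S) z W) I)
        \<le> cosh (L2_set (N W) I) * exp ((L2_set zx I)^2 / p)"
      unfolding \<theta>L 1 2 using insert.prems[of x] p \<theta>
      by (intro cosh_L2_set_bernoulli) (auto simp: zx_def[abs_def] L2_set_scale)
  qed
  also have "\<dots> = ?E (\<lambda>W. cosh (\<theta> * L2_set (noise p S z W) I)) * exp ((L2_set zx I)^2 / p)"
    by (simp add: N_def[abs_def] \<theta>L)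
  also have "\<dots> \<le> exp (\<theta>^2 * (\<Sum>s\<in>S. (L2_set (z s) I)^2) / p) * exp ((L2_set zx I)^2 / p)"
    using insert by (intro mult_right_mono insert.IH) auto
  also have "\<dots> = exp (\<theta>^2 * (\<Sum>s\<in>insert x S. (L2_set (z s) I)^2) / p)"
    using insert.hyps unfolding exp_add[symmetric]
    by (simp add: zx_def[abs_def] L2_set_scale power_mult_distrib add_divide_distrib distrib_left)
  finally show ?case .
qed

text \<open>With \<theta> = \<open>sqrt (L / v)\<close> the threshold becomes \<open>2 * L\<close>,
  and Markov's inequality leaves \<open>2 * exp (L - 2 * L)\<close>. The random variable is
  arbitrary so that the bound also serves for the average of the noise norms over the modes.\<close>

lemma prob_gt_le_of_cosh_moment:
  fixes f :: "'a \<Rightarrow> real"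
  assumes M: "finite (set_pmf M)" and v: "0 < v" "0 \<le> L"
    and m: "expect M (\<lambda>x. cosh (sqrt (L / v) * f x)) \<le> exp L"
  shows "pr M {x. f x > 2 * sqrt (v * L)} \<le> 2 * exp (- L)"
proof -
  have fin: "integrable (measure_pmf M) f" for f :: "_ \<Rightarrow> real"
    using M by (intro integrable_measure_pmf_finite)
  let ?A = "{x. f x > 2 * sqrt (v * L)}"
  have "pr M ?A = expect M (indicator ?A)" by simp
  also have "\<dots> \<le> expect M (\<lambda>x. 2 * exp (- 2 * L) * cosh (sqrt (L / v) * f x))"
  proof (intro integral_mono fin)
    fix x
    show "indicator ?A x \<le> 2 * exp (- 2 * L) * cosh (sqrt (L / v) * f x)"
    proof (cases "x \<in> ?A")
      case True
      have "sqrt (L / v) * sqrt (v * L) = L"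
        using v by (simp add: real_sqrt_mult[symmetric])
      then have "2 * L = sqrt (L / v) * (2 * sqrt (v * L))" by simp
      also have "\<dots> \<le> sqrt (L / v) * f x" using True v by (intro mult_left_mono) auto
      finally have "exp (2 * L) \<le> exp (sqrt (L / v) * f x)" by simp
      also have "\<dots> \<le> 2 * cosh (sqrt (L / v) * f x)" by (simp add: cosh_def)
      finally show ?thesis using True by (simp add: exp_minus field_simps)
    qed simp
  qed
  also have "\<dots> = 2 * exp (- 2 * L) * expect M (\<lambda>x. cosh (sqrt (L / v) * f x))"
    by simp
  also have "\<dots> \<le> 2 * exp (- 2 * L) * exp L" by (intro mult_left_mono m) auto
  also have "\<dots> = 2 * exp (- L)" by (simp add: exp_add[symmetric])
  finally show ?thesis .
qed

text \<open>\<open>b^2 * L \<le> v\<close> says that \<open>sqrt (L / v) * b \<le> 1\<close>: the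
  deviation stays in the Gaussian regime of Bernstein's inequality, where \<open>v\<close> alone
  matters.\<close>

lemma noise_cosh_moment:
  assumes S: "finite S" and p: "0 < p" "p \<le> 1" and v: "0 < v" "0 \<le> L"
    and b: "\<And>s. s \<in> S \<Longrightarrow> L2_set (z s) I / p \<le> b" and bL: "b^2 * L \<le> v"
    and V: "(\<Sum>s\<in>S. (L2_set (z s) I)^2) / p \<le> v"
  shows "expect (rand_subset S p) (\<lambda>W. cosh (sqrt (L / v) * L2_set (noise p S z W) I))
       \<le> exp L"
proof -
  have "expect (rand_subset S p) (\<lambda>W. cosh (sqrt (L / v) * L2_set (noise p S z W) I))
     \<le> exp ((sqrt (L / v))^2 * (\<Sum>s\<in>S. (L2_set (z s) I)^2) / p)"
  proof (intro noise_exp_moment S p)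
    fix s assume s: "s \<in> S"
    have b0: "0 \<le> b" using b[OF s] p by (rule_tac order_trans[OF _ b[OF s]]) simp
    have "sqrt (L / v) * L2_set (z s) I / p \<le> sqrt (L / v) * b"
      using mult_left_mono[OF b[OF s], of "sqrt (L / v)"] v by simp
    also have "\<dots> = sqrt (L / v * b^2)" using b0 by (simp only: real_sqrt_mult real_sqrt_abs abs_of_nonneg)
    also have "\<dots> \<le> 1" using bL v by (simp add: field_simps)
    finally show "sqrt (L / v) * L2_set (z s) I / p \<le> 1" .
  qed (use v in auto)
  also have "\<dots> = exp (L / v * ((\<Sum>s\<in>S. (L2_set (z s) I)^2) / p))" using v by simp
  also have "\<dots> \<le> exp (L / v * v)" using v V by (simp only: exp_le_cancel_iff) (intro mult_left_mono, auto)
  finally show ?thesis using v by simp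
qed

lemma noise_tail:
  assumes "finite S" "0 < p" "p \<le> 1" "0 < v" "0 \<le> L"
    and "\<And>s. s \<in> S \<Longrightarrow> L2_set (z s) I / p \<le> b" "b^2 * L \<le> v"
    and "(\<Sum>s\<in>S. (L2_set (z s) I)^2) / p \<le> v"
  shows "pr (rand_subset S p) {W. L2_set (noise p S z W) I > 2 * sqrt (v * L)} \<le> 2 * exp (- L)"
  using assms by (intro prob_gt_le_of_cosh_moment noise_cosh_moment finite_set_rand_subset)

section \<open>Orthonormal systems and the spectral theorem\<close>

type_synonym rvec = "nat \<Rightarrow> real"
type_synonym rmat = "nat \<Rightarrow> nat \<Rightarrow> real"
type_synonym triples = "(nat \<times> nat \<times> nat) set"

definition ip :: "nat \<Rightarrow> rvec \<Rightarrow> rvec \<Rightarrow> real" where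
  "ip n x y = (\<Sum>i<n. x i * y i)"

definition mv :: "nat \<Rightarrow> rmat \<Rightarrow> rvec \<Rightarrow> nat \<Rightarrow> real" where
  "mv n Z x i = (\<Sum>j<n. Z i j * x j)"

abbreviation nrm :: "nat \<Rightarrow> rvec \<Rightarrow> real" where
  "nrm n x \<equiv> L2_set x {..<n}"

text \<open>The vector index comes first: \<open>w c i\<close> is coordinate \<open>i\<close> of the
  vector \<open>w c\<close>, hence entry \<open>(i, c)\<close> of the matrix with these
  columns.\<close>

definition onsys :: "nat \<Rightarrow> nat \<Rightarrow> rmat \<Rightarrow> bool" where
  "onsys n m w \<longleftrightarrow> (\<forall>c<m. \<forall>d<m. ip n (w c) (w d) = (if c = d then 1 else 0))"

definition symm :: "nat \<Rightarrow> rmat \<Rightarrow> bool" where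
  "symm n Z \<longleftrightarrow> (\<forall>i<n. \<forall>j<n. Z i j = Z j i)"

definition eigsys :: "nat \<Rightarrow> rmat \<Rightarrow> rmat \<Rightarrow> rvec \<Rightarrow> bool" where
  "eigsys n Z w \<mu> \<longleftrightarrow> onsys n n w \<and> (\<forall>c<n. \<forall>i<n. mv n Z (w c) i = \<mu> c * w c i) \<and>
     (\<forall>c d. c \<le> d \<and> d < n \<longrightarrow> \<mu> d \<le> \<mu> c)"

lemma ip_commute: "ip n x y = ip n y x"
  by (simp add: ip_def mult.commute)

lemma ip_add_left: "ip n (\<lambda>i. x i + y i) z = ip n x z + ip n y z"
  by (simp add: ip_def sum.distrib algebra_simps)

lemma ip_add_right: "ip n z (\<lambda>i. x i + y i) = ip n z x + ip n z y"
  by (simp add: ip_def sum.distrib algebra_simps)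

lemma ip_diff_right: "ip n z (\<lambda>i. x i - y i) = ip n z x - ip n z y"
  by (simp add: ip_def sum_subtractf algebra_simps)

lemma ip_scale_left: "ip n (\<lambda>i. c * x i) z = c * ip n x z"
  by (simp add: ip_def sum_distrib_left mult_ac)

lemma ip_scale_right: "ip n z (\<lambda>i. c * x i) = c * ip n z x"
  by (simp add: ip_def sum_distrib_left mult_ac)

lemma ip_sum_left: "ip n (\<lambda>i. \<Sum>c\<in>I. f c * x c i) z = (\<Sum>c\<in>I. f c * ip n (x c) z)"
  unfolding ip_def sum_distrib_left sum_distrib_right by (subst sum.swap) (simp add: mult_ac)

lemma ip_sum_right: "ip n z (\<lambda>i. \<Sum>c\<in>I. f c * x c i) = (\<Sum>c\<in>I. f c * ip n z (x c))"
  unfolding ip_commute[of n z] by (rule ip_sum_left)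

lemma ip_cong: "(\<And>i. i < n \<Longrightarrow> x i = x' i) \<Longrightarrow> (\<And>i. i < n \<Longrightarrow> y i = y' i) \<Longrightarrow> ip n x y = ip n x' y'"
  by (simp add: ip_def)

lemma ip_self: "ip n x x = (nrm n x)^2"
  unfolding ip_def L2_set_squared by (simp add: power2_eq_square)

lemma ip_self_nonneg: "0 \<le> ip n x x"
  by (simp add: ip_self)

lemma abs_ip_le: "\<bar>ip n x y\<bar> \<le> nrm n x * nrm n y"
  unfolding ip_def by (rule abs_sum_le_L2_set)

lemma ip_mv_symm:
  assumes "symm n Z" shows "ip n x (mv n Z y) = ip n (mv n Z x) y"
proof -
  have "ip n x (mv n Z y) = (\<Sum>i<n. \<Sum>j<n. Z i j * x i * y j)"
    by (simp add: ip_def mv_def sum_distrib_left mult_ac)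
  also have "\<dots> = (\<Sum>j<n. \<Sum>i<n. Z j i * x i * y j)"
    using assms by (subst sum.swap) (auto simp: symm_def intro!: sum.cong)
  also have "\<dots> = ip n (mv n Z x) y"
    by (simp add: ip_def mv_def sum_distrib_right)
  finally show ?thesis .
qed

lemma mv_cong: "(\<And>i j. i < n \<Longrightarrow> j < n \<Longrightarrow> Z i j = Z' i j) \<Longrightarrow> i < n \<Longrightarrow> mv n Z x i = mv n Z' x i"
  by (simp add: mv_def)

lemma mv_add: "mv n (\<lambda>i j. G i j + E i j) x i = mv n G x i + mv n E x i"
  by (simp add: mv_def sum.distrib algebra_simps)

lemma mv_vec_add: "mv n Z (\<lambda>i. x i + t * y i) i = mv n Z x i + t * mv n Z y i"
  by (simp add: mv_def sum.distrib sum_distrib_left algebra_simps)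

lemma onsys_comb_norm:
  assumes "onsys n m w"
  shows "ip n (\<lambda>i. \<Sum>c<m. f c * w c i) (\<lambda>i. \<Sum>c<m. g c * w c i) = (\<Sum>c<m. f c * g c)"
proof -
  have "(\<Sum>d<m. g d * ip n (w c) (w d)) = g c" if "c < m" for c
  proof -
    have "(\<Sum>d<m. g d * ip n (w c) (w d)) = (\<Sum>d<m. if c = d then g d else 0)"
      using assms that by (intro sum.cong) (auto simp: onsys_def)
    then show ?thesis using that by simp
  qed
  then show ?thesis unfolding ip_sum_left ip_sum_right by simp
qed

lemma onsys_bessel:
  assumes "onsys n m w"
  shows "(\<Sum>c<m. (ip n x (w c))^2) \<le> ip n x x"
proof -
  let ?y = "\<lambda>i. \<Sum>c<m. ip n x (w c) * w c i"
  have "0 \<le> ip n (\<lambda>i. x i + (-1) * ?y i) (\<lambda>i. x i + (-1) * ?y i)" by (rule ip_self_nonneg)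
  also have "\<dots> = ip n x x - 2 * ip n x ?y + ip n ?y ?y"
    unfolding ip_add_left ip_add_right ip_scale_left ip_scale_right
    by (simp add: ip_commute[of n ?y x])
  also have "ip n ?y ?y = (\<Sum>c<m. (ip n x (w c))^2)"
    by (simp add: onsys_comb_norm[OF assms] power2_eq_square)
  also have "ip n x ?y = (\<Sum>c<m. (ip n x (w c))^2)"
    by (simp add: ip_sum_right power2_eq_square)
  finally show ?thesis by simp
qed

text \<open>Rows of a square matrix with orthonormal columns are orthonormal too, since a left
  inverse is also a right inverse.\<close>

lemma onsys_complete:
  assumes "onsys n n w" "i < n" "j < n"
  shows "(\<Sum>c<n. w c i * w c j) = (if i = j then 1 else 0)"
proof -
  define W where "W = Matrix.mat n n (\<lambda>(i, c). w c i)"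
  have W: "W \<in> carrier_mat n n" "transpose_mat W \<in> carrier_mat n n" by (auto simp: W_def)
  have "transpose_mat W * W = 1\<^sub>m n"
    using assms(1) by (intro eq_matI)
      (auto simp: W_def scalar_prod_def onsys_def ip_def lessThan_atLeast0)
  then have "W * transpose_mat W = 1\<^sub>m n" using mat_mult_left_right_inverse W by blast
  then have "(W * transpose_mat W) $$ (i, j) = (1\<^sub>m n) $$ (i, j)" by simp
  then show ?thesis using assms(2,3)
    by (auto simp: W_def scalar_prod_def lessThan_atLeast0)
qed

lemma onsys_expand:
  assumes "onsys n n w" "i < n"
  shows "(\<Sum>c<n. ip n x (w c) * w c i) = x i"
proof -
  have "(\<Sum>c<n. ip n x (w c) * w c i) = (\<Sum>j<n. x j * (\<Sum>c<n. w c j * w c i))"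
    unfolding ip_def sum_distrib_left sum_distrib_right by (subst sum.swap) (simp add: mult_ac)
  also have "\<dots> = (\<Sum>j<n. if j = i then x j else 0)"
    using assms by (intro sum.cong) (auto simp: onsys_complete)
  finally show ?thesis using assms by simp
qed

lemma onsys_parseval:
  assumes "onsys n n w"
  shows "(\<Sum>c<n. ip n x (w c) * ip n y (w c)) = ip n x y"
proof -
  have "ip n x y = ip n (\<lambda>i. \<Sum>c<n. ip n x (w c) * w c i) (\<lambda>i. \<Sum>c<n. ip n y (w c) * w c i)"
    using assms by (intro ip_cong) (auto simp: onsys_expand)
  then show ?thesis using onsys_comb_norm[OF assms] by simp
qed

section \<open>Eigenbases by successive maximisation of the Rayleigh quotient\<close>

lemma homogeneous_nontrivial:
  "\<exists>\<alpha>::nat \<Rightarrow> real. (\<exists>b\<le>m. \<alpha> b \<noteq> 0) \<and> (\<forall>d<m. (\<Sum>b\<le>m. \<alpha> b * M b d) = 0)"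
proof -
  define c where "c d = Matrix.vec (Suc m) (\<lambda>b. M b d)" for d
  \<comment> \<open>A zero row is appended to the \<open>m\<close> equations in \<open>m + 1\<close>
    unknowns, which makes the system square and singular.\<close>
  define A where "A = mat\<^sub>r (Suc m) (Suc m) (\<lambda>i. if i = m then 0\<^sub>v (Suc m) else c i)"
  have A: "A \<in> carrier_mat (Suc m) (Suc m)" by (simp add: A_def)
  have "Determinant.det A = 0" unfolding A_def using Determinant.det_row_0[of m "Suc m" c] by (auto simp: c_def)
  then obtain v where v: "v \<in> carrier_vec (Suc m)" "v \<noteq> 0\<^sub>v (Suc m)" "A *\<^sub>v v = 0\<^sub>v (Suc m)"
    using det_0_iff_vec_prod_zero[OF A] by auto
  have "\<exists>b\<le>m. vec_index v b \<noteq> 0"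
  proof (rule ccontr)
    assume "\<not> ?thesis"
    then have "v = 0\<^sub>v (Suc m)" using v(1) by (intro eq_vecI) auto
    then show False using v(2) by simp
  qed
  moreover have "(\<Sum>b\<le>m. vec_index v b * M b d) = 0" if "d < m" for d
  proof -
    have "vec_index (A *\<^sub>v v) d = 0" using v(3) that by simp
    moreover have "vec_index (A *\<^sub>v v) d = (\<Sum>b\<le>m. vec_index v b * M b d)"
      using that v(1)
      by (auto simp: A_def c_def scalar_prod_def mult_mat_vec_def atLeast0LessThan lessThan_Suc_atMost mult.commute
          intro!: sum.cong)
    ultimately show ?thesis by simp
  qed
  ultimately show ?thesis by (intro exI[of _ "\<lambda>b. vec_index v b"]) auto
qed

text \<open>A nontrivial solution of the \<open>m\<close> orthogonality conditions is sought among
  vectors supported on the first \<open>m + 1\<close> coordinates. Vanishing from \<open>n\<close>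
  on is recorded because the compactness argument for the Rayleigh quotient takes place in the space
  of all sequences.\<close>

lemma onsys_orth_exists:
  assumes m: "m < n"
  shows "\<exists>x. ip n x x = 1 \<and> (\<forall>c<m. ip n x (w c) = 0) \<and> (\<forall>i\<ge>n. x i = 0)"
proof -
  obtain \<alpha> b where \<alpha>: "b \<le> m" "\<alpha> b \<noteq> 0" "\<And>d. d < m \<Longrightarrow> (\<Sum>b\<le>m. \<alpha> b * w d b) = 0"
    using homogeneous_nontrivial[of m "\<lambda>b d. w d b"] by blast
  define y where "y i = (if i \<le> m then \<alpha> i else 0)" for i
  have orth: "ip n y (w d) = 0" if "d < m" for d
  proof -
    have "ip n y (w d) = (\<Sum>i<n. if i \<le> m then \<alpha> i * w d i else 0)"
      by (auto simp: ip_def y_def intro!: sum.cong)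
    also have "\<dots> = (\<Sum>b\<le>m. \<alpha> b * w d b)"
      using m by (subst sum.inter_filter[symmetric]) (auto intro!: sum.cong)
    finally show ?thesis using \<alpha>(3) that by simp
  qed
  have "0 < (\<Sum>i<n. y i * y i)"
    using \<alpha>(1,2) m by (intro sum_pos2[of _ b]) (auto simp: y_def simp flip: power2_eq_square)
  then have pos: "0 < ip n y y" by (simp add: ip_def)
  define x where "x i = (1 / sqrt (ip n y y)) * y i" for i
  have "ip n x x = 1"
    using pos unfolding x_def ip_scale_left ip_scale_right by simp
  moreover have "ip n x (w c) = 0" if "c < m" for c
    unfolding x_def ip_scale_left using orth that by simp
  ultimately show ?thesis using m by (intro exI[of _ x]) (auto simp: x_def y_def)
qed

text \<open>The admissible unit vectors form a closed subset of a product of intervals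
  \<open>{-1..1}\<close>, compact by Tychonoff, so the quadratic form attains its supremum;
  homogeneity removes the normalisation of \<open>y\<close>.\<close>

lemma rayleigh_max_exists:
  assumes "m < n"
  shows "\<exists>x. ip n x x = 1 \<and> (\<forall>c<m. ip n x (w c) = 0) \<and>
           (\<forall>y. (\<forall>c<m. ip n y (w c) = 0) \<longrightarrow> ip n y (mv n Z y) \<le> ip n x (mv n Z x) * ip n y y)"
proof -
  define K where "K = {x. ip n x x = 1 \<and> (\<forall>c<m. ip n x (w c) = 0) \<and> (\<forall>i\<ge>n. x i = 0)}"
  have co[continuous_intros]: "continuous_on A (\<lambda>x. x i)" for A and i :: nat
    by (rule continuous_on_subset[OF continuous_on_product_coordinates]) auto
  have cip: "closed {x. ip n x x = 1}" "closed {x. ip n x (w c) = 0}" "closed {x::nat \<Rightarrow> real. x i = 0}" for c i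
    unfolding ip_def by (intro closed_Collect_eq continuous_intros)+
  have "closed K"
  proof -
    have "K = {x. ip n x x = 1} \<inter> (\<Inter>c\<in>{..<m}. {x. ip n x (w c) = 0}) \<inter> (\<Inter>i\<in>{n..}. {x. x i = 0})"
      by (auto simp: K_def)
    then show ?thesis using cip by (auto intro!: closed_Int closed_INT)
  qed
  moreover have "compact (PiE UNIV (\<lambda>_::nat. {-1..1::real}))"
    unfolding compactin_euclidean_iff[symmetric] euclidean_product_topology[symmetric] compactin_PiE
    by (simp add: compactin_euclidean_iff)
  moreover have "K \<subseteq> PiE UNIV (\<lambda>_::nat. {-1..1::real})"
  proof
    fix x assume x: "x \<in> K"
    have "\<bar>x i\<bar> \<le> 1" for i
    proof (cases "i < n")
      case True
      have "(x i)^2 \<le> (\<Sum>i<n. (x i)^2)" using True by (intro member_le_sum) auto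
      also have "\<dots> = 1" using x by (simp add: K_def ip_def power2_eq_square)
      finally show ?thesis by (simp add: abs_square_le_1)
    qed (use x in \<open>auto simp: K_def\<close>)
    then show "x \<in> PiE UNIV (\<lambda>_::nat. {-1..1::real})" by (auto simp: PiE_def abs_le_iff minus_le_iff)
  qed
  ultimately have "compact K"
    by (metis compact_Int_closed inf.absorb2)
  moreover have "K \<noteq> {}" using onsys_orth_exists[OF assms] by (auto simp: K_def)
  moreover have "continuous_on K (\<lambda>x. ip n x (mv n Z x))"
    unfolding ip_def mv_def by (intro continuous_intros)
  ultimately obtain x where x: "x \<in> K" "\<And>y. y \<in> K \<Longrightarrow> ip n y (mv n Z y) \<le> ip n x (mv n Z x)"
    using continuous_attains_sup by meson
  have "ip n y (mv n Z y) \<le> ip n x (mv n Z x) * ip n y y" if y: "\<forall>c<m. ip n y (w c) = 0" for y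
  proof (cases "ip n y y = 0")
    case True
    then have "\<forall>i\<in>{..<n}. y i * y i = 0"
      unfolding ip_def by (subst (asm) sum_nonneg_eq_0_iff) auto
    then have "ip n y (mv n Z y) = 0" by (simp add: ip_def)
    then show ?thesis using True by simp
  next
    case False
    then have pos: "0 < ip n y y" using ip_self_nonneg[of n y] by linarith
    let ?s = "1 / sqrt (ip n y y)"
    define z where "z i = ?s * (if i < n then y i else 0)" for i
    have e: "ip n z u = ?s * ip n y u" for u
      unfolding z_def ip_scale_left by (simp add: ip_def)
    have zz: "ip n z z = 1" using pos e[of z] e[of y] by (simp add: ip_commute[of n y z])
    have "mv n Z z i = ?s * mv n Z y i" for i
      by (simp add: mv_def z_def sum_distrib_left mult_ac)
    then have "mv n Z z = (\<lambda>i. ?s * mv n Z y i)" by blast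
    then have "ip n z (mv n Z z) = ?s * (?s * ip n y (mv n Z y))"
      by (simp only: e ip_scale_right)
    also have "\<dots> = ip n y (mv n Z y) / ip n y y" using pos by simp
    finally have q: "ip n z (mv n Z z) = ip n y (mv n Z y) / ip n y y" .
    have "z \<in> K" using y zz e by (auto simp: K_def) (simp add: z_def)
    then show ?thesis using x(2)[of z] q pos by (simp add: field_simps)
  qed
  then show ?thesis using x(1) by (intro exI[of _ x]) (auto simp: K_def)
qed

text \<open>The residual \<open>g\<close> of the eigenvalue equation is orthogonal to
  \<open>x\<close> and to all \<open>w c\<close>, so \<open>x + t * g\<close> is a legal competitor.
  It gains \<open>2 * t * ip n g g\<close> to first order in \<open>t\<close>, which contradicts
  maximality unless \<open>g\<close> vanishes.\<close>

lemma rayleigh_max_eigenvector: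
  assumes Z: "symm n Z" and x: "ip n x x = 1" and xw: "\<And>c. c < m \<Longrightarrow> ip n x (w c) = 0"
    and w: "\<And>c i. c < m \<Longrightarrow> i < n \<Longrightarrow> mv n Z (w c) i = \<mu> c * w c i"
    and mx: "\<And>y. (\<forall>c<m. ip n y (w c) = 0) \<Longrightarrow> ip n y (mv n Z y) \<le> ip n x (mv n Z x) * ip n y y"
    and i: "i < n"
  shows "mv n Z x i = ip n x (mv n Z x) * x i"
proof -
  define \<rho> where "\<rho> = ip n x (mv n Z x)"
  define g where "g i = mv n Z x i - \<rho> * x i" for i
  have gw: "ip n g (w c) = 0" if "c < m" for c
  proof -
    have "ip n g (w c) = ip n (w c) (mv n Z x) - \<rho> * ip n (w c) x"
      unfolding g_def by (subst ip_commute) (simp only: ip_diff_right ip_scale_right)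
    also have "ip n (w c) (mv n Z x) = ip n (\<lambda>i. \<mu> c * w c i) x"
      using w[OF that] by (simp add: ip_mv_symm[OF Z] cong: ip_cong)
    finally show ?thesis using xw[OF that] by (simp add: ip_scale_left ip_commute[of n "w c" x])
  qed
  have gx: "ip n x g = 0" unfolding g_def ip_diff_right ip_scale_right \<rho>_def x by simp
  have gZ: "ip n g (mv n Z x) = ip n g g"
  proof -
    have "ip n g (mv n Z x) = ip n g (\<lambda>i. g i + \<rho> * x i)" by (simp add: g_def)
    then show ?thesis using gx by (simp add: ip_add_right ip_scale_right ip_commute[of n g x])
  qed
  define c where "c = ip n g (mv n Z g) - \<rho> * ip n g g"
  have ineq: "2 * t * ip n g g + t^2 * c \<le> 0" for t
  proof -
    let ?y = "\<lambda>i. x i + t * g i"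
    have "ip n ?y (mv n Z ?y) \<le> \<rho> * ip n ?y ?y"
      unfolding \<rho>_def using xw gw by (intro mx) (simp add: ip_add_left ip_scale_left)
    moreover have "ip n ?y ?y = 1 + t^2 * ip n g g"
      unfolding ip_add_left ip_add_right ip_scale_left ip_scale_right
      using gx x by (simp add: ip_commute[of n g x] power2_eq_square)
    moreover have "mv n Z ?y = (\<lambda>i. mv n Z x i + t * mv n Z g i)" by (intro ext mv_vec_add)
    then have "ip n ?y (mv n Z ?y) = \<rho> + 2 * t * ip n g g + t^2 * ip n g (mv n Z g)"
      by (simp add: ip_add_left ip_add_right ip_scale_left ip_scale_right gZ \<rho>_def
          ip_mv_symm[OF Z, of x g] ip_commute[of n "mv n Z x" g] power2_eq_square algebra_simps)
    ultimately show ?thesis by (simp add: c_def algebra_simps)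
  qed
  have "ip n g g = 0"
  proof (rule ccontr)
    assume "ip n g g \<noteq> 0"
    then have pos: "0 < ip n g g" using ip_self_nonneg[of n g] by linarith
    \<comment> \<open>Small enough for the linear gain to dominate the quadratic term
      \<open>t^2 * c\<close>, whatever the sign of \<open>c\<close>.\<close>
    define t where "t = ip n g g / (\<bar>c\<bar> + 1)"
    have t: "0 < t" using pos by (simp add: t_def)
    have "t * \<bar>c\<bar> < ip n g g"
    proof -
      have "t * \<bar>c\<bar> < t * (\<bar>c\<bar> + 1)" using t by simp
      also have "\<dots> = ip n g g" by (simp add: t_def)
      finally show ?thesis .
    qed
    moreover have "- (t * c) \<le> t * \<bar>c\<bar>" using t by (simp add: abs_if mult_le_0_iff)
    ultimately have "0 < 2 * ip n g g + t * c" using pos by linarith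
    then have "0 < t * (2 * ip n g g + t * c)" using t by simp
    then show False using ineq[of t] by (simp add: power2_eq_square algebra_simps)
  qed
  then have "\<forall>i\<in>{..<n}. g i * g i = 0"
    unfolding ip_def by (subst (asm) sum_nonneg_eq_0_iff) auto
  then show ?thesis using i by (simp add: g_def \<rho>_def)
qed

text \<open>The induction also carries maximality of each \<open>w c\<close> on the complement of
  its predecessors; this is what orders the eigenvalues. The eigenbasis of the wedge matrix is
  given, but those of the leave-one-out matrices have to be constructed.\<close>

lemma symm_eigsys_exists:
  assumes Z: "symm n Z"
  shows "\<exists>w \<mu>. eigsys n Z w \<mu>"
proof -
  have "\<exists>w \<mu>. onsys n m w \<and> (\<forall>c<m. \<forall>i<n. mv n Z (w c) i = \<mu> c * w c i) \<and>
      (\<forall>c<m. \<forall>y. (\<forall>b<c. ip n y (w b) = 0) \<longrightarrow> ip n y (mv n Z y) \<le> \<mu> c * ip n y y)" if "m \<le> n" for m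
    using that
  proof (induction m)
    case 0
    then show ?case by (simp add: onsys_def)
  next
    case (Suc m)
    from Suc.IH[OF Suc_leD[OF Suc.prems]] obtain w \<mu> where w: "onsys n m w" "\<And>c i. c < m \<Longrightarrow> i < n \<Longrightarrow> mv n Z (w c) i = \<mu> c * w c i"
      "\<And>c y. c < m \<Longrightarrow> (\<forall>b<c. ip n y (w b) = 0) \<Longrightarrow> ip n y (mv n Z y) \<le> \<mu> c * ip n y y"
      by blast
    from Suc.prems obtain x where x: "ip n x x = 1" "\<And>c. c < m \<Longrightarrow> ip n x (w c) = 0"
      "\<And>y. (\<forall>c<m. ip n y (w c) = 0) \<Longrightarrow> ip n y (mv n Z y) \<le> ip n x (mv n Z x) * ip n y y"
      using rayleigh_max_exists[of m n w Z] by auto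
    have ev: "mv n Z x i = ip n x (mv n Z x) * x i" if "i < n" for i
      by (rule rayleigh_max_eigenvector[OF Z x(1,2) w(2) x(3) that])
    let ?w = "w(m := x)" and ?\<mu> = "\<mu>(m := ip n x (mv n Z x))"
    have "ip n (w c) x = 0" if "c < m" for c
      using x(2)[OF that] by (subst ip_commute)
    then have "onsys n (Suc m) ?w"
      using w(1) x(1,2) by (auto simp: onsys_def less_Suc_eq)
    moreover have "\<forall>c<Suc m. \<forall>i<n. mv n Z (?w c) i = ?\<mu> c * ?w c i"
      using w(2) ev by (auto simp: less_Suc_eq)
    moreover have "\<forall>c<Suc m. \<forall>y. (\<forall>b<c. ip n y (?w b) = 0) \<longrightarrow> ip n y (mv n Z y) \<le> ?\<mu> c * ip n y y"
      using w(3) x(3) by (auto simp: less_Suc_eq)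
    ultimately show ?case by blast
  qed
  from this[OF order_refl] obtain w \<mu> where w: "onsys n n w" "\<And>c i. c < n \<Longrightarrow> i < n \<Longrightarrow> mv n Z (w c) i = \<mu> c * w c i"
    "\<And>c y. c < n \<Longrightarrow> (\<forall>b<c. ip n y (w b) = 0) \<Longrightarrow> ip n y (mv n Z y) \<le> \<mu> c * ip n y y"
    by blast
  have "\<mu> d \<le> \<mu> c" if "c \<le> d" "d < n" for c d
  proof -
    have "ip n (w d) (mv n Z (w d)) = ip n (w d) (\<lambda>i. \<mu> d * w d i)"
      using w(2) that by (intro ip_cong) auto
    then have "ip n (w d) (mv n Z (w d)) = \<mu> d" "ip n (w d) (w d) = 1"
      using w(1) that by (auto simp: ip_scale_right onsys_def)
    moreover have "\<forall>b<c. ip n (w d) (w b) = 0" using w(1) that by (auto simp: onsys_def)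
    ultimately show ?thesis using w(3)[of c "w d"] that by simp
  qed
  then show ?thesis using w unfolding eigsys_def by blast
qed

section \<open>Weyl and sin-theta bounds\<close>

definition ev :: rmat where
  "ev b i = (if i = b then 1 else 0)"

text \<open>\<open>\<parallel>Q x\<parallel>\<close>, where \<open>Q\<close> projects onto the span of \<open>w\<^sub>0, \<dots>, w\<^sub>r\<^sub>-\<^sub>1\<close>; for \<open>x = e\<^sub>b\<close> it is the norm of
  row \<open>b\<close> of the matrix with these columns.\<close>
definition pn :: "nat \<Rightarrow> nat \<Rightarrow> rmat \<Rightarrow> rvec \<Rightarrow> real" where
  "pn n r w x = L2_set (\<lambda>c. ip n x (w c)) {..<r}"

text \<open>The Frobenius sin-theta distance between the spans of the first \<open>r\<close> vectors of two orthonormal bases.\<close>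
definition sgap :: "nat \<Rightarrow> nat \<Rightarrow> rmat \<Rightarrow> rmat \<Rightarrow> real" where
  "sgap n r w v = sqrt (\<Sum>c<r. \<Sum>d\<in>{r..<n}. (ip n (w c) (v d))^2)"

definition Gm :: "nat \<Rightarrow> rvec \<Rightarrow> rmat \<Rightarrow> nat \<Rightarrow> nat \<Rightarrow> real" where
  "Gm r s U i j = (\<Sum>d<r. s d * U d i * U d j)"

abbreviation "eig_res n Z v \<nu> d \<equiv> nrm n (\<lambda>i. mv n Z (v d) i - \<nu> d * v d i)"

lemma ip_ev: "b < n \<Longrightarrow> ip n (ev b) x = x b"
proof -
  assume "b < n"
  have "ip n (ev b) x = (\<Sum>i<n. if i = b then x i else 0)"
    unfolding ip_def ev_def by (intro sum.cong) auto
  then show ?thesis using \<open>b < n\<close> by simp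
qed

lemma nrm_ev: "b < n \<Longrightarrow> nrm n (ev b) = 1"
  using ip_ev[of b n "ev b"] ip_self[of n "ev b"] by (simp add: ev_def power2_eq_1_iff)
     (metis L2_set_nonneg not_one_le_zero neg_0_le_iff_le)

lemma pn_nonneg [simp]: "0 \<le> pn n r w x"
  by (simp add: pn_def)

lemma pn_squared: "(pn n r w x)^2 = (\<Sum>c<r. (ip n x (w c))^2)"
  by (simp add: pn_def L2_set_squared)

lemma pn_le_nrm:
  assumes "onsys n m w" "r \<le> m"
  shows "pn n r w x \<le> nrm n x"
proof -
  have "onsys n r w" using assms by (auto simp: onsys_def)
  then have "(pn n r w x)^2 \<le> (nrm n x)^2"
    using onsys_bessel by (simp add: pn_squared ip_self[symmetric])
  then show ?thesis by (rule power2_le_imp_le) simp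
qed

lemma pn_add: "pn n r w (\<lambda>i. x i + y i) \<le> pn n r w x + pn n r w y"
  unfolding pn_def ip_add_left by (rule L2_set_triangle_ineq)

lemma pn_ev: "b < n \<Longrightarrow> (pn n r w (ev b))^2 = (\<Sum>c<r. (w c b)^2)"
  by (simp add: pn_squared ip_ev)

text \<open>Count the squared entries twice: the columns sum to \<open>r\<close>, and by Bessel each
  of the \<open>n\<close> rows contributes at most 1.\<close>

lemma onsys_dim_le:
  assumes "onsys n r U" shows "r \<le> n"
proof -
  have "real r = (\<Sum>c<r. ip n (U c) (U c))" using assms by (simp add: onsys_def)
  also have "\<dots> = (\<Sum>i<n. \<Sum>c<r. (U c i)^2)"
    unfolding ip_def by (subst sum.swap) (simp add: power2_eq_square)
  also have "\<dots> \<le> (\<Sum>i<n. 1)"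
  proof (intro sum_mono)
    fix i assume "i \<in> {..<n}"
    then show "(\<Sum>c<r. (U c i)^2) \<le> 1"
      using onsys_bessel[OF assms, of "ev i"] by (simp add: ip_ev ev_def)
  qed
  finally show ?thesis by simp
qed

lemma sum_lessThan_split:
  fixes f :: rvec
  assumes "r \<le> n" shows "(\<Sum>d<n. f d) = (\<Sum>d<r. f d) + (\<Sum>d\<in>{r..<n}. f d)"
  using assms by (metis atLeast0LessThan sum.atLeastLessThan_concat zero_le)

text \<open>Both squared distances equal \<open>r\<close> minus the total squared overlap of the two
  \<open>r\<close>-dimensional spans, which is symmetric.\<close>

lemma sgap_commute:
  assumes w: "onsys n n w" and v: "onsys n n v" and r: "r \<le> n"
  shows "sgap n r w v = sgap n r v w"
proof -
  note sp = sum_lessThan_split[OF r]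
  have tot: "(\<Sum>c<r. \<Sum>d<r. (ip n (w c) (v d))^2) + (\<Sum>c<r. \<Sum>d\<in>{r..<n}. (ip n (w c) (v d))^2) = real r"
    if "onsys n n w" "onsys n n v" for w v
  proof -
    have "(\<Sum>d<n. (ip n (w c) (v d))^2) = 1" if "c < r" for c
      using onsys_parseval[OF \<open>onsys n n v\<close>, of "w c" "w c"] \<open>onsys n n w\<close> that r
      by (simp add: power2_eq_square onsys_def)
    then have "(\<Sum>c<r. \<Sum>d<n. (ip n (w c) (v d))^2) = real r" by simp
    then show ?thesis by (simp add: sp sum.distrib)
  qed
  have "(\<Sum>c<r. \<Sum>d<r. (ip n (w c) (v d))^2) = (\<Sum>c<r. \<Sum>d<r. (ip n (v c) (w d))^2)"
    by (subst sum.swap) (simp add: ip_commute)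
  then show ?thesis unfolding sgap_def using tot[OF w v] tot[OF v w] by simp
qed

lemma sgap_nonneg [simp]: "0 \<le> sgap n r w v"
  by (simp add: sgap_def sum_nonneg)

lemma sgap_squared: "(sgap n r w v)^2 = (\<Sum>c<r. \<Sum>d\<in>{r..<n}. (ip n (w c) (v d))^2)"
  by (simp add: sgap_def sum_nonneg)

text \<open>Split \<open>x\<close> along the basis \<open>v\<close>. On the span of the first
  \<open>r\<close> vectors projecting onto the \<open>w c\<close> does not increase the norm; the
  remainder meets the \<open>w c\<close> only through the inner products collected in
  \<open>sgap\<close>.\<close>

lemma pn_close:
  assumes w: "onsys n n w" and v: "onsys n n v" and r: "r \<le> n"
  shows "pn n r w x \<le> pn n r v x + sgap n r w v * nrm n x"
proof -
  note sp = sum_lessThan_split[OF r]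
  define y where "y i = (\<Sum>d<r. ip n x (v d) * v d i)" for i
  define h where "h c = (\<Sum>d\<in>{r..<n}. ip n x (v d) * ip n (w c) (v d))" for c
  have "ip n x (w c) = ip n y (w c) + h c" for c
  proof -
    have "ip n x (w c) = (\<Sum>d<n. ip n x (v d) * ip n (w c) (v d))"
      by (simp add: onsys_parseval[OF v])
    then show ?thesis unfolding y_def h_def ip_sum_left by (simp add: sp ip_commute[of n "w c"])
  qed
  then have "pn n r w x \<le> L2_set (\<lambda>c. ip n y (w c)) {..<r} + L2_set h {..<r}"
    unfolding pn_def using L2_set_triangle_ineq[of "\<lambda>c. ip n y (w c)" h "{..<r}"] by simp
  also have "L2_set (\<lambda>c. ip n y (w c)) {..<r} \<le> pn n r v x"
  proof -
    have "onsys n r v" using v r by (auto simp: onsys_def)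
    then have "ip n y y = (\<Sum>d<r. ip n x (v d) * ip n x (v d))"
      unfolding y_def by (rule onsys_comb_norm)
    then have "(nrm n y)^2 = (pn n r v x)^2" unfolding ip_self[symmetric] pn_squared by (simp add: power2_eq_square)
    then have "nrm n y = pn n r v x" by (simp add: power2_eq_iff_nonneg)
    then show ?thesis using pn_le_nrm[OF w r, of y] by (simp add: pn_def)
  qed
  also have "L2_set h {..<r} \<le> sgap n r w v * nrm n x"
  proof (rule power2_le_imp_le)
    have tail: "(\<Sum>d\<in>{r..<n}. (ip n x (v d))^2) \<le> (nrm n x)^2"
    proof -
      have "(\<Sum>d\<in>{r..<n}. (ip n x (v d))^2) \<le> (\<Sum>d<n. (ip n x (v d))^2)"
        by (intro sum_mono2) auto
      then show ?thesis using onsys_bessel[OF v, of x] by (simp add: ip_self)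
    qed
    have "(L2_set h {..<r})^2 = (\<Sum>c<r. (h c)^2)" by (rule L2_set_squared)
    also have "\<dots> \<le> (\<Sum>c<r. (nrm n x)^2 * (\<Sum>d\<in>{r..<n}. (ip n (w c) (v d))^2))"
    proof (intro sum_mono)
      fix c
      have "(h c)^2 \<le> (\<Sum>d\<in>{r..<n}. (ip n x (v d))^2) * (\<Sum>d\<in>{r..<n}. (ip n (w c) (v d))^2)"
        unfolding h_def by (rule Cauchy_Schwarz_ineq_sum)
      also have "\<dots> \<le> (nrm n x)^2 * (\<Sum>d\<in>{r..<n}. (ip n (w c) (v d))^2)"
        by (intro mult_right_mono tail sum_nonneg) auto
      finally show "(h c)^2 \<le> \<dots>" .
    qed
    also have "\<dots> = (sgap n r w v * nrm n x)^2"
      by (simp add: power_mult_distrib sgap_squared sum_distrib_left mult.commute)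
    finally show "(L2_set h {..<r})^2 \<le> (sgap n r w v * nrm n x)^2" .
  qed simp
  finally show ?thesis by linarith
qed

text \<open>Davis-Kahan in residual form: pairing the residual of \<open>v d\<close> with
  \<open>w c\<close> gives \<open>(\<mu> c - \<nu> d) * ip n (v d) (w c)\<close>. The
  \<open>v d\<close> are only approximate eigenvectors, so both the population vectors and the
  leave-one-out vectors can be inserted.\<close>

lemma sin_theta_bound:
  assumes Z: "symm n Z" and w: "eigsys n Z w \<mu>" and g: "0 < g"
    and gap: "\<And>c d. r \<le> c \<Longrightarrow> c < n \<Longrightarrow> d < m \<Longrightarrow> g \<le> \<bar>\<mu> c - \<nu> d\<bar>"
  shows "(\<Sum>d<m. \<Sum>c\<in>{r..<n}. (ip n (v d) (w c))^2)
       \<le> (\<Sum>d<m. (eig_res n Z v \<nu> d)^2) / g^2"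
proof -
  have on: "onsys n n w" using w by (simp add: eigsys_def)
  have "g^2 * (\<Sum>c\<in>{r..<n}. (ip n (v d) (w c))^2) \<le> (eig_res n Z v \<nu> d)^2"
    if d: "d < m" for d
  proof -
    define D where "D = (\<lambda>i. mv n Z (v d) i - \<nu> d * v d i)"
    have eq: "ip n D (w c) = (\<mu> c - \<nu> d) * ip n (v d) (w c)" if "c < n" for c
    proof -
      have "ip n D (w c) = ip n (w c) (mv n Z (v d)) - \<nu> d * ip n (w c) (v d)"
        unfolding D_def by (subst ip_commute) (simp only: ip_diff_right ip_scale_right)
      also have "ip n (w c) (mv n Z (v d)) = ip n (\<lambda>i. \<mu> c * w c i) (v d)"
        unfolding ip_mv_symm[OF Z] using w that by (intro ip_cong) (auto simp: eigsys_def)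
      finally show ?thesis by (simp add: ip_scale_left ip_commute[of n "w c"] algebra_simps)
    qed
    have "g^2 * (\<Sum>c\<in>{r..<n}. (ip n (v d) (w c))^2) \<le> (\<Sum>c\<in>{r..<n}. (ip n D (w c))^2)"
      unfolding sum_distrib_left
    proof (intro sum_mono)
      fix c assume c: "c \<in> {r..<n}"
      have "g^2 \<le> (\<mu> c - \<nu> d)^2" using gap[of c d] c d g by (simp add: abs_le_square_iff[symmetric])
      then show "g^2 * (ip n (v d) (w c))^2 \<le> (ip n D (w c))^2"
        using c by (auto simp: eq power_mult_distrib intro!: mult_right_mono)
    qed
    also have "\<dots> \<le> (\<Sum>c<n. (ip n D (w c))^2)" by (intro sum_mono2) auto
    also have "\<dots> \<le> (nrm n D)^2" using onsys_bessel[OF on, of D] by (simp add: ip_self)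
    finally show ?thesis by (simp add: D_def)
  qed
  then have "g^2 * (\<Sum>d<m. \<Sum>c\<in>{r..<n}. (ip n (v d) (w c))^2)
      \<le> (\<Sum>d<m. (eig_res n Z v \<nu> d)^2)"
    unfolding sum_distrib_left[of "g^2"] by (intro sum_mono) auto
  then show ?thesis using g by (simp add: field_simps)
qed

lemma eigsys_quad:
  assumes Z: "symm n Z" and w: "eigsys n Z w \<mu>"
  shows "ip n x (mv n Z x) = (\<Sum>c<n. \<mu> c * (ip n x (w c))^2)"
proof -
  have on: "onsys n n w" using w by (simp add: eigsys_def)
  have "ip n (mv n Z x) (w c) = \<mu> c * ip n x (w c)" if "c < n" for c
  proof -
    have "ip n (mv n Z x) (w c) = ip n x (mv n Z (w c))" by (rule ip_mv_symm[OF Z, symmetric])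
    also have "\<dots> = ip n x (\<lambda>i. \<mu> c * w c i)"
      using w that by (intro ip_cong) (auto simp: eigsys_def)
    finally show ?thesis by (simp add: ip_scale_right)
  qed
  then show ?thesis
    using onsys_parseval[OF on, of x "mv n Z x"] by (simp add: power2_eq_square mult_ac)
qed

section \<open>Eigenvalues and eigenspaces of a low-rank matrix plus noise\<close>

lemma mv_Gm: "mv n (Gm r s U) x i = (\<Sum>d<r. s d * ip n (U d) x * U d i)"
proof -
  have "mv n (Gm r s U) x i = (\<Sum>j<n. \<Sum>d<r. s d * U d i * (U d j * x j))"
    by (simp add: mv_def Gm_def sum_distrib_right sum_distrib_left mult_ac)
  also have "\<dots> = (\<Sum>d<r. \<Sum>j<n. s d * U d i * (U d j * x j))" by (rule sum.swap)
  also have "\<dots> = (\<Sum>d<r. s d * ip n (U d) x * U d i)"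
    by (simp add: ip_def sum_distrib_left mult_ac)
  finally show ?thesis .
qed

lemma ip_mv_Gm: "ip n x (mv n (Gm r s U) x) = (\<Sum>d<r. s d * (ip n x (U d))^2)"
proof -
  have "mv n (Gm r s U) x = (\<lambda>i. \<Sum>d<r. (s d * ip n (U d) x) * U d i)"
    by (rule ext) (simp add: mv_Gm)
  then have "ip n x (mv n (Gm r s U) x) = (\<Sum>d<r. (s d * ip n (U d) x) * ip n x (U d))"
    by (simp only: ip_sum_right)
  then show ?thesis by (simp add: power2_eq_square ip_commute[of n _ x] mult_ac)
qed

lemma symm_Gm: "symm n (Gm r s U)"
  by (auto simp: symm_def Gm_def mult_ac)

lemma symm_add: "symm n A \<Longrightarrow> symm n B \<Longrightarrow> symm n (\<lambda>i j. A i j + B i j)"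
  by (simp add: symm_def)

text \<open>Noise of norm at most \<open>lam / 4\<close> leaves the top \<open>r\<close> eigenvalues
  above \<open>3 / 4 * lam\<close> and moves the others by at most \<open>lam / 4\<close>. The
  remaining gap \<open>lam / 2\<close> drives every eigenspace comparison below.\<close>

locale spike =
  fixes n r :: nat and s :: rvec and U E :: rmat and lam :: real
  assumes U: "onsys n r U" and lam: "0 < lam" and s: "\<And>d. d < r \<Longrightarrow> lam \<le> s d" and r: "1 \<le> r"
    and E: "symm n E" and Eb: "\<And>x. nrm n (mv n E x) \<le> lam / 4 * nrm n x"
begin

abbreviation "Z \<equiv> (\<lambda>i j. Gm r s U i j + E i j)"

lemma symm_Z: "symm n Z" by (intro symm_add symm_Gm E)

lemma r_le_n: "r \<le> n" using onsys_dim_le[OF U] .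

lemma E_quad: "\<bar>ip n x (mv n E x)\<bar> \<le> lam / 4 * ip n x x"
proof -
  have "\<bar>ip n x (mv n E x)\<bar> \<le> nrm n x * nrm n (mv n E x)" by (rule abs_ip_le)
  also have "\<dots> \<le> nrm n x * (lam / 4 * nrm n x)" by (intro mult_left_mono Eb) simp
  also have "\<dots> = lam / 4 * ip n x x" by (simp add: ip_self power2_eq_square)
  finally show ?thesis .
qed

lemma Z_quad: "ip n x (mv n Z x) = (\<Sum>d<r. s d * (ip n x (U d))^2) + ip n x (mv n E x)"
proof -
  have "mv n Z x = (\<lambda>i. mv n (Gm r s U) x i + mv n E x i)" by (rule ext) (rule mv_add)
  then show ?thesis by (simp only: ip_add_right ip_mv_Gm)
qed

context
  fixes w \<mu> assumes w: "eigsys n Z w \<mu>"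
begin

lemma on_w: "onsys n n w" using w by (simp add: eigsys_def)

lemma mu_mono: "c \<le> d \<Longrightarrow> d < n \<Longrightarrow> \<mu> d \<le> \<mu> c" using w by (simp add: eigsys_def)

text \<open>The lower bound holds because the signal is positive semidefinite. For the upper bound,
  the span of \<open>w 0\<close> to \<open>w r\<close> has dimension \<open>r + 1\<close> and so
  contains a nonzero vector orthogonal to all \<open>U d\<close>; on it only the noise acts, while
  its Rayleigh quotient is at least \<open>\<mu> r\<close>.\<close>

lemma weyl_bottom:
  assumes "r \<le> c" "c < n" shows "\<bar>\<mu> c\<bar> \<le> lam / 4"
proof -
  have "- (lam / 4) \<le> \<mu> c"
  proof -
    have "ip n (w c) (mv n Z (w c)) = ip n (w c) (\<lambda>i. \<mu> c * w c i)"
      using w assms by (intro ip_cong) (auto simp: eigsys_def)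
    also have "\<dots> = \<mu> c" using on_w assms by (simp add: ip_scale_right onsys_def)
    finally have "\<mu> c = (\<Sum>d<r. s d * (ip n (w c) (U d))^2) + ip n (w c) (mv n E (w c))"
      by (simp add: Z_quad)
    moreover have "0 \<le> (\<Sum>d<r. s d * (ip n (w c) (U d))^2)"
      using s lam by (intro sum_nonneg mult_nonneg_nonneg) (auto intro: order_trans less_imp_le)
    moreover have "ip n (w c) (w c) = 1" using on_w assms by (simp add: onsys_def)
    ultimately show ?thesis using E_quad[of "w c"] by simp
  qed
  moreover have "\<mu> c \<le> lam / 4"
  proof -
    obtain \<alpha> b where \<alpha>: "b \<le> r" "\<alpha> b \<noteq> 0" "\<And>d. d < r \<Longrightarrow> (\<Sum>b\<le>r. \<alpha> b * ip n (w b) (U d)) = 0"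
      using homogeneous_nontrivial[of r "\<lambda>b d. ip n (w b) (U d)"] by blast
    define x where "x i = (\<Sum>b<Suc r. \<alpha> b * w b i)" for i
    have on: "onsys n (Suc r) w" using on_w assms by (auto simp: onsys_def)
    have xx: "ip n x x = (\<Sum>b<Suc r. (\<alpha> b)^2)"
      unfolding x_def onsys_comb_norm[OF on] by (simp add: power2_eq_square)
    have pos: "0 < ip n x x" unfolding xx
      using \<alpha>(1,2) by (intro sum_pos2[of _ b]) auto
    have xU: "ip n x (U d) = 0" if "d < r" for d
      unfolding x_def ip_sum_left lessThan_Suc_atMost using \<alpha>(3)[OF that] by simp
    have xw: "ip n x (w d) = (if d < Suc r then \<alpha> d else 0)" if "d < n" for d
    proof -
      have "ip n x (w d) = (\<Sum>b<Suc r. if b = d then \<alpha> b else 0)"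
        unfolding x_def ip_sum_left using that assms on_w
        by (intro sum.cong) (auto simp: onsys_def)
      then show ?thesis by simp
    qed
    have "\<mu> r * ip n x x \<le> (\<Sum>d<n. \<mu> d * (ip n x (w d))^2)"
    proof -
      have "\<mu> r * ip n x x = (\<Sum>d<n. \<mu> r * (ip n x (w d))^2)"
        using onsys_parseval[OF on_w, of x x] by (simp add: sum_distrib_left[symmetric] power2_eq_square)
      also have "\<dots> \<le> (\<Sum>d<n. \<mu> d * (ip n x (w d))^2)"
      proof (intro sum_mono)
        fix d assume d: "d \<in> {..<n}"
        show "\<mu> r * (ip n x (w d))^2 \<le> \<mu> d * (ip n x (w d))^2"
          using d xw[of d] mu_mono[of d r] assms by (cases "d < Suc r") (auto intro!: mult_right_mono)
      qed
      finally show ?thesis .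
    qed
    also have "\<dots> = ip n x (mv n E x)"
      using eigsys_quad[OF symm_Z w, of x] Z_quad[of x] xU by simp
    also have "\<dots> \<le> lam / 4 * ip n x x" using E_quad[of x] by linarith
    finally have "\<mu> r \<le> lam / 4" using pos by (simp only: mult_le_cancel_right_pos)
    then show ?thesis using mu_mono[of r c] assms by linarith
  qed
  ultimately show ?thesis by linarith
qed

text \<open>Dually, the span of the \<open>U d\<close> contains a nonzero vector orthogonal to the
  first \<open>r - 1\<close> eigenvectors. Its Rayleigh quotient is at most
  \<open>\<mu> (r - 1)\<close>, yet the signal contributes at least \<open>lam\<close>.\<close>

lemma weyl_top:
  assumes "c < r" shows "3 / 4 * lam \<le> \<mu> c"
proof -
  define m where "m = r - 1"
  have rm: "r = Suc m" using r by (simp add: m_def)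
  obtain \<alpha> b where \<alpha>: "b \<le> m" "\<alpha> b \<noteq> 0" "\<And>d. d < m \<Longrightarrow> (\<Sum>b\<le>m. \<alpha> b * ip n (U b) (w d)) = 0"
    using homogeneous_nontrivial[of m "\<lambda>b d. ip n (U b) (w d)"] by blast
  define x where "x i = (\<Sum>b<r. \<alpha> b * U b i)" for i
  have xx: "ip n x x = (\<Sum>b<r. (\<alpha> b)^2)"
    unfolding x_def onsys_comb_norm[OF U] by (simp add: power2_eq_square)
  have pos: "0 < ip n x x" unfolding xx
    using \<alpha>(1,2) rm by (intro sum_pos2[of _ b]) auto
  have xw: "ip n x (w d) = 0" if "d < m" for d
    unfolding x_def ip_sum_left rm lessThan_Suc_atMost using \<alpha>(3)[OF that] by simp
  have xU: "ip n x (U d) = \<alpha> d" if "d < r" for d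
  proof -
    have "ip n x (U d) = (\<Sum>b<r. if b = d then \<alpha> b else 0)"
      unfolding x_def ip_sum_left using that U by (intro sum.cong) (auto simp: onsys_def)
    then show ?thesis using that by simp
  qed
  have "lam * ip n x x \<le> (\<Sum>d<r. s d * (ip n x (U d))^2)"
    unfolding xx sum_distrib_left using s by (intro sum_mono) (auto simp: xU intro!: mult_right_mono)
  then have "3 / 4 * lam * ip n x x \<le> ip n x (mv n Z x)"
    using E_quad[of x] unfolding Z_quad by linarith
  also have "\<dots> = (\<Sum>d<n. \<mu> d * (ip n x (w d))^2)" by (rule eigsys_quad[OF symm_Z w])
  also have "\<dots> \<le> (\<Sum>d<n. \<mu> m * (ip n x (w d))^2)"
  proof (intro sum_mono)
    fix d assume d: "d \<in> {..<n}"
    show "\<mu> d * (ip n x (w d))^2 \<le> \<mu> m * (ip n x (w d))^2"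
      using d xw[of d] mu_mono[of m d] by (cases "d < m") (auto intro!: mult_right_mono)
  qed
  also have "\<dots> = \<mu> m * ip n x x"
    using onsys_parseval[OF on_w, of x x] by (simp add: sum_distrib_left[symmetric] power2_eq_square)
  finally have "3 / 4 * lam \<le> \<mu> m" using pos by (simp only: mult_le_cancel_right_pos)
  moreover have "\<mu> m \<le> \<mu> c" using assms rm r_le_n by (intro mu_mono) auto
  ultimately show ?thesis by linarith
qed

text \<open>By the eigenvalue equation row \<open>a\<close> of \<open>Z\<close> has inner product
  \<open>\<mu> c * w c a\<close> with \<open>w c\<close>. Thus row \<open>a\<close> of the
  eigenvectors is controlled by row \<open>a\<close> of the matrix, the entry point of the
  leave-one-out argument.\<close>

lemma pn_Z_row:
  assumes "a < n" shows "3 / 4 * lam * pn n r w (ev a) \<le> pn n r w (Z a)"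
proof -
  have e: "ip n (Z a) (w c) = \<mu> c * w c a" if "c < r" for c
  proof -
    have "ip n (Z a) (w c) = mv n Z (w c) a" by (simp add: ip_def mv_def)
    then show ?thesis using w that r_le_n assms by (simp add: eigsys_def)
  qed
  have "(3 / 4 * lam)^2 * (\<Sum>c<r. (w c a)^2) \<le> (\<Sum>c<r. (ip n (Z a) (w c))^2)"
    unfolding sum_distrib_left
  proof (rule sum_mono)
    fix c assume c: "c \<in> {..<r}"
    have "(3 / 4 * lam)^2 \<le> (\<mu> c)^2" using weyl_top c lam by (intro power_mono) auto
    then show "(3 / 4 * lam)^2 * (w c a)^2 \<le> (ip n (Z a) (w c))^2"
      unfolding e[OF c[unfolded lessThan_iff]] power_mult_distrib[of "\<mu> c"] by (rule mult_right_mono) simp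
  qed
  then have "(3 / 4 * lam * pn n r w (ev a))^2 \<le> (pn n r w (Z a))^2"
    unfolding power_mult_distrib[of "3 / 4 * lam"] pn_ev[OF assms] unfolding pn_squared .
  then show ?thesis by (rule power2_le_imp_le) simp
qed

text \<open>The unperturbed singular vectors satisfy \<open>Z U\<^sub>d - s\<^sub>d U\<^sub>d = E U\<^sub>d\<close>.\<close>
lemma sin_theta_population:
  "(\<Sum>d<r. \<Sum>c\<in>{r..<n}. (ip n (U d) (w c))^2) \<le> (4 / (3 * lam))^2 * (\<Sum>d<r. (nrm n (mv n E (U d)))^2)"
proof -
  have res: "mv n Z (U d) i - s d * U d i = mv n E (U d) i" if "d < r" "i < n" for d i
  proof -
    have "mv n (Gm r s U) (U d) i = (\<Sum>e<r. if e = d then s e * U e i else 0)"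
      unfolding mv_Gm using U that by (intro sum.cong) (auto simp: onsys_def)
    then show ?thesis using that by (simp add: mv_add)
  qed
  have "(\<Sum>d<r. \<Sum>c\<in>{r..<n}. (ip n (U d) (w c))^2)
      \<le> (\<Sum>d<r. (nrm n (\<lambda>i. mv n Z (U d) i - s d * U d i))^2) / (3 / 4 * lam)^2"
  proof (rule sin_theta_bound[OF symm_Z w])
    fix c d assume "r \<le> c" "c < n" "d < r"
    then show "3 / 4 * lam \<le> \<bar>\<mu> c - s d\<bar>" using weyl_bottom[of c] s[of d] by linarith
  qed (use lam in simp)
  also have "(\<Sum>d<r. (nrm n (\<lambda>i. mv n Z (U d) i - s d * U d i))^2) = (\<Sum>d<r. (nrm n (mv n E (U d)))^2)"
    using res by (intro sum.cong refl arg_cong[where f = "\<lambda>x. x^2"] L2_set_cong) auto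
  finally show ?thesis by (simp add: power_divide power_mult_distrib field_simps)
qed

lemma sgap_bound:
  assumes v: "onsys n n v" and \<nu>: "\<And>d. d < r \<Longrightarrow> 3 / 4 * lam \<le> \<nu> d"
  shows "(sgap n r v w)^2 \<le> (2 / lam)^2 * (\<Sum>d<r. (eig_res n Z v \<nu> d)^2)"
proof -
  have "(sgap n r v w)^2 \<le> (\<Sum>d<r. (eig_res n Z v \<nu> d)^2) / (1 / 2 * lam)^2"
    unfolding sgap_squared
  proof (rule sin_theta_bound[OF symm_Z w])
    fix c d assume "r \<le> c" "c < n" "d < r"
    then show "1 / 2 * lam \<le> \<bar>\<mu> c - \<nu> d\<bar>" using weyl_bottom[of c] \<nu>[of d] by linarith
  qed (use lam in simp)
  then show ?thesis by (simp add: power_divide power_mult_distrib field_simps)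
qed

end

text \<open>Vectors of one eigenbasis have zero residual for the same matrix, so the gap forces
  \<open>sgap\<close> to vanish and projected norms agree. Polarisation recovers the entries of the
  projection.\<close>

lemma top_projection_unique:
  assumes w: "eigsys n Z w \<mu>" and v: "eigsys n Z v \<nu>" and ij: "i < n" "j < n"
  shows "(\<Sum>c<r. w c i * w c j) = (\<Sum>c<r. v c i * v c j)"
proof -
  have le: "pn n r w x \<le> pn n r v x" if w: "eigsys n Z w \<mu>" and v: "eigsys n Z v \<nu>" for w v \<mu> \<nu> x
  proof -
    have "(\<lambda>i. mv n Z (v d) i - \<nu> d * v d i) i = 0" if "d < r" "i < n" for d i
      using v that r_le_n by (simp add: eigsys_def)
    then have "eig_res n Z v \<nu> d = 0" if "d < r" for d
      using that by (intro L2_set_0') auto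
    then have "(sgap n r v w)^2 \<le> 0"
      using sgap_bound[OF w on_w[OF v], of \<nu>] weyl_top[OF v] by simp
    then have "sgap n r v w = 0" by simp
    then show ?thesis
      using pn_close[OF on_w[OF w] on_w[OF v] r_le_n, of x] sgap_commute[OF on_w[OF w] on_w[OF v] r_le_n]
      by simp
  qed
  have eq: "(pn n r w x)^2 = (pn n r v x)^2" for x
    using le[OF w v, of x] le[OF v w, of x] by simp
  have pol: "(pn n r w (\<lambda>k. ev i k + ev j k))^2
      = (pn n r w (ev i))^2 + (pn n r w (ev j))^2 + 2 * (\<Sum>c<r. w c i * w c j)" for w
    using ij by (simp add: pn_squared ip_add_left ip_ev power2_sum sum.distrib sum_distrib_left mult.assoc)
  show ?thesis using pol[of w] pol[of v] eq by simp
qed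

end

section \<open>Leave-one-out incoherence\<close>

text \<open>Only the noise is erased, not the signal, so signal plus \<open>loo a E\<close>
  satisfies the assumptions of \<open>spike\<close> with the same \<open>lam\<close>.\<close>

definition loo :: "nat \<Rightarrow> rmat \<Rightarrow> nat \<Rightarrow> nat \<Rightarrow> real" where
  "loo a E i j = (if i = a \<or> j = a then 0 else E i j)"

lemma L2_set_abs_mono:
  assumes "\<And>i. i \<in> I \<Longrightarrow> \<bar>f i\<bar> \<le> \<bar>g i\<bar>"
  shows "L2_set f I \<le> L2_set g I"
  unfolding L2_set_def using assms by (intro real_sqrt_le_mono sum_mono) (simp add: abs_le_square_iff)

lemma symm_loo: "symm n E \<Longrightarrow> symm n (loo a E)"
  by (auto simp: symm_def loo_def)

lemma nrm_Gm_row: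
  assumes U: "onsys n r U" and s: "\<And>d. d < r \<Longrightarrow> 0 \<le> s d" "\<And>d. d < r \<Longrightarrow> s d \<le> \<sigma>"
    and u: "(\<Sum>d<r. (U d a)^2) \<le> u^2" "0 \<le> u" and \<sigma>: "0 \<le> \<sigma>"
  shows "nrm n (Gm r s U a) \<le> \<sigma> * u"
proof (rule power2_le_imp_le)
  have "Gm r s U a = (\<lambda>j. \<Sum>d<r. (s d * U d a) * U d j)" by (auto simp: Gm_def)
  then have "(nrm n (Gm r s U a))^2 = (\<Sum>d<r. (s d)^2 * (U d a)^2)"
    unfolding ip_self[symmetric] by (simp only: onsys_comb_norm[OF U]) (simp add: power2_eq_square mult_ac)
  also have "\<dots> \<le> (\<Sum>d<r. \<sigma>^2 * (U d a)^2)"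
    using s by (intro sum_mono mult_right_mono power_mono) auto
  also have "\<dots> \<le> \<sigma>^2 * u^2" unfolding sum_distrib_left[symmetric] by (intro mult_left_mono u) auto
  finally show "(nrm n (Gm r s U a))^2 \<le> (\<sigma> * u)^2" by (simp add: power_mult_distrib)
qed (use u \<sigma> in simp)

context spike
begin

lemma nrm_E_row:
  assumes "a < n" shows "nrm n (E a) \<le> lam / 4"
proof -
  have "E a j = mv n E (ev a) j" if "j < n" for j
  proof -
    have "mv n E (ev a) j = ip n (ev a) (E j)" by (simp add: mv_def ip_def mult.commute)
    then show ?thesis using E assms that by (simp add: ip_ev symm_def)
  qed
  then have "nrm n (E a) = nrm n (mv n E (ev a))" by (intro L2_set_cong) auto
  then show ?thesis using Eb[of "ev a"] assms by (simp add: nrm_ev)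
qed

lemma spike_loo: "spike n r s U (loo a E) lam"
proof
  fix x :: rvec
  define y where "y i = (if i = a then 0 else x i)" for i
  have "mv n (loo a E) x i = (if i = a then 0 else mv n E y i)" for i
    by (auto simp: mv_def loo_def y_def intro!: sum.cong)
  then have "nrm n (mv n (loo a E) x) \<le> nrm n (mv n E y)"
    by (intro L2_set_abs_mono) auto
  also have "\<dots> \<le> lam / 4 * nrm n y" by (rule Eb)
  also have "\<dots> \<le> lam / 4 * nrm n x"
    using lam by (intro mult_left_mono L2_set_abs_mono) (auto simp: y_def)
  finally show "nrm n (mv n (loo a E) x) \<le> lam / 4 * nrm n x" .
qed (use U lam s r symm_loo[OF E] in auto)

context
  fixes w \<mu> v \<nu> \<sigma> u a
  assumes w: "eigsys n Z w \<mu>"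
    and v: "eigsys n (\<lambda>i j. Gm r s U i j + loo a E i j) v \<nu>"
    and s_le: "\<And>d. d < r \<Longrightarrow> s d \<le> \<sigma>" and u: "0 \<le> u" "\<And>a. a < n \<Longrightarrow> (\<Sum>d<r. (U d a)^2) \<le> u^2"
    and a: "a < n"
begin

lemma sigma_nonneg: "0 \<le> \<sigma>"
  using s[of 0] s_le[of 0] lam r by auto

lemma nrm_Gm_row_le: "nrm n (Gm r s U a) \<le> \<sigma> * u"
  using s lam s_le u a sigma_nonneg
  by (intro nrm_Gm_row U) (auto intro: order_trans less_imp_le)

lemma on_v: "onsys n n v"
  using v by (simp add: eigsys_def)

text \<open>Row \<open>a\<close> of the leave-one-out matrix is pure signal, so the eigenvalue
  equation bounds row \<open>a\<close> of its eigenvectors without any noise term.\<close>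

lemma loo_own_row: "pn n r v (ev a) \<le> 4 / 3 * (\<sigma> / lam * u)"
proof -
  interpret L: spike n r s U "loo a E" lam by (rule spike_loo)
  have "3 / 4 * lam * pn n r v (ev a) \<le> pn n r v (\<lambda>j. Gm r s U a j + loo a E a j)"
    by (rule L.pn_Z_row[OF v a])
  also have "\<dots> = pn n r v (Gm r s U a)" by (simp add: loo_def)
  also have "\<dots> \<le> nrm n (Gm r s U a)" by (rule pn_le_nrm[OF on_v r_le_n])
  also have "\<dots> \<le> \<sigma> * u" by (rule nrm_Gm_row_le)
  finally show ?thesis using lam by (simp add: field_simps)
qed

text \<open>The residual of \<open>v d\<close> under the full matrix is the erased row and column
  applied to it: coordinate \<open>a\<close> carries \<open>ip n (E a) (v d)\<close>, every other
  coordinate \<open>i\<close> carries \<open>E i a * v d a\<close>.\<close>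

lemma loo_sgap: "sgap n r v w \<le> 2 / lam * (pn n r v (E a) + lam / 4 * pn n r v (ev a))"
proof (rule power2_le_imp_le)
  interpret L: spike n r s U "loo a E" lam by (rule spike_loo)
  have res: "(eig_res n Z v \<nu> d)^2 \<le> (ip n (E a) (v d))^2 + (lam / 4)^2 * (v d a)^2"
    if d: "d < r" for d
  proof -
    have e: "mv n Z (v d) i - \<nu> d * v d i = (if i = a then ip n (E a) (v d) else E i a * v d a)" if "i < n" for i
    proof -
      have "\<nu> d * v d i = mv n (\<lambda>i j. Gm r s U i j + loo a E i j) (v d) i"
        using v d that r_le_n by (simp add: eigsys_def)
      then have "mv n Z (v d) i - \<nu> d * v d i = (\<Sum>j<n. (E i j - loo a E i j) * v d j)"
        by (simp add: mv_add mv_def sum_subtractf algebra_simps)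
      also have "\<dots> = (if i = a then ip n (E a) (v d) else (\<Sum>j<n. if j = a then E i j * v d j else 0))"
      proof (cases "i = a")
        case False
        have "(\<Sum>j<n. (E i j - loo a E i j) * v d j) = (\<Sum>j<n. if j = a then E i j * v d j else 0)"
          using False by (intro sum.cong) (auto simp: loo_def)
        then show ?thesis using False by simp
      qed (simp add: loo_def ip_def)
      also have "\<dots> = (if i = a then ip n (E a) (v d) else E i a * v d a)" using a by simp
      finally show ?thesis .
    qed
    have "(eig_res n Z v \<nu> d)^2 = (\<Sum>i<n. (if i = a then ip n (E a) (v d) else E i a * v d a)^2)"
      unfolding L2_set_squared using e by (intro sum.cong) auto
    \<comment> \<open>Admitting the second summand at \<open>i = a\<close> as well completes it to
      the full norm of the row \<open>E a\<close>.\<close>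
    also have "\<dots> \<le> (\<Sum>i<n. (if i = a then (ip n (E a) (v d))^2 else 0) + (E a i)^2 * (v d a)^2)"
      using E a by (intro sum_mono) (auto simp: symm_def power_mult_distrib)
    also have "\<dots> = (ip n (E a) (v d))^2 + (nrm n (E a))^2 * (v d a)^2"
      using a by (simp add: sum.distrib L2_set_squared sum_distrib_right)
    also have "\<dots> \<le> (ip n (E a) (v d))^2 + (lam / 4)^2 * (v d a)^2"
      using nrm_E_row[OF a] by (intro add_left_mono mult_right_mono power_mono) auto
    finally show ?thesis .
  qed
  have "(sgap n r v w)^2 \<le> (2 / lam)^2 * (\<Sum>d<r. (eig_res n Z v \<nu> d)^2)"
    using L.weyl_top[OF v] by (intro sgap_bound[OF w on_v])
  also have "\<dots> \<le> (2 / lam)^2 * (\<Sum>d<r. (ip n (E a) (v d))^2 + (lam / 4)^2 * (v d a)^2)"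
    using res by (intro mult_left_mono sum_mono) auto
  also have "\<dots> = (2 / lam)^2 * ((pn n r v (E a))^2 + (lam / 4 * pn n r v (ev a))^2)"
    unfolding power_mult_distrib[of "lam / 4"] pn_ev[OF a] unfolding pn_squared
    by (simp add: sum.distrib sum_distrib_left)
  also have "\<dots> \<le> (2 / lam)^2 * (pn n r v (E a) + lam / 4 * pn n r v (ev a))^2"
    using lam by (intro mult_left_mono) (auto simp: power2_sum)
  finally show "(sgap n r v w)^2 \<le> (2 / lam * (pn n r v (E a) + lam / 4 * pn n r v (ev a)))^2"
    by (simp only: power_mult_distrib)
  show "0 \<le> 2 / lam * (pn n r v (E a) + lam / 4 * pn n r v (ev a))" using lam by simp
qed

text \<open>Row \<open>a\<close> of \<open>Z\<close> is a signal row plus \<open>E a\<close>. The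
  latter is dependent on \<open>w\<close>, so it is projected onto \<open>v\<close> instead, at the
  price \<open>sgap\<close> times the norm of \<open>E a\<close>.\<close>

lemma loo_row_bound:
  "3 / 4 * lam * pn n r w (ev a) \<le> \<sigma> * u + pn n r v (E a) + sgap n r v w * (lam / 4)"
proof -
  have "3 / 4 * lam * pn n r w (ev a) \<le> pn n r w (Z a)" by (rule pn_Z_row[OF w a])
  also have "\<dots> \<le> pn n r w (Gm r s U a) + pn n r w (E a)" by (rule pn_add)
  also have "pn n r w (Gm r s U a) \<le> \<sigma> * u"
    using pn_le_nrm[OF on_w[OF w] r_le_n, of "Gm r s U a"] nrm_Gm_row_le by linarith
  also have "pn n r w (E a) \<le> pn n r v (E a) + sgap n r w v * nrm n (E a)"
    by (rule pn_close[OF on_w[OF w] on_v r_le_n])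
  also have "sgap n r w v * nrm n (E a) \<le> sgap n r v w * (lam / 4)"
    unfolding sgap_commute[OF on_w[OF w] on_v r_le_n]
    by (intro mult_left_mono nrm_E_row a) simp
  finally show ?thesis by linarith
qed

lemma loo_rows_close: "b < n \<Longrightarrow> pn n r v (ev b) \<le> pn n r w (ev b) + sgap n r v w"
  using pn_close[OF on_v on_w[OF w] r_le_n, of "ev b"] by (simp add: nrm_ev)

end

text \<open>A self-bounding argument: the row noise is measured against the rows of
  \<open>v a\<close>, these are within \<open>sgap\<close> of the rows of \<open>w\<close>, and the
  largest row \<eta> of \<open>w\<close> then bounds itself with a factor below 1.\<close>

lemma loo_incoherence:
  assumes w: "eigsys n Z w \<mu>"
    and v: "\<And>a. a < n \<Longrightarrow> eigsys n (\<lambda>i j. Gm r s U i j + loo a E i j) (v a) (\<nu> a)"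
    and s_le: "\<And>d. d < r \<Longrightarrow> s d \<le> \<sigma>" and u: "0 \<le> u" "\<And>a. a < n \<Longrightarrow> (\<Sum>d<r. (U d a)^2) \<le> u^2"
    and good: "\<And>a. a < n \<Longrightarrow> \<exists>b<n. pn n r (v a) (E a) \<le> lam / 40 * pn n r (v a) (ev b)"
    and a: "a < n"
  shows "pn n r w (ev a) \<le> 17 / 10 * (\<sigma> / lam * u)"
proof -
  define K where "K = \<sigma> / lam * u"
  have \<sigma>0: "0 \<le> \<sigma>" using s[of 0] s_le[of 0] lam r by auto
  have K0: "0 \<le> K" using \<sigma>0 u lam by (simp add: K_def)
  define \<eta> where "\<eta> = Max ((\<lambda>b. pn n r w (ev b)) ` {..<n})"
  have \<eta>: "pn n r w (ev b) \<le> \<eta>" if "b < n" for b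
    unfolding \<eta>_def using that by (intro Max_ge) auto
  \<comment> \<open>Eliminating \<delta> and \<open>y\<close> gives
    \<open>38 * x \<le> \<eta> + 2 / 3 * K\<close> and then \<open>7 / 6 * K + 3 / 2 * x\<close> as
    a bound for three quarters of the row norm; 6/5 and 1/25 are the rounded coefficients.\<close>
  have bound: "pn n r w (ev a) \<le> 4 / 3 * (6 / 5 * K + \<eta> / 25)" if a: "a < n" for a
  proof -
    obtain b where b: "b < n" "pn n r (v a) (E a) \<le> lam / 40 * pn n r (v a) (ev b)"
      using good[OF a] by blast
    define \<delta> where "\<delta> = sgap n r (v a) w"
    define x where "x = pn n r (v a) (E a) / lam"
    define y where "y = pn n r (v a) (ev b)"
    have 1: "pn n r (v a) (ev a) \<le> 4 / 3 * K"
      unfolding K_def by (rule loo_own_row[OF w v[OF a] s_le u a])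
    have "\<delta> \<le> 2 / lam * (pn n r (v a) (E a) + lam / 4 * pn n r (v a) (ev a))"
      unfolding \<delta>_def by (rule loo_sgap[OF w v[OF a] s_le u a])
    also have "\<dots> = 2 * x + pn n r (v a) (ev a) / 2" using lam by (simp add: x_def field_simps)
    finally have 2: "\<delta> \<le> 2 * x + 2 / 3 * K" using 1 by simp
    have "3 / 4 * lam * pn n r w (ev a) \<le> \<sigma> * u + pn n r (v a) (E a) + \<delta> * (lam / 4)"
      unfolding \<delta>_def by (rule loo_row_bound[OF w v[OF a] s_le u a])
    also have "\<dots> = lam * (K + x + \<delta> / 4)" using lam by (simp add: x_def K_def field_simps)
    finally have "lam * (3 / 4 * pn n r w (ev a)) \<le> lam * (K + x + \<delta> / 4)" by (simp add: mult_ac)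
    then have 3: "3 / 4 * pn n r w (ev a) \<le> K + x + \<delta> / 4" using lam by simp
    have 4: "y \<le> \<eta> + \<delta>"
      using loo_rows_close[OF w v[OF a] s_le u a b(1)] \<eta>[OF b(1)] by (simp add: y_def \<delta>_def)
    have 5: "x \<le> y / 40" using b(2) lam by (simp add: x_def y_def field_simps)
    have 6: "0 \<le> \<eta>" using \<eta>[OF a] pn_nonneg[of n r w "ev a"] by linarith
    show ?thesis using 2 3 4 5 6 K0 by argo
  qed
  have "\<eta> \<in> (\<lambda>b. pn n r w (ev b)) ` {..<n}"
    unfolding \<eta>_def using a by (intro Max_in) auto
  then obtain b where "b < n" "\<eta> = pn n r w (ev b)" by auto
  \<comment> \<open>At the maximising row this reads
    \<open>\<eta> \<le> 8 / 5 * K + 4 / 75 * \<eta>\<close>; the coefficient obtained is 120/71,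
    just below 17/10.\<close>
  then have "\<eta> \<le> 17 / 10 * K" using bound[of b] K0 by simp
  then show ?thesis using \<eta>[OF a] by (simp add: K_def)
qed

end

section \<open>Wedge noise of a single unfolding\<close>

text \<open>The entries of \<open>Z - A A\<^sup>T\<close> for the wedge matrix \<open>Z\<close> of \<open>A\<close>.\<close>
definition wE :: "real \<Rightarrow> nat \<Rightarrow> rmat \<Rightarrow> triples \<Rightarrow> nat \<Rightarrow> nat \<Rightarrow> real" where
  "wE p N A W a b = (\<Sum>l<N. ((if (min a b, l, max a b) \<in> W then 1 / p else 0) - 1) * (A a l * A b l))"

lemma finite_wedge_triples: "finite (wedge_triples n m)"
  by (rule finite_subset[of _ "{..<n} \<times> {..<m} \<times> {..<n}"]) (auto simp: wedge_triples_def)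

lemma symm_wE: "symm n (wE p N A W)"
  by (simp add: symm_def wE_def min.commute max.commute mult.commute)

lemma L2_set_prod_squared:
  "(L2_set f (I \<times> J))^2 = (\<Sum>i\<in>I. \<Sum>j\<in>J. (f (i, j))^2)"
  by (simp add: L2_set_squared sum.cartesian_product')

text \<open>\<open>lam\<close> and \<open>sg\<close> bracket the squared singular values;
  \<open>u2\<close> and \<open>v2\<close> bound the squared row norms of the two factors, that is,
  they carry the incoherence.\<close>

locale svd_mode =
  fixes n N r :: nat and A U V :: rmat and \<sigma> :: rvec and lam sg u2 v2 p :: real
  assumes U: "onsys n r U" and V: "onsys N r V" and r: "1 \<le> r"
    and A: "\<And>i l. i < n \<Longrightarrow> l < N \<Longrightarrow> A i l = (\<Sum>d<r. \<sigma> d * U d i * V d l)"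
    and lam: "0 < lam" and s_ge: "\<And>d. d < r \<Longrightarrow> lam \<le> (\<sigma> d)^2" and s_le: "\<And>d. d < r \<Longrightarrow> (\<sigma> d)^2 \<le> sg"
    and u2: "\<And>i. i < n \<Longrightarrow> (\<Sum>d<r. (U d i)^2) \<le> u2" and v2: "\<And>l. l < N \<Longrightarrow> (\<Sum>d<r. (V d l)^2) \<le> v2"
    and p: "0 < p" "p \<le> 1" and u2_pos: "0 < u2" and v2_pos: "0 < v2"
begin

abbreviation "S \<equiv> wedge_triples n N"
abbreviation "rU i \<equiv> (\<Sum>d<r. (U d i)^2)"
abbreviation "fr2 \<equiv> (\<Sum>i<n. \<Sum>l<N. (A i l)^2)"
abbreviation "pe v b \<equiv> pn n r v (ev b)"
abbreviation "UI \<equiv> {..<n} \<times> {..<r}"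
abbreviation "RI \<equiv> {..<n} \<times> {..<N}"
abbreviation "wedge a \<equiv> (\<lambda>(b, l). (min a b, l, max a b))"
abbreviation "E \<equiv> wE p N A"
abbreviation "G \<equiv> Gm r (\<lambda>d. (\<sigma> d)^2) U"

text \<open>Any sampled product \<open>A i l * A j l / p\<close> is at most
  \<open>sg * \<rho>\<close> in absolute value, so \<rho> is the resolution of the wedge sampling
  relative to the signal.\<close>

definition "\<rho> = u2 * v2 / p"

lemma rho_pos: "0 < \<rho>" using p u2_pos v2_pos by (simp add: \<rho>_def)

lemma sg_ge: "lam \<le> sg" using s_ge[of 0] s_le[of 0] r by linarith

lemma sg_pos: "0 < sg" using sg_ge lam by linarith

lemma gram_rows:
  assumes "a < n" "b < n"
  shows "(\<Sum>l<N. A a l * A b l) = G a b"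
proof -
  have "(\<Sum>l<N. A a l * A b l)
      = ip N (\<lambda>l. \<Sum>d<r. (\<sigma> d * U d a) * V d l) (\<lambda>l. \<Sum>d<r. (\<sigma> d * U d b) * V d l)"
    unfolding ip_def using assms by (intro sum.cong) (auto simp: A)
  also have "\<dots> = (\<Sum>d<r. (\<sigma> d * U d a) * (\<sigma> d * U d b))" by (rule onsys_comb_norm[OF V])
  finally show ?thesis by (simp add: Gm_def power2_eq_square mult_ac)
qed

lemma col_norm_eq:
  assumes "l < N" shows "(\<Sum>i<n. (A i l)^2) = (\<Sum>d<r. (\<sigma> d)^2 * (V d l)^2)"
proof -
  have "(\<Sum>i<n. (A i l)^2) = ip n (\<lambda>i. \<Sum>d<r. (\<sigma> d * V d l) * U d i) (\<lambda>i. \<Sum>d<r. (\<sigma> d * V d l) * U d i)"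
    unfolding ip_def using assms by (intro sum.cong) (auto simp: A power2_eq_square mult_ac)
  also have "\<dots> = (\<Sum>d<r. (\<sigma> d * V d l) * (\<sigma> d * V d l))" by (rule onsys_comb_norm[OF U])
  finally show ?thesis by (simp add: power2_eq_square mult_ac)
qed

lemma col_norm:
  assumes "l < N" shows "(\<Sum>i<n. (A i l)^2) \<le> sg * v2"
proof -
  have "(\<Sum>i<n. (A i l)^2) \<le> (\<Sum>d<r. sg * (V d l)^2)"
    unfolding col_norm_eq[OF assms] using s_le by (intro sum_mono mult_right_mono) auto
  also have "\<dots> \<le> sg * v2"
    unfolding sum_distrib_left[symmetric] using v2[OF assms] sg_pos by (intro mult_left_mono) auto
  finally show ?thesis .
qed

lemma row_norm:
  assumes "a < n" shows "(\<Sum>l<N. (A a l)^2) \<le> sg * u2"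
proof -
  have "(\<Sum>l<N. (A a l)^2) = (\<Sum>d<r. (\<sigma> d)^2 * (U d a)^2)"
    using gram_rows[OF assms assms] by (simp add: Gm_def power2_eq_square mult_ac)
  also have "\<dots> \<le> (\<Sum>d<r. sg * (U d a)^2)"
    using s_le by (intro sum_mono mult_right_mono) auto
  also have "\<dots> \<le> sg * u2"
    unfolding sum_distrib_left[symmetric] using u2[OF assms] sg_pos by (intro mult_left_mono) auto
  finally show ?thesis .
qed

lemma fro_eq: "fr2 = (\<Sum>d<r. (\<sigma> d)^2)"
proof -
  have "fr2 = (\<Sum>l<N. \<Sum>d<r. (\<sigma> d)^2 * (V d l)^2)"
    by (subst sum.swap) (simp add: col_norm_eq)
  also have "\<dots> = (\<Sum>d<r. (\<sigma> d)^2 * ip N (V d) (V d))"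
    unfolding ip_def sum_distrib_left by (subst sum.swap) (simp add: power2_eq_square)
  finally show ?thesis using V by (simp add: onsys_def)
qed

lemma fro_le: "fr2 \<le> r * sg"
  unfolding fro_eq using sum_mono[of "{..<r}" "\<lambda>d. (\<sigma> d)^2" "\<lambda>_. sg"] s_le by simp

lemma entry_sq:
  assumes "i < n" "l < N" shows "(A i l)^2 \<le> sg * (u2 * v2)"
proof -
  have "(A i l)^2 = (\<Sum>d<r. (\<sigma> d * U d i) * V d l)^2" using assms by (simp add: A)
  also have "\<dots> \<le> (\<Sum>d<r. (\<sigma> d * U d i)^2) * (\<Sum>d<r. (V d l)^2)" by (rule Cauchy_Schwarz_ineq_sum)
  also have "\<dots> \<le> (sg * u2) * v2"
  proof (intro mult_mono v2 assms)
    have "(\<Sum>d<r. (\<sigma> d * U d i)^2) \<le> (\<Sum>d<r. sg * (U d i)^2)"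
      using s_le by (intro sum_mono) (auto simp: power_mult_distrib intro!: mult_right_mono)
    also have "\<dots> \<le> sg * u2"
      unfolding sum_distrib_left[symmetric] using u2[OF assms(1)] sg_pos by (intro mult_left_mono) auto
    finally show "(\<Sum>d<r. (\<sigma> d * U d i)^2) \<le> sg * u2" .
  qed (use sg_pos u2_pos in \<open>auto intro: sum_nonneg\<close>)
  finally show ?thesis by (simp add: mult.assoc)
qed

lemma entry_prod:
  assumes "i < n" "j < n" "l < N" shows "\<bar>A i l * A j l\<bar> \<le> sg * (u2 * v2)"
proof -
  have le: "\<bar>A i l\<bar> \<le> sqrt (sg * (u2 * v2))" if "i < n" "l < N" for i l
    using entry_sq[OF that] by (intro real_le_rsqrt) simp
  have "\<bar>A i l * A j l\<bar> \<le> sqrt (sg * (u2 * v2)) * sqrt (sg * (u2 * v2))"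
    unfolding abs_mult using assms sg_pos u2_pos v2_pos by (intro mult_mono le) auto
  then show ?thesis using sg_pos u2_pos v2_pos by simp
qed

section \<open>The wedge noise applied to the population singular vectors\<close>

definition EU :: "triples \<Rightarrow> real" where
  "EU W = L2_set (\<lambda>(a, d). mv n (E W) (U d) a) UI"

text \<open>A triple touches the entries \<open>(i, j)\<close> and \<open>(j, i)\<close> of the
  noise, hence rows \<open>i\<close> and \<open>j\<close> of its product with \<open>U\<close>. The
  nested conditional counts a diagonal triple once.\<close>

definition zU :: "nat \<times> nat \<times> nat \<Rightarrow> nat \<times> nat \<Rightarrow> real" where
  "zU = (\<lambda>(i, l, j) (a, d). if a = i then A i l * A j l * U d j
           else if a = j then A i l * A j l * U d i else 0)"

lemma S_sum:
  "(\<Sum>s\<in>S. f s) = (\<Sum>l<N. \<Sum>j<n. \<Sum>i\<le>j. f (i, l, j))" for f :: "nat \<times> nat \<times> nat \<Rightarrow> real"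
proof -
  have "(\<Sum>l<N. \<Sum>j<n. \<Sum>i\<le>j. f (i, l, j)) = (\<Sum>(l, j, i)\<in>(SIGMA l:{..<N}. SIGMA j:{..<n}. {..j}). f (i, l, j))"
    by (simp add: sum.Sigma)
  also have "\<dots> = (\<Sum>s\<in>S. f s)"
    by (rule sum.reindex_bij_witness[of _ "\<lambda>(i, l, j). (l, j, i)" "\<lambda>(l, j, i). (i, l, j)"])
      (auto simp: wedge_triples_def)
  finally show ?thesis by simp
qed

lemma E_mv_noise:
  assumes a: "a < n"
  shows "mv n (E W) (U d) a = noise p S zU W (a, d)"
proof -
  let ?x = "\<lambda>i l j. (if (i, l, j) \<in> W then 1 / p else 0) - 1"
  have inner: "(\<Sum>j<n. \<Sum>i\<le>j. ?x i l j * zU (i, l, j) (a, d)) = (\<Sum>b<n. ?x (min a b) l (max a b) * (A a l * A b l) * U d b)"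
    for l
  proof -
    \<comment> \<open>Triples containing \<open>a\<close> have it either as their larger index, with
      partner \<open>i \<le> a\<close>, or strictly as the smaller one, with partner
      \<open>j > a\<close>; every partner \<open>b < n\<close> then occurs exactly once.\<close>
    have "(\<Sum>i\<le>j. ?x i l j * zU (i, l, j) (a, d)) =
        (if j = a then (\<Sum>i\<le>a. ?x i l a * (A a l * A i l) * U d i)
         else if a < j then ?x a l j * (A a l * A j l) * U d j else 0)" for j
    proof -
      consider "j = a" | "a < j" | "j < a" by linarith
      then show ?thesis
      proof cases
        case 1
        then show ?thesis by (auto simp: zU_def intro!: sum.cong)
      next
        case 2
        have "(\<Sum>i\<le>j. ?x i l j * zU (i, l, j) (a, d)) = (\<Sum>i\<le>j. if i = a then ?x a l j * (A a l * A j l) * U d j else 0)"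
          using 2 by (intro sum.cong) (auto simp: zU_def)
        then show ?thesis using 2 by simp
      next
        case 3
        then show ?thesis by (auto simp: zU_def intro!: sum.neutral)
      qed
    qed
    then have "(\<Sum>j<n. \<Sum>i\<le>j. ?x i l j * zU (i, l, j) (a, d)) =
       (\<Sum>j<n. (if j = a then (\<Sum>i\<le>a. ?x i l a * (A a l * A i l) * U d i) else 0)
         + (if a < j then ?x a l j * (A a l * A j l) * U d j else 0))"
      by (intro sum.cong) auto
    also have "\<dots> = (\<Sum>i\<le>a. ?x i l a * (A a l * A i l) * U d i) + (\<Sum>j\<in>{a<..<n}. ?x a l j * (A a l * A j l) * U d j)"
      unfolding sum.distrib using a
      by (subst (2) sum.inter_filter[symmetric]) (auto intro!: sum.cong)
    also have "\<dots> = (\<Sum>b\<in>{..a} \<union> {a<..<n}. ?x (min a b) l (max a b) * (A a l * A b l) * U d b)"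
      by (subst sum.union_disjoint) (auto simp: min_def max_def intro!: arg_cong2[where f = "(+)"] sum.cong)
    also have "{..a} \<union> {a<..<n} = {..<n}" using a by auto
    finally show ?thesis .
  qed
  have "noise p S zU W (a, d) = (\<Sum>l<N. \<Sum>j<n. \<Sum>i\<le>j. ?x i l j * zU (i, l, j) (a, d))"
    unfolding noise_def S_sum by simp
  also have "\<dots> = (\<Sum>l<N. \<Sum>b<n. ?x (min a b) l (max a b) * (A a l * A b l) * U d b)"
    unfolding inner ..
  also have "\<dots> = mv n (E W) (U d) a"
    unfolding mv_def wE_def sum_distrib_right by (rule sum.swap)
  finally show ?thesis by simp
qed

lemma EU_noise: "EU W = L2_set (noise p S zU W) UI"
  unfolding EU_def by (intro L2_set_cong) (auto simp: E_mv_noise)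

lemma EU_squared: "(EU W)^2 = (\<Sum>d<r. (nrm n (mv n (E W) (U d)))^2)"
  unfolding EU_def L2_set_prod_squared unfolding L2_set_squared by (subst sum.swap) simp

lemma zU_norm:
  assumes "i < n" "j < n"
  shows "(L2_set (zU (i, l, j)) UI)^2
       \<le> (A i l * A j l)^2 * (rU i + rU j)"
proof -
  let ?c = "(A i l * A j l)^2"
  have "(L2_set (zU (i, l, j)) UI)^2 = (\<Sum>a<n. \<Sum>d<r. (zU (i, l, j) (a, d))^2)"
    by (rule L2_set_prod_squared)
  also have "\<dots> \<le> (\<Sum>a<n. (if a = i then ?c * rU j else 0) + (if a = j then ?c * rU i else 0))"
  proof (intro sum_mono)
    fix a
    have nn: "0 \<le> ?c * rU i" by (intro mult_nonneg_nonneg sum_nonneg) auto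
    have 1: "(\<Sum>d<r. (zU (i, l, j) (a, d))^2) = (if a = i then ?c * rU j else if a = j then ?c * rU i else 0)"
      by (auto simp: zU_def power_mult_distrib sum_distrib_left)
    show "(\<Sum>d<r. (zU (i, l, j) (a, d))^2) \<le> (if a = i then ?c * rU j else 0) + (if a = j then ?c * rU i else 0)"
      unfolding 1 using nn by (cases "a = i"; cases "a = j") (simp_all add: mult.commute)
  qed
  also have "\<dots> = ?c * (rU i + rU j)"
    unfolding sum.distrib using assms by (simp add: distrib_left)
  finally show ?thesis .
qed

text \<open>For fixed \<open>l\<close> the full double sum factorises into two squared column norms.
  Incoherence bounds one of them, and summing the other over \<open>l\<close> gives the squared
  Frobenius norm.\<close>

lemma wedge_square_sum: "(\<Sum>(i, l, j)\<in>S. (A i l * A j l)^2) \<le> sg * v2 * (r * sg)"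
proof -
  have "(\<Sum>(i, l, j)\<in>S. (A i l * A j l)^2) = (\<Sum>l<N. \<Sum>j<n. \<Sum>i\<le>j. (A i l * A j l)^2)"
    by (simp add: S_sum)
  also have "\<dots> \<le> (\<Sum>l<N. \<Sum>j<n. \<Sum>i<n. (A i l * A j l)^2)"
    by (intro sum_mono sum_mono2) auto
  also have "\<dots> = (\<Sum>l<N. (\<Sum>i<n. (A i l)^2) * (\<Sum>j<n. (A j l)^2))"
    by (intro sum.cong refl) (simp add: sum_distrib_left sum_distrib_right power_mult_distrib)
  also have "\<dots> \<le> (\<Sum>l<N. sg * v2 * (\<Sum>j<n. (A j l)^2))"
    using col_norm by (intro sum_mono mult_right_mono sum_nonneg) auto
  also have "\<dots> = sg * v2 * fr2"
    unfolding sum_distrib_left[symmetric] by (subst sum.swap) simp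
  also have "\<dots> \<le> sg * v2 * (r * sg)"
    using sg_pos v2_pos by (intro mult_left_mono fro_le) auto
  finally show ?thesis .
qed

lemma U_row_le_1: "i < n \<Longrightarrow> rU i \<le> 1"
  using onsys_bessel[OF U, of "ev i"] by (simp add: ip_ev ev_def)

text \<open>The size of single terms uses only the trivial row bound 1 for \<open>U\<close>, twice,
  whence \<open>sqrt 2\<close>; the variance uses \<open>u2\<close>. The parameter \<open>v\<close>
  is free so that all modes can be given the same variance relative to their
  \<open>lam\<close>.\<close>

lemma EU_cosh_moment:
  assumes L: "0 \<le> L" "\<rho> * L \<le> 1" and v: "2 * r * sg^2 * \<rho> \<le> v"
  shows "expect (rand_subset S p) (\<lambda>W. cosh (sqrt (L / v) * EU W)) \<le> exp L"
  unfolding EU_noise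
proof (rule noise_cosh_moment[OF finite_wedge_triples p])
  have "0 < 2 * r * sg^2 * \<rho>" using r sg_pos rho_pos by simp
  then show "0 < v" using v by linarith
  show "0 \<le> L" by fact
  show "L2_set (zU s) UI / p \<le> sqrt 2 * (sg * \<rho>)" if "s \<in> S" for s
  proof -
    obtain i l j where s: "s = (i, l, j)" by (cases s)
    have ij: "i < n" "j < n" "l < N" using that by (auto simp: s wedge_triples_def)
    have "(L2_set (zU s) UI)^2 \<le> (A i l * A j l)^2 * (rU i + rU j)"
      unfolding s by (rule zU_norm[OF ij(1,2)])
    also have "\<dots> \<le> (sg * (u2 * v2))^2 * (1 + 1)"
    proof (intro mult_mono add_mono U_row_le_1 ij)
      have "\<bar>A i l * A j l\<bar> \<le> \<bar>sg * (u2 * v2)\<bar>" using entry_prod[OF ij] by linarith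
      then show "(A i l * A j l)^2 \<le> (sg * (u2 * v2))^2" by (simp only: abs_le_square_iff)
    qed (auto intro!: sum_nonneg add_nonneg_nonneg)
    also have "\<dots> = (sqrt 2 * (sg * (u2 * v2)))^2" by (simp add: power_mult_distrib)
    finally have "L2_set (zU s) UI \<le> sqrt 2 * (sg * (u2 * v2))"
      by (rule power2_le_imp_le) (use sg_pos u2_pos v2_pos in auto)
    then have "L2_set (zU s) UI / p \<le> sqrt 2 * (sg * (u2 * v2)) / p"
      using p by (intro divide_right_mono) auto
    then show ?thesis by (simp add: \<rho>_def)
  qed
  have "(sqrt 2 * (sg * \<rho>))^2 * L = 2 * sg^2 * \<rho> * (\<rho> * L)" by (simp add: power_mult_distrib power2_eq_square)
  also have "\<dots> \<le> 2 * sg^2 * \<rho> * real r" using L r sg_pos rho_pos by (intro mult_left_mono) auto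
  also have "\<dots> \<le> v" using v by (simp add: mult_ac)
  finally show "(sqrt 2 * (sg * \<rho>))^2 * L \<le> v" .
  have "(\<Sum>s\<in>S. (L2_set (zU s) UI)^2) \<le> (\<Sum>(i, l, j)\<in>S. (A i l * A j l)^2 * (2 * u2))"
  proof (intro sum_mono)
    fix s assume "s \<in> S"
    then obtain i l j where s: "s = (i, l, j)" and ij: "i < n" "j < n" "l < N"
      by (auto simp: wedge_triples_def)
    have "(A i l * A j l)^2 * (rU i + rU j) \<le> (A i l * A j l)^2 * (2 * u2)"
      using u2[OF ij(1)] u2[OF ij(2)] by (intro mult_left_mono) auto
    then show "(L2_set (zU s) UI)^2 \<le> (case s of (i, l, j) \<Rightarrow> (A i l * A j l)^2 * (2 * u2))"
      using zU_norm[OF ij(1,2), of l] by (simp add: s)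
  qed
  also have "\<dots> = (\<Sum>(i, l, j)\<in>S. (A i l * A j l)^2) * (2 * u2)"
    by (simp add: sum_distrib_right case_prod_unfold)
  also have "\<dots> \<le> (sg * v2 * (r * sg)) * (2 * u2)"
    using u2_pos by (intro mult_right_mono wedge_square_sum) auto
  finally have "(\<Sum>s\<in>S. (L2_set (zU s) UI)^2) / p \<le> (sg * v2 * (r * sg)) * (2 * u2) / p"
    using p by (intro divide_right_mono) auto
  also have "\<dots> = 2 * r * sg^2 * \<rho>" by (simp add: \<rho>_def power2_eq_square)
  finally show "(\<Sum>s\<in>S. (L2_set (zU s) UI)^2) / p \<le> v" using v by linarith
qed


section \<open>Independence of the leave-one-out eigenvectors from their row\<close>

definition row_tr :: "nat \<Rightarrow> triples" where
  "row_tr a = {(i, l, j) \<in> S. i = a \<or> j = a}"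

text \<open>The choice depends on \<open>W\<close> only through \<open>loo a (E W)\<close>, so the
  chosen vectors are literally unchanged when triples of row \<open>a\<close> are added. This is the
  form in which independence is used.\<close>

definition loo_vecs :: "nat \<Rightarrow> triples \<Rightarrow> nat \<Rightarrow> nat \<Rightarrow> real" where
  "loo_vecs a W = (SOME v. \<exists>\<nu>. eigsys n (\<lambda>i j. G i j + loo a (E W) i j) v \<nu>)"

text \<open>The existential compares with the largest row of the leave-one-out vectors. Being
  relative to that row, the event needs no prior bound on their incoherence.\<close>

definition row_good :: "nat \<Rightarrow> triples \<Rightarrow> bool" where
  "row_good a W \<longleftrightarrow> (\<exists>b<n. pn n r (loo_vecs a W) (E W a) \<le> lam / 40 * pn n r (loo_vecs a W) (ev b))"

lemma loo_vecs_eigsys: "\<exists>\<nu>. eigsys n (\<lambda>i j. G i j + loo a (E W) i j) (loo_vecs a W) \<nu>"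
proof -
  have "\<exists>v \<nu>. eigsys n (\<lambda>i j. G i j + loo a (E W) i j) v \<nu>"
    by (intro symm_eigsys_exists symm_add symm_Gm symm_loo symm_wE)
  then show ?thesis unfolding loo_vecs_def by (rule someI_ex)
qed

lemma row_tr_reindex:
  assumes a: "a < n"
  shows "row_tr a = wedge a ` RI"
    and "inj_on (wedge a) RI"
proof -
  show "row_tr a = wedge a ` RI"
  proof
    show "row_tr a \<subseteq> wedge a ` RI"
    proof
      fix s assume "s \<in> row_tr a"
      then obtain i l j where s: "s = (i, l, j)" "i \<le> j" "j < n" "l < N" "i = a \<or> j = a"
        by (auto simp: row_tr_def wedge_triples_def)
      then show "s \<in> wedge a ` RI"
        by (intro image_eqI[of _ _ "(if i = a then j else i, l)"]) auto
    qed
    show "wedge a ` RI \<subseteq> row_tr a"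
      using a by (auto simp: row_tr_def wedge_triples_def min_def max_def split: if_splits)
  qed
  show "inj_on (wedge a) RI"
    by (auto simp: inj_on_def min_def max_def split: if_splits)
qed

definition zR :: "nat \<Rightarrow> rmat \<Rightarrow> nat \<times> nat \<times> nat \<Rightarrow> nat \<Rightarrow> real" where
  "zR a v = (\<lambda>(i, l, j) c. let b = (if i = a then j else i) in A a l * A b l * v c b)"

lemma zR_eq: "zR a v (min a b, l, max a b) c = A a l * A b l * v c b"
  by (auto simp: zR_def Let_def min_def max_def)

lemma E_row_noise:
  assumes a: "a < n" and W: "\<And>s. s \<in> row_tr a \<Longrightarrow> s \<in> W \<longleftrightarrow> s \<in> W1"
  shows "ip n (E W a) (v c) = noise p (row_tr a) (zR a v) W1 c"
proof -
  let ?f = "wedge a"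
  have mem: "(min a b, l, max a b) \<in> row_tr a" if "b < n" "l < N" for b l
    using that unfolding row_tr_reindex(1)[OF a] by (intro image_eqI[of _ _ "(b, l)"]) auto
  have "noise p (row_tr a) (zR a v) W1 c
      = (\<Sum>x\<in>RI. ((if ?f x \<in> W1 then 1 / p else 0) - 1) * zR a v (?f x) c)"
    unfolding noise_def row_tr_reindex(1)[OF a]
    by (subst sum.reindex[OF row_tr_reindex(2)[OF a]]) simp
  also have "\<dots> = (\<Sum>b<n. \<Sum>l<N. ((if (min a b, l, max a b) \<in> W1 then 1 / p else 0) - 1) * (A a l * A b l * v c b))"
    by (simp add: sum.cartesian_product' zR_eq)
  also have "\<dots> = (\<Sum>b<n. \<Sum>l<N. ((if (min a b, l, max a b) \<in> W then 1 / p else 0) - 1) * (A a l * A b l * v c b))"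
    using W[OF mem] by (intro sum.cong refl) auto
  also have "\<dots> = ip n (E W a) (v c)"
    by (simp add: ip_def wE_def sum_distrib_right mult.assoc)
  finally show ?thesis by simp
qed

lemma loo_E_indep:
  assumes "W1 \<subseteq> row_tr a" shows "loo a (E (W2 \<union> W1)) = loo a (E W2)"
proof (intro ext)
  fix i j
  have "(min i j, l, max i j) \<notin> W1" if "i \<noteq> a" "j \<noteq> a" for l
    using assms that by (auto simp: row_tr_def min_def max_def split: if_splits)
  then show "loo a (E (W2 \<union> W1)) i j = loo a (E W2) i j"
    by (auto simp: loo_def wE_def intro!: sum.cong)
qed

text \<open>If every row vanished, \<open>v 0\<close> would be zero. Positivity of the largest row
  makes the variance in Bernstein's inequality positive.\<close>

lemma pn_ev_max_pos:
  assumes "onsys n n v"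
  shows "\<exists>b<n. 0 < pe v b \<and> (\<forall>b'<n. pe v b' \<le> pe v b)"
proof -
  have rn: "r \<le> n" using onsys_dim_le[OF U] .
  then have n: "0 < n" using r by linarith
  define \<eta> where "\<eta> = Max ((\<lambda>b. pe v b) ` {..<n})"
  have \<eta>: "pe v b \<le> \<eta>" if "b < n" for b
    unfolding \<eta>_def using that by (intro Max_ge) auto
  have "\<eta> \<in> (\<lambda>b. pe v b) ` {..<n}" unfolding \<eta>_def using n by (intro Max_in) auto
  then obtain b where b: "b < n" "\<eta> = pe v b" by auto
  have "\<eta> \<noteq> 0"
  proof
    assume "\<eta> = 0"
    then have "pe v b = 0" if "b < n" for b using \<eta>[OF that] pn_nonneg[of n r v "ev b"] by linarith
    then have "(\<Sum>c<r. (v c b)^2) = 0" if "b < n" for b using that pn_ev[OF that, of r v] by simp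
    then have "v 0 b = 0" if "b < n" for b
      using that r by (subst (asm) sum_nonneg_eq_0_iff) auto
    then have "ip n (v 0) (v 0) = 0" by (simp add: ip_def)
    then show False using assms n by (simp add: onsys_def)
  qed
  then have "0 < pe v b" using b pn_nonneg[of n r v "ev b"] by linarith
  then show ?thesis using b \<eta> by auto
qed

text \<open>For fixed vectors with largest row \<eta>, single terms are at most
  \<open>sg * \<rho> * \<eta>\<close>, and the row and column norms of \<open>A\<close> bound the
  variance by \<open>sg^2 * \<rho> * \<eta>^2\<close>. Everything scales with \<eta>, as does the
  threshold.\<close>

lemma row_noise_tail:
  assumes a: "a < n" and v: "onsys n n v" and L: "0 \<le> L" "\<rho> * L \<le> 1" and small: "2 * sg * sqrt (\<rho> * L) \<le> lam / 40"
    and b: "b < n" "0 < pe v b" "\<And>b'. b' < n \<Longrightarrow> pe v b' \<le> pe v b"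
  shows "pr (rand_subset (row_tr a) p)
      {W1. L2_set (noise p (row_tr a) (zR a v) W1) {..<r} > lam / 40 * pe v b} \<le> 2 * exp (- L)"
proof -
  define \<eta> where "\<eta> = pe v b"
  have zn: "L2_set (zR a v (min a b', l, max a b')) {..<r} = \<bar>A a l * A b' l\<bar> * pe v b'" if "b' < n" for b' l
  proof -
    have "pe v b' = L2_set (\<lambda>c. v c b') {..<r}" using that by (simp add: pn_def ip_ev)
    then show ?thesis unfolding zR_eq[abs_def] L2_set_scale by simp
  qed
  have fin: "finite (row_tr a)"
    by (rule finite_subset[OF _ finite_wedge_triples[of n N]]) (auto simp: row_tr_def)
  let ?X = "\<lambda>W1. L2_set (noise p (row_tr a) (zR a v) W1) {..<r}"
  have tail: "pr (rand_subset (row_tr a) p)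
      {W1. ?X W1 > 2 * sqrt (sg^2 * \<rho> * \<eta>^2 * L)} \<le> 2 * exp (- L)"
  proof (rule noise_tail[OF fin p])
    show "0 < sg^2 * \<rho> * \<eta>^2" using sg_pos rho_pos b by (simp add: \<eta>_def)
    show "0 \<le> L" by fact
    show "L2_set (zR a v s) {..<r} / p \<le> sg * \<rho> * \<eta>" if s: "s \<in> row_tr a" for s
    proof -
      obtain b' l where s: "s = (min a b', l, max a b')" "b' < n" "l < N"
        using s unfolding row_tr_reindex(1)[OF a] by auto
      have "L2_set (zR a v s) {..<r} \<le> (sg * (u2 * v2)) * \<eta>"
        unfolding s(1) zn[OF s(2)] using entry_prod[OF a s(2,3)] b(3)[OF s(2)] sg_pos u2_pos v2_pos
        by (intro mult_mono) (auto simp: \<eta>_def)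
      then have "L2_set (zR a v s) {..<r} / p \<le> (sg * (u2 * v2)) * \<eta> / p"
        using p by (intro divide_right_mono) auto
      then show ?thesis by (simp add: \<rho>_def)
    qed
    have "(sg * \<rho> * \<eta>)^2 * L = sg^2 * \<rho> * \<eta>^2 * (\<rho> * L)"
      by (simp add: power_mult_distrib power2_eq_square)
    also have "\<dots> \<le> sg^2 * \<rho> * \<eta>^2 * 1" using L rho_pos by (intro mult_left_mono) auto
    finally show "(sg * \<rho> * \<eta>)^2 * L \<le> sg^2 * \<rho> * \<eta>^2" by simp
    have "(\<Sum>s\<in>row_tr a. (L2_set (zR a v s) {..<r})^2)
        = (\<Sum>b'<n. \<Sum>l<N. (L2_set (zR a v (min a b', l, max a b')) {..<r})^2)"
      unfolding row_tr_reindex(1)[OF a]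
      by (subst sum.reindex[OF row_tr_reindex(2)[OF a]]) (simp add: sum.cartesian_product')
    also have "\<dots> \<le> (\<Sum>b'<n. \<Sum>l<N. (A a l)^2 * (A b' l)^2 * \<eta>^2)"
    proof (intro sum_mono)
      fix b' l assume b': "b' \<in> {..<n}" "l \<in> {..<N}"
      have "(pe v b')^2 \<le> \<eta>^2" using b(3) b' by (intro power_mono) (auto simp: \<eta>_def)
      then show "(L2_set (zR a v (min a b', l, max a b')) {..<r})^2 \<le> (A a l)^2 * (A b' l)^2 * \<eta>^2"
        using b' zn[of b' l] by (simp add: power_mult_distrib mult_left_mono)
    qed
    also have "\<dots> = (\<Sum>l<N. (A a l)^2 * (\<Sum>b'<n. (A b' l)^2)) * \<eta>^2"
      by (subst sum.swap) (simp add: sum_distrib_left sum_distrib_right mult_ac)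
    also have "\<dots> \<le> (\<Sum>l<N. (A a l)^2 * (sg * v2)) * \<eta>^2"
      using col_norm by (intro mult_right_mono sum_mono mult_left_mono) auto
    also have "\<dots> = (\<Sum>l<N. (A a l)^2) * (sg * v2) * \<eta>^2" by (simp add: sum_distrib_right)
    also have "\<dots> \<le> (sg * u2) * (sg * v2) * \<eta>^2"
      using row_norm[OF a] sg_pos v2_pos by (intro mult_right_mono) auto
    finally have "(\<Sum>s\<in>row_tr a. (L2_set (zR a v s) {..<r})^2) / p \<le> (sg * u2) * (sg * v2) * \<eta>^2 / p"
      using p by (intro divide_right_mono) auto
    then show "(\<Sum>s\<in>row_tr a. (L2_set (zR a v s) {..<r})^2) / p \<le> sg^2 * \<rho> * \<eta>^2"
      by (simp add: \<rho>_def power2_eq_square mult_ac)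
  qed
  have le: "2 * sqrt (sg^2 * \<rho> * \<eta>^2 * L) \<le> lam / 40 * \<eta>"
  proof -
    have "sqrt (sg^2 * \<rho> * \<eta>^2 * L) = sqrt ((sg * \<eta>)^2 * (\<rho> * L))" by (simp add: power_mult_distrib mult_ac)
    also have "\<dots> = sg * \<eta> * sqrt (\<rho> * L)" using sg_pos b by (simp add: real_sqrt_mult \<eta>_def)
    finally show ?thesis using mult_right_mono[OF small, of \<eta>] b by (simp add: \<eta>_def mult_ac)
  qed
  have "{W1. ?X W1 > lam / 40 * \<eta>} \<subseteq> {W1. ?X W1 > 2 * sqrt (sg^2 * \<rho> * \<eta>^2 * L)}"
    using le by (auto intro: le_less_trans)
  then have "pr (rand_subset (row_tr a) p) {W1. ?X W1 > lam / 40 * \<eta>}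
      \<le> pr (rand_subset (row_tr a) p) {W1. ?X W1 > 2 * sqrt (sg^2 * \<rho> * \<eta>^2 * L)}"
    by (rule measure_pmf.finite_measure_mono) simp
  with tail show ?thesis unfolding \<eta>_def[symmetric] by linarith
qed

text \<open>Condition on the triples avoiding \<open>a\<close>: they fix the leave-one-out vectors,
  and the triples meeting \<open>a\<close> supply fresh noise for row \<open>a\<close>.\<close>

lemma row_bad_prob:
  assumes a: "a < n" and L: "0 \<le> L" "\<rho> * L \<le> 1" and small: "2 * sg * sqrt (\<rho> * L) \<le> lam / 40"
  shows "pr (rand_subset S p) {W. \<not> row_good a W} \<le> 2 * exp (- L)"
proof -
  define S2 where "S2 = S - row_tr a"
  let ?R1 = "rand_subset (row_tr a) p" and ?R2 = "rand_subset S2 p"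
  have "row_tr a \<subseteq> S" by (auto simp: row_tr_def)
  then have fin: "finite (row_tr a)" "finite S2"
    using finite_subset[OF _ finite_wedge_triples[of n N]] finite_wedge_triples[of n N] by (auto simp: S2_def)
  have Seq: "S = S2 \<union> row_tr a" by (auto simp: S2_def row_tr_def)
  have inner: "expect ?R1 (\<lambda>W1. indicator {W. \<not> row_good a W} (W2 \<union> W1)) \<le> 2 * exp (- L)"
    if W2: "W2 \<in> set_pmf ?R2" for W2
  proof -
    define v where "v = loo_vecs a W2"
    have vW: "loo_vecs a (W2 \<union> W1) = v" if "W1 \<subseteq> row_tr a" for W1
      unfolding v_def loo_vecs_def loo_E_indep[OF that] ..
    have on: "onsys n n v" using loo_vecs_eigsys[of a W2] by (auto simp: v_def eigsys_def)
    obtain b where b: "b < n" "0 < pe v b" "\<And>b'. b' < n \<Longrightarrow> pe v b' \<le> pe v b"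
      using pn_ev_max_pos[OF on] by blast
    let ?B = "{W1. L2_set (noise p (row_tr a) (zR a v) W1) {..<r} > lam / 40 * pe v b}"
    have W2d: "W2 \<inter> row_tr a = {}" using set_rand_subset[OF W2] by (auto simp: S2_def)
    have "expect ?R1 (\<lambda>W1. indicator {W. \<not> row_good a W} (W2 \<union> W1) :: real)
        \<le> expect ?R1 (indicator ?B)"
    proof (rule integral_mono_AE)
      show "AE W1 in ?R1. (indicator {W. \<not> row_good a W} (W2 \<union> W1) :: real) \<le> indicator ?B W1"
      proof (rule AE_pmfI)
        fix W1 assume "W1 \<in> set_pmf ?R1"
        then have W1: "W1 \<subseteq> row_tr a" by (rule set_rand_subset)
        have "pn n r v (E (W2 \<union> W1) a) = L2_set (noise p (row_tr a) (zR a v) W1) {..<r}"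
          unfolding pn_def using W2d by (intro L2_set_cong refl E_row_noise a) auto
        then have "row_good a (W2 \<union> W1)" if "W1 \<notin> ?B"
          using that b(1) unfolding row_good_def vW[OF W1] by (intro exI[of _ b]) auto
        then show "(indicator {W. \<not> row_good a W} (W2 \<union> W1) :: real) \<le> indicator ?B W1"
          by (auto simp: indicator_def)
      qed
    qed (auto intro!: integrable_measure_pmf_finite finite_set_rand_subset fin)
    also have "\<dots> \<le> 2 * exp (- L)" using row_noise_tail[OF a on L small b] by simp
    finally show ?thesis .
  qed
  have "pr (rand_subset S p) {W. \<not> row_good a W}
      = expect (rand_subset S p) (indicator {W. \<not> row_good a W})" by simp
  also have "\<dots> = expect ?R2 (\<lambda>W2. expect ?R1 (\<lambda>W1. indicator {W. \<not> row_good a W} (W2 \<union> W1)))"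
  proof -
    have "rand_subset S p = map_pmf (\<lambda>(X, Y). X \<union> Y) (pair_pmf ?R2 ?R1)"
      unfolding Seq using fin by (intro rand_subset_union) (auto simp: S2_def)
    then show ?thesis
      by (simp only: integral_map_pmf case_prod_conv
          expectation_pair_pmf_finite[OF finite_set_rand_subset[OF fin(2)] finite_set_rand_subset[OF fin(1)]])
  qed
  also have "\<dots> \<le> expect ?R2 (\<lambda>_. 2 * exp (- L))"
    using inner by (intro integral_mono_AE AE_pmfI integrable_measure_pmf_finite finite_set_rand_subset fin)
  finally show ?thesis by simp
qed

lemma some_row_bad_prob:
  assumes L: "0 \<le> L" "\<rho> * L \<le> 1" and small: "2 * sg * sqrt (\<rho> * L) \<le> lam / 40"
  shows "pr (rand_subset S p) {W. \<exists>a<n. \<not> row_good a W} \<le> n * (2 * exp (- L))"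
proof -
  have "{W. \<exists>a<n. \<not> row_good a W} = (\<Union>a\<in>{..<n}. {W. \<not> row_good a W})" by auto
  then have "pr (rand_subset S p) {W. \<exists>a<n. \<not> row_good a W}
      \<le> (\<Sum>a<n. pr (rand_subset S p) {W. \<not> row_good a W})"
    by (simp only:) (intro measure_pmf.finite_measure_subadditive_finite, auto)
  also have "\<dots> \<le> (\<Sum>a<n. 2 * exp (- L))" using assms by (intro sum_mono row_bad_prob) auto
  finally show ?thesis by simp
qed

lemma spike_E:
  assumes "\<And>x. nrm n (mv n (E W) x) \<le> lam / 4 * nrm n x"
  shows "spike n r (\<lambda>d. (\<sigma> d)^2) U (E W) lam"
  using assms U lam s_ge r symm_wE by unfold_locales auto

lemma good_incoherence:
  assumes Eb: "\<And>x. nrm n (mv n (E W) x) \<le> lam / 4 * nrm n x"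
    and w: "eigsys n (\<lambda>i j. G i j + E W i j) w \<mu>"
    and good: "\<And>a. a < n \<Longrightarrow> row_good a W" and a: "a < n"
  shows "(pn n r w (ev a))^2 \<le> (17 / 10)^2 * (sg / lam)^2 * u2"
proof -
  interpret spike n r "\<lambda>d. (\<sigma> d)^2" U "E W" lam by (rule spike_E[OF Eb])
  obtain \<nu> where \<nu>: "\<And>a. eigsys n (\<lambda>i j. G i j + loo a (E W) i j) (loo_vecs a W) (\<nu> a)"
    using loo_vecs_eigsys[of _ W] by metis
  have "pn n r w (ev a) \<le> 17 / 10 * (sg / lam * sqrt u2)"
  proof (rule loo_incoherence[OF w])
    show "\<And>a. eigsys n (\<lambda>i j. G i j + loo a (E W) i j) (loo_vecs a W) (\<nu> a)" by fact
    show "\<And>a. a < n \<Longrightarrow> \<exists>b<n. pn n r (loo_vecs a W) (E W a) \<le> lam / 40 * pn n r (loo_vecs a W) (ev b)"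
      using good unfolding row_good_def .
  qed (use s_le u2 u2_pos a in auto)
  then have "(pn n r w (ev a))^2 \<le> (17 / 10 * (sg / lam * sqrt u2))^2" by (intro power_mono) auto
  also have "\<dots> = (17 / 10)^2 * (sg / lam)^2 * u2"
    using u2_pos by (simp only: power_mult_distrib) simp
  finally show ?thesis .
qed

text \<open>\<open>\<parallel>(I - Q)A\<parallel>\<^sub>F\<close> squared is the sum on the left, \<open>Q\<close> being the projection onto the first \<open>r\<close> of the \<open>w\<^sub>c\<close>.\<close>
lemma residual_bound:
  assumes Eb: "\<And>x. nrm n (mv n (E W) x) \<le> lam / 4 * nrm n x"
    and w: "eigsys n (\<lambda>i j. G i j + E W i j) w \<mu>"
  shows "(\<Sum>l<N. \<Sum>c\<in>{r..<n}. (ip n (\<lambda>i. A i l) (w c))^2)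
       \<le> (4 / (3 * lam) * EU W)^2 * fr2"
proof -
  interpret spike n r "\<lambda>d. (\<sigma> d)^2" U "E W" lam by (rule spike_E[OF Eb])
  have "(ip n (\<lambda>i. A i l) (w c))^2 \<le> (\<Sum>d<r. (ip n (U d) (w c))^2) * (\<Sum>d<r. (\<sigma> d)^2 * (V d l)^2)"
    if "l < N" for l c
  proof -
    have "ip n (\<lambda>i. A i l) (w c) = ip n (\<lambda>i. \<Sum>d<r. (\<sigma> d * V d l) * U d i) (w c)"
      using that by (intro ip_cong) (auto simp: A mult_ac)
    also have "\<dots> = (\<Sum>d<r. ip n (U d) (w c) * (\<sigma> d * V d l))"
      unfolding ip_sum_left by (simp add: mult.commute)
    finally have "(ip n (\<lambda>i. A i l) (w c))^2 \<le> (\<Sum>d<r. (ip n (U d) (w c))^2) * (\<Sum>d<r. (\<sigma> d * V d l)^2)"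
      using Cauchy_Schwarz_ineq_sum by metis
    then show ?thesis by (simp add: power_mult_distrib)
  qed
  then have "(\<Sum>l<N. \<Sum>c\<in>{r..<n}. (ip n (\<lambda>i. A i l) (w c))^2)
      \<le> (\<Sum>l<N. \<Sum>c\<in>{r..<n}. (\<Sum>d<r. (ip n (U d) (w c))^2) * (\<Sum>d<r. (\<sigma> d)^2 * (V d l)^2))"
    by (intro sum_mono) auto
  also have "\<dots> = (\<Sum>c\<in>{r..<n}. \<Sum>d<r. (ip n (U d) (w c))^2) * (\<Sum>l<N. \<Sum>d<r. (\<sigma> d)^2 * (V d l)^2)"
    by (simp add: sum_distrib_right[symmetric] sum_distrib_left[symmetric])
  also have "(\<Sum>l<N. \<Sum>d<r. (\<sigma> d)^2 * (V d l)^2) = fr2"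
    by (subst (2) sum.swap) (simp add: col_norm_eq)
  also have "(\<Sum>c\<in>{r..<n}. \<Sum>d<r. (ip n (U d) (w c))^2) = (\<Sum>d<r. \<Sum>c\<in>{r..<n}. (ip n (U d) (w c))^2)"
    by (rule sum.swap)
  also have "\<dots> * fr2 \<le> (4 / (3 * lam) * EU W)^2 * fr2"
    unfolding power_mult_distrib[of "4 / (3 * lam)"] EU_squared
    by (intro mult_right_mono sin_theta_population[OF w] sum_nonneg) auto
  finally show ?thesis .
qed

end

section \<open>Mode products\<close>

lemma idx_Nil: "idx [] = {[]}"
  by (auto simp: idx_def)

lemma idx_Cons: "idx (m # ms) = (\<lambda>(x, xs). x # xs) ` ({..<m} \<times> idx ms)"
proof
  show "idx (m # ms) \<subseteq> (\<lambda>(x, xs). x # xs) ` ({..<m} \<times> idx ms)"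
  proof
    fix i assume i: "i \<in> idx (m # ms)"
    then obtain x xs where x: "i = x # xs" "length xs = length ms" by (auto simp: idx_def length_Suc_conv)
    have "x < m" using i x by (auto simp: idx_def dest: spec[of _ 0])
    moreover have "xs \<in> idx ms" using i x by (auto simp: idx_def dest: spec[of _ "Suc _"])
    ultimately show "i \<in> (\<lambda>(x, xs). x # xs) ` ({..<m} \<times> idx ms)" using x by auto
  qed
  show "(\<lambda>(x, xs). x # xs) ` ({..<m} \<times> idx ms) \<subseteq> idx (m # ms)"
    by (auto simp: idx_def nth_Cons split: nat.splits)
qed

lemma bij_betw_dec: "bij_betw (dec ms) {..<prod_list ms} (idx ms)"
proof (induction ms)
  case Nil
  then show ?case by (auto simp: idx_Nil bij_betw_def inj_on_def)
next
  case (Cons m ms)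
  have inj: "inj_on (dec (m # ms)) {..<prod_list (m # ms)}"
  proof (rule inj_onI)
    fix c c' assume c: "c \<in> {..<prod_list (m # ms)}" "c' \<in> {..<prod_list (m # ms)}"
      and e: "dec (m # ms) c = dec (m # ms) c'"
    have "c div m < prod_list ms" "c' div m < prod_list ms"
      using c by (auto simp: less_mult_imp_div_less mult.commute)
    then have "c div m = c' div m"
      using e bij_betw_imp_inj_on[OF Cons] by (auto simp: inj_on_def)
    moreover have "c mod m = c' mod m" using e by simp
    ultimately show "c = c'" by (metis div_mult_mod_eq)
  qed
  moreover have "dec (m # ms) ` {..<prod_list (m # ms)} = idx (m # ms)"
  proof
    show "dec (m # ms) ` {..<prod_list (m # ms)} \<subseteq> idx (m # ms)"
    proof
      fix i assume "i \<in> dec (m # ms) ` {..<prod_list (m # ms)}"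
      then obtain c where c: "c < m * prod_list ms" "i = (c mod m) # dec ms (c div m)" by auto
      have "0 < m" using c by (cases m) auto
      moreover have "dec ms (c div m) \<in> idx ms"
        using c Cons by (auto simp: bij_betw_def less_mult_imp_div_less mult.commute)
      ultimately show "i \<in> idx (m # ms)" unfolding idx_Cons c(2) by (intro image_eqI[of _ _ "(c mod m, dec ms (c div m))"]) auto
    qed
    show "idx (m # ms) \<subseteq> dec (m # ms) ` {..<prod_list (m # ms)}"
    proof
      fix i assume "i \<in> idx (m # ms)"
      then obtain x xs where x: "i = x # xs" "x < m" "xs \<in> idx ms" by (auto simp: idx_Cons)
      then obtain c where c: "c < prod_list ms" "xs = dec ms c" using Cons by (auto simp: bij_betw_def)
      have "x + m * c < m * Suc c" using x by simp
      also have "\<dots> \<le> m * prod_list ms" using c by (intro mult_le_mono2) auto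
      finally have "x + m * c < prod_list (m # ms)" by simp
      moreover have "dec (m # ms) (x + m * c) = i" using x c by simp
      ultimately show "i \<in> dec (m # ms) ` {..<prod_list (m # ms)}" by blast
    qed
  qed
  ultimately show ?case unfolding bij_betw_def by blast
qed

lemma finite_idx: "finite (idx n)"
  using bij_betw_finite[OF bij_betw_dec[of n]] by simp

lemma remove_at_length: "j < length xs \<Longrightarrow> length (remove_at j xs) = length xs - 1"
  by (simp add: remove_at_def)

lemma insert_at_length: "j \<le> length xs \<Longrightarrow> length (insert_at j x xs) = Suc (length xs)"
  by (simp add: insert_at_def)

lemma insert_at_remove_at: "j < length xs \<Longrightarrow> insert_at j (xs ! j) (remove_at j xs) = xs"
  by (simp add: insert_at_def remove_at_def id_take_nth_drop[symmetric])

lemma remove_at_insert_at: "j \<le> length xs \<Longrightarrow> remove_at j (insert_at j x xs) = xs"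
  by (simp add: insert_at_def remove_at_def)

lemma insert_at_nth_same: "j \<le> length xs \<Longrightarrow> insert_at j x xs ! j = x"
  by (simp add: insert_at_def nth_append)

lemma insert_at_update: "j \<le> length xs \<Longrightarrow> (insert_at j x xs)[j := y] = insert_at j y xs"
  by (simp add: insert_at_def list_update_append)

lemma insert_at_in_idx:
  assumes "j < length n" "s < n ! j" "xs \<in> idx (remove_at j n)"
  shows "insert_at j s xs \<in> idx n"
proof -
  have l: "length xs = length n - 1" using assms by (simp add: idx_def remove_at_length)
  have "insert_at j s xs ! t < n ! t" if t: "t < length n" for t
  proof -
    consider "t < j" | "t = j" | "j < t" by linarith
    then show ?thesis
    proof cases
      case 1
      then have "xs ! t < remove_at j n ! t" using assms l by (auto simp: idx_def remove_at_length)
      then show ?thesis using 1 assms l by (simp add: insert_at_def remove_at_def nth_append)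
    next
      case 2
      then show ?thesis using assms l by (simp add: insert_at_nth_same)
    next
      case 3
      then obtain t' where t': "t = Suc t'" "j \<le> t'" by (cases t) auto
      have "xs ! t' < remove_at j n ! t'" using assms l t t' by (auto simp: idx_def remove_at_length)
      then show ?thesis using assms l t
        using t'(2) by (simp add: t'(1) insert_at_def remove_at_def nth_append min_absorb2 Suc_diff_le)
    qed
  qed
  moreover have "length (insert_at j s xs) = length n"
    using assms(1) l by (simp add: insert_at_length)
  ultimately show ?thesis by (simp add: idx_def)
qed

lemma remove_at_in_idx:
  assumes "j < length n" "i \<in> idx n"
  shows "remove_at j i \<in> idx (remove_at j n)"
  using assms by (auto simp: idx_def remove_at_def nth_append)

lemma sum_idx_fibres:
  fixes f :: "nat list \<Rightarrow> real"
  assumes j: "j < length n"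
  shows "(\<Sum>i\<in>idx n. f i) = (\<Sum>s<n ! j. \<Sum>c<Ndim n j. f (insert_at j s (dec (remove_at j n) c)))"
proof -
  have "(\<Sum>i\<in>idx n. f i) = (\<Sum>(s, xs)\<in>{..<n ! j} \<times> idx (remove_at j n). f (insert_at j s xs))"
  proof (rule sum.reindex_bij_witness[of _ "\<lambda>(s, xs). insert_at j s xs" "\<lambda>i. (i ! j, remove_at j i)"])
    fix i assume i: "i \<in> idx n"
    then have l: "length i = length n" by (simp add: idx_def)
    show "(case (i ! j, remove_at j i) of (s, xs) \<Rightarrow> insert_at j s xs) = i"
      using j l by (simp add: insert_at_remove_at)
    then show "(case (i ! j, remove_at j i) of (s, xs) \<Rightarrow> f (insert_at j s xs)) = f i" by simp
    show "(i ! j, remove_at j i) \<in> {..<n ! j} \<times> idx (remove_at j n)"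
      using i j remove_at_in_idx[OF j i] by (auto simp: idx_def)
  next
    fix z assume "z \<in> {..<n ! j} \<times> idx (remove_at j n)"
    then obtain s xs where z: "z = (s, xs)" "s < n ! j" "xs \<in> idx (remove_at j n)" by auto
    then have l: "length xs = length n - 1" using j by (simp add: idx_def remove_at_length)
    show "((case z of (s, xs) \<Rightarrow> insert_at j s xs) ! j, remove_at j (case z of (s, xs) \<Rightarrow> insert_at j s xs)) = z"
      using j l by (simp add: z insert_at_nth_same remove_at_insert_at)
    show "(case z of (s, xs) \<Rightarrow> insert_at j s xs) \<in> idx n"
      using insert_at_in_idx[OF j z(2,3)] by (simp add: z)
  qed
  also have "\<dots> = (\<Sum>s<n ! j. \<Sum>xs\<in>idx (remove_at j n). f (insert_at j s xs))"
    by (simp add: sum.cartesian_product)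
  also have "\<dots> = (\<Sum>s<n ! j. \<Sum>c<Ndim n j. f (insert_at j s (dec (remove_at j n) c)))"
    unfolding Ndim_def
    by (intro sum.cong refl sum.reindex_bij_betw[OF bij_betw_dec, symmetric])
  finally show ?thesis .
qed

section \<open>Projections acting along one mode\<close>

definition fibre :: "nat list \<Rightarrow> nat \<Rightarrow> tensor \<Rightarrow> nat \<Rightarrow> nat \<Rightarrow> real" where
  "fibre n j X i c = X (insert_at j i (dec (remove_at j n) c))"

lemma unfold_fibre: "i < n ! j \<Longrightarrow> c < Ndim n j \<Longrightarrow> unfold n j X $$ (i, c) = fibre n j X i c"
  by (simp add: unfold_def fibre_def)

lemma fro_norm_L2: "fro_norm n X = L2_set X (idx n)"
  by (simp add: fro_norm_def L2_set_def)

lemma fro_norm_nonneg [simp]: "0 \<le> fro_norm n X"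
  by (simp add: fro_norm_L2)

lemma fro_norm_fibre:
  assumes "j < length n"
  shows "(fro_norm n X)^2 = (\<Sum>c<Ndim n j. (nrm (n ! j) (\<lambda>i. fibre n j X i c))^2)"
  unfolding fro_norm_L2 L2_set_squared sum_idx_fibres[OF assms] fibre_def by (rule sum.swap)

lemma fibre_mode_prod:
  assumes j: "j < length n" and c: "c < Ndim n j"
  shows "fibre n j (mode_prod n X j M) i c = (\<Sum>s<n ! j. M $$ (i, s) * fibre n j X s c)"
proof -
  have "dec (remove_at j n) c \<in> idx (remove_at j n)"
    using bij_betw_dec[of "remove_at j n"] c by (auto simp: bij_betw_def Ndim_def)
  then have "j \<le> length (dec (remove_at j n) c)" using j by (simp add: idx_def remove_at_length)
  then show ?thesis by (simp add: fibre_def mode_prod_def insert_at_nth_same insert_at_update)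
qed

text \<open>A full basis is required, not just \<open>r\<close> vectors, so that the residual of a
  projection is read off from the coefficients with index at least \<open>r\<close>.\<close>

definition proj_on :: "nat \<Rightarrow> nat \<Rightarrow> rmat \<Rightarrow> real mat \<Rightarrow> bool" where
  "proj_on m r w M \<longleftrightarrow> onsys m m w \<and> r \<le> m \<and> (\<forall>a<m. \<forall>b<m. M $$ (a, b) = (\<Sum>c<r. w c a * w c b))"

lemma proj_on_apply:
  assumes "proj_on m r w M" "i < m"
  shows "(\<Sum>s<m. M $$ (i, s) * x s) = (\<Sum>c<r. ip m x (w c) * w c i)"
proof -
  have "(\<Sum>s<m. M $$ (i, s) * x s) = (\<Sum>s<m. \<Sum>c<r. w c i * w c s * x s)"
    using assms by (auto simp: proj_on_def sum_distrib_right intro!: sum.cong)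
  also have "\<dots> = (\<Sum>c<r. ip m x (w c) * w c i)"
    unfolding ip_def sum_distrib_right by (subst sum.swap) (simp add: mult_ac)
  finally show ?thesis .
qed

lemma proj_on_norm:
  assumes M: "proj_on m r w M"
  shows "(nrm m (\<lambda>i. \<Sum>s<m. M $$ (i, s) * x s))^2 = (pn m r w x)^2"
proof -
  have on: "onsys m r w" using M by (auto simp: proj_on_def onsys_def)
  have "nrm m (\<lambda>i. \<Sum>s<m. M $$ (i, s) * x s) = nrm m (\<lambda>i. \<Sum>c<r. ip m x (w c) * w c i)"
    using proj_on_apply[OF M] by (intro L2_set_cong) auto
  then have "(nrm m (\<lambda>i. \<Sum>s<m. M $$ (i, s) * x s))^2 = (\<Sum>c<r. ip m x (w c) * ip m x (w c))"
    by (simp only: ip_self[symmetric] onsys_comb_norm[OF on])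
  then show ?thesis unfolding pn_squared by (simp add: power2_eq_square[of "ip m x _"])
qed

lemma proj_on_residual:
  assumes M: "proj_on m r w M"
  shows "(nrm m (\<lambda>i. x i - (\<Sum>s<m. M $$ (i, s) * x s)))^2 = (\<Sum>c\<in>{r..<m}. (ip m x (w c))^2)"
proof -
  have on: "onsys m m w" and r: "r \<le> m" using M by (auto simp: proj_on_def)
  define g where "g c = (if c < r then 0 else ip m x (w c))" for c
  have "x i - (\<Sum>s<m. M $$ (i, s) * x s) = (\<Sum>c<m. g c * w c i)" if "i < m" for i
  proof -
    have "x i = (\<Sum>c<m. ip m x (w c) * w c i)" using onsys_expand[OF on that] by simp
    moreover have "(\<Sum>c<r. ip m x (w c) * w c i) = (\<Sum>c<m. (if c < r then ip m x (w c) else 0) * w c i)"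
      using r by (intro sum.mono_neutral_cong_left) auto
    ultimately show ?thesis unfolding proj_on_apply[OF M that]
      by (simp add: g_def sum_subtractf[symmetric]) (intro sum.cong, auto)
  qed
  then have "nrm m (\<lambda>i. x i - (\<Sum>s<m. M $$ (i, s) * x s)) = nrm m (\<lambda>i. \<Sum>c<m. g c * w c i)"
    by (intro L2_set_cong) auto
  then have "(nrm m (\<lambda>i. x i - (\<Sum>s<m. M $$ (i, s) * x s)))^2 = (\<Sum>c<m. g c * g c)"
    by (simp only: ip_self[symmetric] onsys_comb_norm[OF on])
  also have "\<dots> = (\<Sum>c\<in>{r..<m}. (ip m x (w c))^2)"
    by (intro sum.mono_neutral_cong_right) (auto simp: g_def power2_eq_square)
  finally show ?thesis .
qed

lemma mode_prod_contraction:
  assumes j: "j < length n" and M: "proj_on (n ! j) r w M"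
  shows "fro_norm n (mode_prod n X j M) \<le> fro_norm n X"
proof (rule power2_le_imp_le)
  have "(nrm (n ! j) (\<lambda>i. fibre n j (mode_prod n X j M) i c))^2 \<le> (nrm (n ! j) (\<lambda>i. fibre n j X i c))^2"
    if "c < Ndim n j" for c
    unfolding fibre_mode_prod[OF j that] proj_on_norm[OF M]
    using M by (intro power_mono pn_le_nrm[of _ "n ! j"]) (auto simp: proj_on_def)
  then show "(fro_norm n (mode_prod n X j M))^2 \<le> (fro_norm n X)^2"
    unfolding fro_norm_fibre[OF j] by (intro sum_mono) auto
qed simp

lemma mode_prod_residual:
  assumes j: "j < length n" and M: "proj_on (n ! j) r w M"
  shows "(fro_norm n (\<lambda>i. X i - mode_prod n X j M i))^2
       = (\<Sum>c<Ndim n j. \<Sum>b\<in>{r..<n ! j}. (ip (n ! j) (\<lambda>i. fibre n j X i c) (w b))^2)"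
proof -
  have "fibre n j (\<lambda>i. X i - mode_prod n X j M i) i c
      = fibre n j X i c - (\<Sum>s<n ! j. M $$ (i, s) * fibre n j X s c)" if "c < Ndim n j" for i c
    using fibre_mode_prod[OF j that, of X M i] by (simp add: fibre_def)
  then show ?thesis unfolding fro_norm_fibre[OF j]
    by (intro sum.cong refl) (simp add: proj_on_residual[OF M])
qed

lemma mode_prod_diff: "mode_prod n (\<lambda>i. X i - Y i) j M i = mode_prod n X j M i - mode_prod n Y j M i"
  by (simp add: mode_prod_def sum_subtractf algebra_simps)

lemma fro_norm_triangle: "fro_norm n (\<lambda>i. X i + Y i) \<le> fro_norm n X + fro_norm n Y"
  unfolding fro_norm_L2 by (rule L2_set_triangle_ineq)

section \<open>Successive projections over several modes\<close>

definition mmp :: "nat list \<Rightarrow> (nat \<Rightarrow> real mat) \<Rightarrow> nat \<Rightarrow> tensor \<Rightarrow> tensor" where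
  "mmp n Q m X = foldl (\<lambda>X j. mode_prod n X j (Q j)) X [0..<m]"

lemma mmp_0: "mmp n Q 0 X = X"
  by (simp add: mmp_def)

lemma mmp_Suc: "mmp n Q (Suc m) X = mode_prod n (mmp n Q m X) m (Q m)"
  by (simp add: mmp_def)

lemma multi_mode_prod_mmp: "multi_mode_prod n X Q = mmp n Q (length n) X"
  by (simp add: multi_mode_prod_def mmp_def)

text \<open>Telescoping: the residual after another mode is the residual of that mode alone plus the
  projection of the previous residual, and projections do not increase the norm.\<close>

lemma mmp_residual:
  assumes "m \<le> length n" "\<And>j. j < m \<Longrightarrow> proj_on (n ! j) r (w j) (Q j)"
  shows "fro_norm n (\<lambda>i. X i - mmp n Q m X i) \<le> (\<Sum>j<m. fro_norm n (\<lambda>i. X i - mode_prod n X j (Q j) i))"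
  using assms
proof (induction m)
  case 0
  then show ?case by (simp add: mmp_0 fro_norm_def)
next
  case (Suc m)
  have eq: "(\<lambda>i. X i - mmp n Q (Suc m) X i)
      = (\<lambda>i. (X i - mode_prod n X m (Q m) i) + mode_prod n (\<lambda>i. X i - mmp n Q m X i) m (Q m) i)"
    by (rule ext) (simp add: mmp_Suc mode_prod_diff)
  have "fro_norm n (\<lambda>i. X i - mmp n Q (Suc m) X i)
      \<le> fro_norm n (\<lambda>i. X i - mode_prod n X m (Q m) i) + fro_norm n (mode_prod n (\<lambda>i. X i - mmp n Q m X i) m (Q m))"
    unfolding eq by (rule fro_norm_triangle)
  also have "fro_norm n (mode_prod n (\<lambda>i. X i - mmp n Q m X i) m (Q m)) \<le> fro_norm n (\<lambda>i. X i - mmp n Q m X i)"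
    using Suc.prems by (intro mode_prod_contraction[of _ _ r "w m"]) auto
  also have "\<dots> \<le> (\<Sum>j<m. fro_norm n (\<lambda>i. X i - mode_prod n X j (Q j) i))"
    using Suc by auto
  finally show ?case by simp
qed

lemma idx_update: "i \<in> idx n \<Longrightarrow> s < n ! j \<Longrightarrow> i[j := s] \<in> idx n"
  by (cases "j < length n") (auto simp: idx_def nth_list_update)

lemma mmp_cong:
  assumes "\<And>i. i \<in> idx n \<Longrightarrow> X i = Y i" "i \<in> idx n"
  shows "mmp n Q m X i = mmp n Q m Y i"
  using assms(2)
  by (induction m arbitrary: i) (auto simp: mmp_0 assms(1) mmp_Suc mode_prod_def idx_update intro!: sum.cong)

lemma mmp_sum: "mmp n Q m (\<lambda>i. \<Sum>s\<in>I. c s * X s i) i = (\<Sum>s\<in>I. c s * mmp n Q m (X s) i)"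
proof (induction m arbitrary: i)
  case 0
  then show ?case by (simp add: mmp_0)
next
  case (Suc m)
  have "mmp n Q (Suc m) (\<lambda>i. \<Sum>s\<in>I. c s * X s i) i
      = (\<Sum>t<n ! m. \<Sum>s\<in>I. c s * (Q m $$ (i ! m, t) * mmp n Q m (X s) (i[m := t])))"
    by (simp add: mmp_Suc mode_prod_def Suc sum_distrib_left mult_ac)
  also have "\<dots> = (\<Sum>s\<in>I. c s * mmp n Q (Suc m) (X s) i)"
    unfolding mmp_Suc mode_prod_def sum_distrib_left by (rule sum.swap)
  finally show ?case .
qed

definition unit_tensor :: "nat list \<Rightarrow> tensor" where
  "unit_tensor s i = (if i = s then 1 else 0)"

text \<open>The image of a unit tensor is a product of matrix columns in the modes already treated
  and is still a unit tensor in the others.\<close>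

lemma mmp_unit:
  assumes s: "s \<in> idx n" and m: "m \<le> length n" and i: "i \<in> idx n"
  shows "mmp n Q m (unit_tensor s) i = (\<Prod>t<m. Q t $$ (i ! t, s ! t)) * (if drop m i = drop m s then 1 else 0)"
  using m i
proof (induction m arbitrary: i)
  case 0
  then show ?case by (simp add: mmp_0 unit_tensor_def)
next
  case (Suc m)
  have l: "length i = length n" "length s = length n" using Suc.prems s by (auto simp: idx_def)
  have d: "drop m (i[m := t]) = t # drop (Suc m) i" for t
    using Suc.prems(1) l by (simp add: drop_update_swap Cons_nth_drop_Suc[symmetric])
  have ds: "drop m s = s ! m # drop (Suc m) s"
    using Suc.prems(1) l by (simp add: Cons_nth_drop_Suc)
  have "mmp n Q (Suc m) (unit_tensor s) i
      = (\<Sum>t<n ! m. Q m $$ (i ! m, t) * ((\<Prod>t'<m. Q t' $$ (i[m := t] ! t', s ! t')) * (if drop m (i[m := t]) = drop m s then 1 else 0)))"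
    unfolding mmp_Suc mode_prod_def using Suc by (intro sum.cong refl) (simp add: idx_update)
  also have "\<dots> = (\<Sum>t<n ! m. if t = s ! m then Q m $$ (i ! m, t) * ((\<Prod>t'<m. Q t' $$ (i ! t', s ! t')) * (if drop (Suc m) i = drop (Suc m) s then 1 else 0)) else 0)"
    unfolding d ds by (intro sum.cong refl) auto
  also have "\<dots> = Q m $$ (i ! m, s ! m) * ((\<Prod>t'<m. Q t' $$ (i ! t', s ! t')) * (if drop (Suc m) i = drop (Suc m) s then 1 else 0))"
    using s Suc.prems(1) by (auto simp: idx_def)
  finally show ?case by simp
qed

lemma sum_prod_idx:
  fixes g :: rmat
  shows "(\<Sum>i\<in>idx n. \<Prod>t<length n. g t (i ! t)) = (\<Prod>t<length n. \<Sum>s<n ! t. g t s)"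
proof (induction n arbitrary: g)
  case Nil
  then show ?case by (simp add: idx_Nil)
next
  case (Cons m ms)
  have inj: "inj_on (\<lambda>(x, xs). x # xs) ({..<m} \<times> idx ms)" by (auto simp: inj_on_def)
  have "(\<Sum>i\<in>idx (m # ms). \<Prod>t<length (m # ms). g t (i ! t))
      = (\<Sum>x<m. \<Sum>xs\<in>idx ms. \<Prod>t<Suc (length ms). g t ((x # xs) ! t))"
    unfolding idx_Cons by (subst sum.reindex[OF inj]) (simp add: sum.cartesian_product' case_prod_unfold)
  also have "\<dots> = (\<Sum>x<m. g 0 x) * (\<Sum>xs\<in>idx ms. \<Prod>t<length ms. g (Suc t) (xs ! t))"
    by (simp only: prod.lessThan_Suc_shift) (simp add: sum_product)
  also have "\<dots> = (\<Prod>t<length (m # ms). \<Sum>s<(m # ms) ! t. g t s)"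
    using Cons[of "\<lambda>t. g (Suc t)"] unfolding list.size(4) add_Suc_right add_0_right
    by (simp only: prod.lessThan_Suc_shift) simp
  finally show ?case .
qed

text \<open>The image is a rank-one tensor, so its norm is the product of the norms of its columns.
  Column \<open>s ! t\<close> of a projection is as long as row \<open>s ! t\<close> of its basis
  vectors; this is how the incoherence of all modes multiplies.\<close>

lemma mmp_unit_norm:
  assumes s: "s \<in> idx n" and Q: "\<And>j. j < length n \<Longrightarrow> proj_on (n ! j) r (w j) (Q j)"
  shows "(L2_set (mmp n Q (length n) (unit_tensor s)) (idx n))^2 = (\<Prod>t<length n. (pn (n ! t) r (w t) (ev (s ! t)))^2)"
proof -
  have sl: "length s = length n" "\<And>t. t < length n \<Longrightarrow> s ! t < n ! t" using s by (auto simp: idx_def)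
  have "(L2_set (mmp n Q (length n) (unit_tensor s)) (idx n))^2
      = (\<Sum>i\<in>idx n. \<Prod>t<length n. (Q t $$ (i ! t, s ! t))^2)"
    unfolding L2_set_squared using sl
    by (intro sum.cong refl) (simp add: mmp_unit[OF s order_refl] idx_def prod_power_distrib)
  also have "\<dots> = (\<Prod>t<length n. \<Sum>a<n ! t. (Q t $$ (a, s ! t))^2)" by (rule sum_prod_idx)
  also have "\<dots> = (\<Prod>t<length n. (pn (n ! t) r (w t) (ev (s ! t)))^2)"
  proof (intro prod.cong refl)
    fix t assume t: "t \<in> {..<length n}"
    have "(pn (n ! t) r (w t) (ev (s ! t)))^2 = (nrm (n ! t) (\<lambda>i. \<Sum>b<n ! t. Q t $$ (i, b) * ev (s ! t) b))^2"
      using proj_on_norm[OF Q] t by simp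
    also have "(\<lambda>i. \<Sum>b<n ! t. Q t $$ (i, b) * ev (s ! t) b) = (\<lambda>i. Q t $$ (i, s ! t))"
    proof
      fix i
      have "(\<Sum>b<n ! t. Q t $$ (i, b) * ev (s ! t) b) = ip (n ! t) (ev (s ! t)) (\<lambda>b. Q t $$ (i, b))"
        by (simp add: ip_def mult.commute)
      then show "(\<Sum>b<n ! t. Q t $$ (i, b) * ev (s ! t) b) = Q t $$ (i, s ! t)"
        using sl(2) t by (simp add: ip_ev)
    qed
    finally show "(\<Sum>a<n ! t. (Q t $$ (a, s ! t))^2) = (pn (n ! t) r (w t) (ev (s ! t)))^2"
      by (simp add: L2_set_squared)
  qed
  finally show ?thesis .
qed

definition zT :: "nat list \<Rightarrow> (nat \<Rightarrow> real mat) \<Rightarrow> tensor \<Rightarrow> nat list \<Rightarrow> tensor" where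
  "zT n Q T s i = T s * mmp n Q (length n) (unit_tensor s) i"

lemma mmp_idx_expand:
  assumes "i \<in> idx n"
  shows "mmp n Q m X i = (\<Sum>s\<in>idx n. X s * mmp n Q m (unit_tensor s) i)"
proof -
  have "mmp n Q m X i = mmp n Q m (\<lambda>i. \<Sum>s\<in>idx n. X s * unit_tensor s i) i"
  proof (rule mmp_cong[OF _ assms])
    fix i assume "i \<in> idx n"
    have "(\<Sum>s\<in>idx n. X s * unit_tensor s i) = (\<Sum>s\<in>idx n. if s = i then X s else 0)"
      by (intro sum.cong) (auto simp: unit_tensor_def)
    then show "X i = (\<Sum>s\<in>idx n. X s * unit_tensor s i)" using \<open>i \<in> idx n\<close> finite_idx by simp
  qed
  then show ?thesis by (simp add: mmp_sum)
qed

text \<open>By linearity the projected sample differs from the projection of \<open>T\<close> by the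
  sum over entries \<open>s\<close> of centred coefficients times the image of the unit tensor at
  \<open>s\<close>.\<close>

lemma estimate_error_split:
  assumes Q: "\<And>j. j < length n \<Longrightarrow> proj_on (n ! j) r (w j) (Q j)"
  shows "fro_norm n (\<lambda>i. T i - multi_mode_prod n (\<lambda>i. P_Omega Om T i / q) Q i)
     \<le> (\<Sum>j<length n. fro_norm n (\<lambda>i. T i - mode_prod n T j (Q j) i))
       + L2_set (noise q (idx n) (zT n Q T) Om) (idx n)"
proof -
  let ?m = "mmp n Q (length n)"
  have "T i - ?m (\<lambda>i. P_Omega Om T i / q) i = (T i - ?m T i) + (-1) * noise q (idx n) (zT n Q T) Om i"
    if i: "i \<in> idx n" for i
  proof -
    have "?m (\<lambda>i. P_Omega Om T i / q) i - ?m T i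
        = (\<Sum>s\<in>idx n. (P_Omega Om T s / q - T s) * ?m (unit_tensor s) i)"
      unfolding mmp_idx_expand[OF i, of _ _ T] mmp_idx_expand[OF i, of _ _ "\<lambda>i. P_Omega Om T i / q"]
      by (simp add: sum_subtractf algebra_simps)
    also have "\<dots> = noise q (idx n) (zT n Q T) Om i"
      unfolding noise_def zT_def P_Omega_def by (intro sum.cong refl) (simp add: algebra_simps)
    finally show ?thesis by simp
  qed
  then have "fro_norm n (\<lambda>i. T i - ?m (\<lambda>i. P_Omega Om T i / q) i)
      = L2_set (\<lambda>i. (T i - ?m T i) + (-1) * noise q (idx n) (zT n Q T) Om i) (idx n)"
    unfolding fro_norm_L2 by (intro L2_set_cong) auto
  also have "\<dots> \<le> fro_norm n (\<lambda>i. T i - ?m T i) + L2_set (\<lambda>i. (-1) * noise q (idx n) (zT n Q T) Om i) (idx n)"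
    unfolding fro_norm_L2 by (rule L2_set_triangle_ineq)
  also have "L2_set (\<lambda>i. (-1) * noise q (idx n) (zT n Q T) Om i) (idx n) = L2_set (noise q (idx n) (zT n Q T) Om) (idx n)"
    by (subst L2_set_scale) simp
  also have "fro_norm n (\<lambda>i. T i - ?m T i) \<le> (\<Sum>j<length n. fro_norm n (\<lambda>i. T i - mode_prod n T j (Q j) i))"
    using Q by (intro mmp_residual[of _ _ r w]) auto
  finally show ?thesis by (simp add: multi_mode_prod_mmp)
qed

section \<open>Translation from matrices\<close>

lemma eigsys_cong:
  assumes "\<And>i j. i < n \<Longrightarrow> j < n \<Longrightarrow> Z i j = Z' i j" "eigsys n Z w \<mu>"
  shows "eigsys n Z' w \<mu>"
  using assms(2) mv_cong[of n Z' Z] assms(1) unfolding eigsys_def by (metis mv_cong)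

lemma onsys_of_mat:
  assumes "U \<in> carrier_mat n r" "transpose_mat U * U = 1\<^sub>m r"
  shows "onsys n r (\<lambda>d i. U $$ (i, d))"
  unfolding onsys_def
proof (intro allI impI)
  fix c d assume cd: "c < r" "d < r"
  have "(transpose_mat U * U) $$ (c, d) = (1\<^sub>m r) $$ (c, d)" using assms by simp
  then show "ip n (\<lambda>i. U $$ (i, c)) (\<lambda>i. U $$ (i, d)) = (if c = d then 1 else 0)"
    using assms(1) cd by (auto simp: scalar_prod_def ip_def lessThan_atLeast0)
qed

lemma svd_entry:
  assumes svd: "compact_svd A r U S V" and il: "i < dim_row A" "l < dim_col A"
  shows "A $$ (i, l) = (\<Sum>d<r. S $$ (d, d) * U $$ (i, d) * V $$ (l, d))"
proof -
  have c: "U \<in> carrier_mat (dim_row A) r" "V \<in> carrier_mat (dim_col A) r" "S \<in> carrier_mat r r"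
    and S0: "\<And>i l. i < r \<Longrightarrow> l < r \<Longrightarrow> i \<noteq> l \<Longrightarrow> S $$ (i, l) = 0"
    and A: "A = U * S * transpose_mat V"
    using svd unfolding compact_svd_def by blast+
  have US: "(U * S) $$ (i, d) = U $$ (i, d) * S $$ (d, d)" if "d < r" for d
  proof -
    have "(U * S) $$ (i, d) = (\<Sum>e<r. U $$ (i, e) * S $$ (e, d))"
      using c that il by (auto simp: scalar_prod_def lessThan_atLeast0 intro!: sum.cong)
    also have "\<dots> = (\<Sum>e<r. if e = d then U $$ (i, e) * S $$ (e, d) else 0)"
      using S0 that by (intro sum.cong) auto
    finally show ?thesis using that by simp
  qed
  have "(B * transpose_mat V) $$ (i, l) = (\<Sum>d<r. B $$ (i, d) * V $$ (l, d))"
    if "B \<in> carrier_mat (dim_row A) r" for B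
    using that c il by (auto simp: scalar_prod_def lessThan_atLeast0 intro!: sum.cong)
  from this[of "U * S"] have "(U * S * transpose_mat V) $$ (i, l) = (\<Sum>d<r. (U * S) $$ (i, d) * V $$ (l, d))"
    using c by simp
  then have "A $$ (i, l) = (\<Sum>d<r. (U * S) $$ (i, d) * V $$ (l, d))" using A by simp
  then show ?thesis by (simp add: US mult_ac)
qed

lemma row_norm_le_2inf:
  assumes "U \<in> carrier_mat m r" "i < m"
  shows "(\<Sum>d<r. (U $$ (i, d))^2) \<le> (norm_2inf U)^2"
proof -
  have v: "(vnorm (Matrix.row U i))^2 = (\<Sum>d<r. (U $$ (i, d))^2)" and v0: "0 \<le> vnorm (Matrix.row U i)"
    using assms by (auto simp: vnorm_def scalar_prod_def power2_eq_square lessThan_atLeast0 sum_nonneg)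
  have "vnorm (Matrix.row U i) \<le> norm_2inf U"
    unfolding norm_2inf_def using assms by (intro Max_ge) auto
  then show ?thesis using v v0 by (metis power_mono)
qed

lemma vnorm_vec: "vnorm (Matrix.vec m f) = nrm m f"
  by (simp add: vnorm_def scalar_prod_def L2_set_def power2_eq_square lessThan_atLeast0)

lemma mult_mat_vec_mv:
  assumes "M \<in> carrier_mat m m"
  shows "M *\<^sub>v Matrix.vec m x = Matrix.vec m (mv m (\<lambda>i j. M $$ (i, j)) x)"
  using assms by (intro eq_vecI) (auto simp: mv_def scalar_prod_def lessThan_atLeast0)

text \<open>\<open>spec_norm\<close> is a supremum and useful only once its set is known to be
  bounded; the Frobenius norm \<open>F\<close> provides the bound. Scaling to unit length then gives
  the inequality.\<close>

lemma nrm_mv_le_spec_norm: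
  assumes M: "M \<in> carrier_mat m m"
  shows "nrm m (mv m (\<lambda>i j. M $$ (i, j)) x) \<le> spec_norm M * nrm m x"
proof -
  let ?Mf = "\<lambda>i j. M $$ (i, j)"
  let ?X = "{vnorm (M *\<^sub>v y) | y. y \<in> carrier_vec (dim_col M) \<and> vnorm y \<le> 1}"
  define F where "F = L2_set (\<lambda>i. nrm m (?Mf i)) {..<m}"
  have vec: "y = Matrix.vec m (\<lambda>i. vec_index y i)" if "y \<in> carrier_vec m" for y :: "real Matrix.vec"
    using that by (intro eq_vecI) auto
  have fb: "nrm m (mv m ?Mf y) \<le> F * nrm m y" for y
  proof -
    have "nrm m (mv m ?Mf y) \<le> L2_set (\<lambda>i. nrm m y * nrm m (?Mf i)) {..<m}"
      using abs_ip_le[of m "?Mf _" y]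
      by (intro L2_set_abs_mono) (auto simp: mv_def ip_def mult.commute abs_mult)
    then show ?thesis by (simp add: L2_set_scale F_def mult.commute)
  qed
  have F0: "0 \<le> F" by (simp add: F_def)
  have "bdd_above ?X"
  proof (rule bdd_aboveI[of _ F])
    fix t assume "t \<in> ?X"
    then obtain y where y: "t = vnorm (M *\<^sub>v y)" "y \<in> carrier_vec m" "vnorm y \<le> 1" using M by auto
    define f where "f = (\<lambda>i. vec_index y i)"
    have yf: "y = Matrix.vec m f" using vec[OF y(2)] by (simp add: f_def)
    have "t \<le> F * nrm m f" using fb[of f] by (simp add: y(1) yf mult_mat_vec_mv[OF M] vnorm_vec)
    also have "\<dots> \<le> F * 1" using y(3) F0 by (intro mult_left_mono) (simp_all add: yf vnorm_vec)
    finally show "t \<le> F" by simp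
  qed
  then have sup: "nrm m (mv m ?Mf y) \<le> spec_norm M" if "nrm m y \<le> 1" for y
    unfolding spec_norm_def using M that
    by (intro cSup_upper CollectI exI[of _ "Matrix.vec m y"]) (auto simp: mult_mat_vec_mv[OF M] vnorm_vec)
  show ?thesis
  proof (cases "nrm m x = 0")
    case True
    then show ?thesis using fb[of x] by simp
  next
    case False
    then have pos: "0 < nrm m x" using L2_set_nonneg[of x "{..<m}"] by linarith
    let ?c = "1 / nrm m x"
    have "mv m ?Mf (\<lambda>i. ?c * x i) = (\<lambda>i. ?c * mv m ?Mf x i)"
      by (rule ext) (simp add: mv_def sum_distrib_left mult_ac)
    moreover have "nrm m (\<lambda>i. ?c * x i) \<le> 1" using pos by (simp only: L2_set_scale) simp
    ultimately have "nrm m (\<lambda>i. ?c * mv m ?Mf x i) \<le> spec_norm M" using sup by metis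
    then show ?thesis using pos by (simp only: L2_set_scale) (simp add: field_simps)
  qed
qed

lemma top_eigvecs_eigsys:
  assumes te: "top_eigvecs Z r Uh" and Z: "Z \<in> carrier_mat m m"
  shows "\<exists>w \<mu>. eigsys m (\<lambda>i j. Z $$ (i, j)) w \<mu> \<and> proj_on m r w (Uh * transpose_mat Uh)"
proof -
  define D where "D \<mu> = Matrix.mat m m (\<lambda>(i, l). if i = l then \<mu> i else (0::real))" for \<mu>
  obtain W \<mu> where W: "W \<in> carrier_mat m m" "transpose_mat W * W = 1\<^sub>m m"
    "\<And>i l. i \<le> l \<Longrightarrow> l < m \<Longrightarrow> \<mu> l \<le> \<mu> i" "Z = W * D \<mu> * transpose_mat W" "r \<le> m"
    "Uh = Matrix.mat m r (\<lambda>(i, l). W $$ (i, l))"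
    using te Z unfolding top_eigvecs_def D_def by auto
  define w where "w c i = W $$ (i, c)" for c i
  have on: "onsys m m w" unfolding w_def[abs_def] by (rule onsys_of_mat[OF W(1,2)])
  have D: "D \<mu> \<in> carrier_mat m m" by (simp add: D_def)
  have "Z * W = W * D \<mu> * (transpose_mat W * W)"
    unfolding W(4) using W(1) D by (intro assoc_mult_mat[of _ m m _ m _ m]) auto
  then have ZW: "Z * W = W * D \<mu>" using W(1,2) D by simp
  have "mv m (\<lambda>i j. Z $$ (i, j)) (w c) i = \<mu> c * w c i" if ci: "c < m" "i < m" for c i
  proof -
    have "mv m (\<lambda>i j. Z $$ (i, j)) (w c) i = (Z * W) $$ (i, c)"
      using Z W(1) ci by (simp add: mv_def w_def scalar_prod_def lessThan_atLeast0)
    also have "\<dots> = (\<Sum>e<m. W $$ (i, e) * D \<mu> $$ (e, c))"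
      unfolding ZW using D W(1) ci by (auto simp: scalar_prod_def lessThan_atLeast0 intro!: sum.cong)
    also have "\<dots> = (\<Sum>e<m. if e = c then W $$ (i, e) * \<mu> e else 0)"
      using ci by (intro sum.cong) (auto simp: D_def)
    finally show ?thesis using ci by (simp add: w_def)
  qed
  then have "eigsys m (\<lambda>i j. Z $$ (i, j)) w \<mu>" using on W(3) by (simp add: eigsys_def)
  moreover have "proj_on m r w (Uh * transpose_mat Uh)"
    unfolding proj_on_def using on W(5)
    by (auto simp: W(6) scalar_prod_def w_def lessThan_atLeast0)
  ultimately show ?thesis by blast
qed

lemma wedge_matrix_carrier: "wedge_matrix A p W \<in> carrier_mat (dim_row A) (dim_row A)"
  by (simp add: wedge_matrix_def)

lemma wedge_matrix_entry:
  assumes "a < dim_row A" "b < dim_row A"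
  shows "wedge_matrix A p W $$ (a, b)
       = (\<Sum>l<dim_col A. A $$ (a, l) * A $$ (b, l)) + wE p (dim_col A) (\<lambda>i l. A $$ (i, l)) W a b"
  using assms unfolding wedge_matrix_def wE_def sum.distrib[symmetric]
  by (auto intro!: sum.cong simp: algebra_simps)

section \<open>Jensen's inequality for \<open>cosh\<close> and finite product distributions\<close>

lemma cosh_avg_le:
  fixes x :: rvec
  assumes "0 < k"
  shows "cosh ((\<Sum>j<k. x j) / k) \<le> (\<Sum>j<k. cosh (x j)) / k"
proof -
  define m where "m = (\<Sum>j<k. x j) / k"
  \<comment> \<open>The tangent of \<open>cosh\<close> at the mean, obtained by averaging the
    tangent bounds of \<open>exp y\<close> and \<open>exp (- y)\<close>.\<close>
  have tangent: "cosh m + sinh m * (y - m) \<le> cosh y" for y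
  proof -
    have 1: "exp m * (1 + (y - m)) \<le> exp y"
      using mult_left_mono[OF exp_ge_add_one_self[of "y - m"], of "exp m"] by (simp add: exp_add[symmetric])
    have 2: "exp (- m) * (1 + (m - y)) \<le> exp (- y)"
      using mult_left_mono[OF exp_ge_add_one_self[of "m - y"], of "exp (- m)"] by (simp add: exp_add[symmetric])
    have "cosh m + sinh m * (y - m) = (exp m * (1 + (y - m)) + exp (- m) * (1 + (m - y))) / 2"
      by (simp add: cosh_def sinh_def field_simps)
    also have "\<dots> \<le> cosh y" using 1 2 by (simp add: cosh_def)
    finally show ?thesis .
  qed
  have "real k * cosh m = (\<Sum>j<k. cosh m + sinh m * (x j - m))"
    using assms by (simp add: sum.distrib sum_distrib_left[symmetric] sum_subtractf m_def)
  also have "\<dots> \<le> (\<Sum>j<k. cosh (x j))" by (intro sum_mono tangent)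
  finally show ?thesis using assms by (simp add: m_def field_simps)
qed

lemma prob_pair_le:
  assumes "finite (set_pmf P)" "finite (set_pmf R)"
    and "\<And>x. x \<in> set_pmf P \<Longrightarrow> pr R {y. (x, y) \<in> B} \<le> c"
  shows "pr (pair_pmf P R) B \<le> c"
proof -
  have "pr (pair_pmf P R) B = expect (pair_pmf P R) (indicator B)" by simp
  also have "\<dots> = expect P (\<lambda>x. expect R (\<lambda>y. indicator B (x, y)))"
    by (rule expectation_pair_pmf_finite[OF assms(1,2)])
  also have "\<dots> \<le> expect P (\<lambda>_. c)"
  proof (intro integral_mono_AE AE_pmfI integrable_measure_pmf_finite assms(1))
    fix x assume x: "x \<in> set_pmf P"
    have "(\<lambda>y. indicator B (x, y) :: real) = indicator {y. (x, y) \<in> B}" by (auto simp: indicator_def)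
    then show "expect R (\<lambda>y. indicator B (x, y)) \<le> c" using assms(3)[OF x] by simp
  qed
  finally show ?thesis by simp
qed

lemma prob_pair_fst: "pr (pair_pmf P R) {z. fst z \<in> B} = pr P B"
proof -
  have "pr P B = pr (map_pmf fst (pair_pmf P R)) B" by (simp add: map_fst_pair_pmf)
  then show ?thesis by (simp add: vimage_def)
qed

lemma expectation_Pi_pmf_component:
  fixes g :: "_ \<Rightarrow> real"
  assumes "finite I" "j \<in> I"
  shows "expect (Pi_pmf I d D) (\<lambda>f. g (f j)) = expect (D j) g"
proof -
  have "expect (D j) g = expect (map_pmf (\<lambda>f. f j) (Pi_pmf I d D)) g"
    using assms by (simp add: Pi_pmf_component)
  then show ?thesis by simp
qed

lemma finite_set_Pi_pmf:
  assumes "finite I" "\<And>j. j \<in> I \<Longrightarrow> finite (set_pmf (D j))"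
  shows "finite (set_pmf (Pi_pmf I d D))"
  using assms by (auto simp: set_Pi_pmf intro!: finite_PiE_dflt)

section \<open>All modes together\<close>

lemma prod_list_Ndim:
  assumes "j < length n" shows "prod_list n = n ! j * Ndim n j"
proof -
  have "prod_list n = prod_list (take j n @ n ! j # drop (Suc j) n)"
    using assms by (simp add: id_take_nth_drop[symmetric])
  then show ?thesis by (simp add: Ndim_def remove_at_def mult_ac)
qed

lemma prod_list_prod: "real (prod_list n) = (\<Prod>t<length n. real (n ! t))"
proof (induction n)
  case (Cons m ms)
  then show ?case by (simp only: list.size(4) add_Suc_right add_0_right prod.lessThan_Suc_shift) simp
qed simp

text \<open>\<open>kappa\<close> and \<open>nmax\<close> are upper bounds here rather than maxima.
  The bound \<open>2 \<le> nmax\<close> makes the logarithm positive; dimension 1 throughout is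
  treated separately at the end.\<close>

locale tensor_setup =
  fixes n :: "nat list" and T :: tensor and a :: real and r :: nat
    and U S V :: "nat \<Rightarrow> real mat" and mu1 mu2 p q kappa nmax :: real
  assumes k: "2 \<le> length n" and a: "2 \<le> a" and r: "1 \<le> r"
    and p: "0 < p" "p \<le> 1" and q: "0 < q" "q \<le> 1"
    and svd: "\<And>j. j < length n \<Longrightarrow> compact_svd (unfold n j T) r (U j) (S j) (V j)"
    and incU: "\<And>j. j < length n \<Longrightarrow> (norm_2inf (U j))^2 \<le> mu1 * r / real (n ! j)"
    and incV: "\<And>j. j < length n \<Longrightarrow> (norm_2inf (V j))^2 \<le> mu2 * r / real (Ndim n j)"
    and kappa: "\<And>j. j < length n \<Longrightarrow> S j $$ (0, 0) / S j $$ (r - 1, r - 1) \<le> kappa"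
    and p_ge: "20000 * kappa ^ 4 * a * mu1 * mu2 * (real r)^2 * ln nmax / real (prod_list n) \<le> p"
    and q_ge: "a * (real (length n) - 1) * ln nmax / real (prod_list n) \<le> q"
    and nmax: "2 \<le> nmax" "\<And>j. j < length n \<Longrightarrow> real (n ! j) \<le> nmax"
begin

abbreviation "k \<equiv> length n"
abbreviation "ntot \<equiv> real (prod_list n)"
abbreviation "Lg \<equiv> ln nmax"
abbreviation "aL \<equiv> a * Lg"
abbreviation "Am j \<equiv> fibre n j T"
abbreviation "Um j \<equiv> (\<lambda>d i. U j $$ (i, d))"
abbreviation "Vm j \<equiv> (\<lambda>d i. V j $$ (i, d))"
abbreviation "sm j \<equiv> (\<lambda>d. S j $$ (d, d))"
abbreviation "lam j \<equiv> (S j $$ (r - 1, r - 1))^2"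
abbreviation "sg j \<equiv> (S j $$ (0, 0))^2"
abbreviation "u2 j \<equiv> mu1 * r / real (n ! j)"
abbreviation "v2 j \<equiv> mu2 * r / real (Ndim n j)"
abbreviation "EUj j \<equiv> svd_mode.EU (n ! j) (Ndim n j) r (Am j) (Um j) p"
abbreviation "goodj j \<equiv> svd_mode.row_good (n ! j) (Ndim n j) r (Am j) (Um j) (sm j) (lam j) p"
abbreviation "Ej j \<equiv> wE p (Ndim n j) (Am j)"
abbreviation "Gj j \<equiv> Gm r (\<lambda>d. (sm j d)^2) (Um j)"
abbreviation "Zj j W \<equiv> wedge_matrix (unfold n j T) p W"

text \<open>The common value of the sampling parameter of all modes: \<open>n ! j * Ndim n j\<close>
  is the same for every \<open>j\<close>.\<close>

definition "rho = mu1 * mu2 * (real r)^2 / (p * ntot)"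

lemma unfold_dim: "dim_row (unfold n j T) = n ! j" "dim_col (unfold n j T) = Ndim n j"
  by (simp_all add: unfold_def)

lemma Lg_pos: "0 < Lg" using nmax by simp

lemma onsys_UV:
  assumes "j < k"
  shows "onsys (n ! j) r (Um j)" "onsys (Ndim n j) r (Vm j)"
  using svd[OF assms] unfolding compact_svd_def unfold_dim by (auto intro: onsys_of_mat)

lemma rows_U: "j < k \<Longrightarrow> i < n ! j \<Longrightarrow> (\<Sum>d<r. (U j $$ (i, d))^2) \<le> u2 j"
  using svd[of j] row_norm_le_2inf[of "U j" "n ! j" r i] incU[of j]
  unfolding compact_svd_def unfold_dim by (auto intro: order_trans)

lemma rows_V: "j < k \<Longrightarrow> i < Ndim n j \<Longrightarrow> (\<Sum>d<r. (V j $$ (i, d))^2) \<le> v2 j"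
  using svd[of j] row_norm_le_2inf[of "V j" "Ndim n j" r i] incV[of j]
  unfolding compact_svd_def unfold_dim by (auto intro: order_trans)

text \<open>The squared row norms average exactly \<open>r / m\<close>, so their upper bound cannot
  lie below this.\<close>

lemma coherence_ge_1:
  fixes mu :: real
  assumes on: "onsys m r X" and b: "\<And>i. i < m \<Longrightarrow> (\<Sum>d<r. (X d i)^2) \<le> mu * r / real m"
  shows "0 < m" "1 \<le> mu"
proof -
  show m: "0 < m" using onsys_dim_le[OF on] r by linarith
  have "real r = (\<Sum>d<r. ip m (X d) (X d))" using on by (simp add: onsys_def)
  also have "\<dots> = (\<Sum>i<m. \<Sum>d<r. (X d i)^2)"
    unfolding ip_def by (subst sum.swap) (simp add: power2_eq_square)
  also have "\<dots> \<le> (\<Sum>i<m. mu * r / real m)" using b by (intro sum_mono) auto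
  also have "\<dots> = mu * r" using m by simp
  finally show "1 \<le> mu" using r by simp
qed

lemma mu1_ge: "1 \<le> mu1" and mu2_ge: "1 \<le> mu2"
proof -
  have j: "0 < k" using k by linarith
  show "1 \<le> mu1" by (rule coherence_ge_1(2)[OF onsys_UV(1)[OF j] rows_U[OF j]])
  show "1 \<le> mu2" by (rule coherence_ge_1(2)[OF onsys_UV(2)[OF j] rows_V[OF j]])
qed

lemma dims_pos: "j < k \<Longrightarrow> 0 < n ! j" "j < k \<Longrightarrow> 0 < Ndim n j"
  by (rule coherence_ge_1(1)[OF onsys_UV(1) rows_U]; assumption)
    (rule coherence_ge_1(1)[OF onsys_UV(2) rows_V]; assumption)

lemma ntot_eq: "j < k \<Longrightarrow> ntot = real (n ! j) * real (Ndim n j)"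
  by (subst prod_list_Ndim[of j]) auto

lemma ntot_pos: "0 < ntot"
proof -
  have j: "0 < k" using k by linarith
  show ?thesis unfolding ntot_eq[OF j] using dims_pos[OF j] by simp
qed

lemma S_pos: "j < k \<Longrightarrow> d < r \<Longrightarrow> 0 < S j $$ (d, d)"
  using svd[of j] unfolding compact_svd_def by blast

lemma S_mono: "j < k \<Longrightarrow> c \<le> d \<Longrightarrow> d < r \<Longrightarrow> S j $$ (d, d) \<le> S j $$ (c, c)"
  using svd[of j] unfolding compact_svd_def by blast

lemma svd_mode_j:
  assumes j: "j < k"
  shows "svd_mode (n ! j) (Ndim n j) r (Am j) (Um j) (Vm j) (sm j) (lam j) (sg j) (u2 j) (v2 j) p"
proof
  show "onsys (n ! j) r (Um j)" "onsys (Ndim n j) r (Vm j)" using onsys_UV[OF j] by auto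
  show "1 \<le> r" "0 < p" "p \<le> 1" using r p by auto
  show "0 < lam j" using S_pos[OF j, of "r - 1"] r by auto
  show "Am j i l = (\<Sum>d<r. S j $$ (d, d) * U j $$ (i, d) * V j $$ (l, d))" if "i < n ! j" "l < Ndim n j" for i l
    using svd_entry[OF svd[OF j], of i l] that by (simp add: unfold_fibre unfold_dim)
  show "lam j \<le> (S j $$ (d, d))^2" if "d < r" for d
    using S_pos[OF j, of "r - 1"] S_mono[OF j, of d "r - 1"] that r by (intro power_mono) auto
  show "(S j $$ (d, d))^2 \<le> sg j" if "d < r" for d
    using S_pos[OF j that] S_mono[OF j, of 0 d] that by (intro power_mono) auto
  show "(\<Sum>d<r. (U j $$ (i, d))^2) \<le> u2 j" if "i < n ! j" for i using rows_U[OF j that] .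
  show "(\<Sum>d<r. (V j $$ (i, d))^2) \<le> v2 j" if "i < Ndim n j" for i using rows_V[OF j that] .
  show "0 < u2 j" "0 < v2 j" using mu1_ge mu2_ge r dims_pos[OF j] by auto
qed

lemma rho_j:
  assumes j: "j < k" shows "svd_mode.\<rho> (u2 j) (v2 j) p = rho"
  unfolding svd_mode.\<rho>_def[OF svd_mode_j[OF j]] rho_def ntot_eq[OF j] by (simp add: power2_eq_square mult_ac)

lemma kappa_ge: "1 \<le> kappa"
proof -
  have j: "0 < k" using k by linarith
  have "S 0 $$ (r - 1, r - 1) \<le> S 0 $$ (0, 0)" using S_mono[OF j, of 0 "r - 1"] r by auto
  then have "1 \<le> S 0 $$ (0, 0) / S 0 $$ (r - 1, r - 1)" using S_pos[OF j, of "r - 1"] r by simp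
  then show ?thesis using kappa[OF j] by linarith
qed

lemma lam_pos: "j < k \<Longrightarrow> 0 < lam j"
  using S_pos[of j "r - 1"] r by auto

lemma cond_ratio:
  assumes j: "j < k" shows "sg j \<le> kappa^2 * lam j" "(sg j / lam j)^2 \<le> kappa ^ 4"
proof -
  have pos: "0 < S j $$ (r - 1, r - 1)" "0 < S j $$ (0, 0)" using S_pos[OF j] r by auto
  have "S j $$ (0, 0) \<le> kappa * S j $$ (r - 1, r - 1)"
    using kappa[OF j] pos by (simp add: divide_le_eq)
  then have "sg j \<le> (kappa * S j $$ (r - 1, r - 1))^2" using pos by (intro power_mono) auto
  then show 1: "sg j \<le> kappa^2 * lam j" by (simp only: power_mult_distrib)
  have "sg j / lam j \<le> kappa^2" using 1 lam_pos[OF j] by (simp add: divide_le_eq)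
  then have "(sg j / lam j)^2 \<le> (kappa^2)^2" by (intro power_mono) auto
  then show "(sg j / lam j)^2 \<le> kappa ^ 4" by (simp add: power_mult[symmetric])
qed

lemma rho_pos: "0 < rho"
  using mu1_ge mu2_ge r p ntot_pos by (simp add: rho_def)

lemma rho_small: "20000 * kappa ^ 4 * (rho * aL) \<le> 1"
proof -
  have "20000 * kappa ^ 4 * (rho * aL) = (20000 * kappa ^ 4 * a * mu1 * mu2 * (real r)^2 * Lg / ntot) / p"
    by (simp add: rho_def mult_ac)
  also have "\<dots> \<le> p / p" using p by (intro divide_right_mono p_ge) auto
  finally show ?thesis using p by simp
qed

lemma aL_nonneg: "0 \<le> aL" using a Lg_pos by simp

lemma raL_nonneg: "0 \<le> rho * aL" using rho_pos aL_nonneg by simp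

lemma rho_L: "rho * aL \<le> 1" "rho * (3 * aL) \<le> 1"
proof -
  have "1 \<le> kappa ^ 4" using kappa_ge by simp
  then have "20000 * 1 * (rho * aL) \<le> 20000 * kappa ^ 4 * (rho * aL)"
    by (intro mult_right_mono mult_left_mono raL_nonneg) auto
  then have "20000 * (rho * aL) \<le> 1" using rho_small by linarith
  then show "rho * aL \<le> 1" using raL_nonneg by linarith
  have "rho * (3 * aL) = 3 * (rho * aL)" by simp
  then show "rho * (3 * aL) \<le> 1" using \<open>20000 * (rho * aL) \<le> 1\<close> raL_nonneg by linarith
qed

text \<open>The origin of 20000. Factor 2 and threshold 1/40 require
  \<open>80 * kappa^2 * sqrt (3 * rho * aL) \<le> 1\<close>, and squaring gives
  \<open>6400 * 3 = 19200\<close>.\<close>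

lemma row_small:
  assumes j: "j < k" shows "2 * sg j * sqrt (rho * (3 * aL)) \<le> lam j / 40"
proof -
  have "(80 * (kappa^2 * sqrt (rho * (3 * aL))))^2 = 19200 * (kappa^2)^2 * (rho * aL)"
    using rho_pos aL_nonneg by (simp add: power_mult_distrib)
  also have "\<dots> = 19200 * kappa ^ 4 * (rho * aL)" by (simp add: power_mult[symmetric])
  also have "\<dots> \<le> 20000 * kappa ^ 4 * (rho * aL)"
    using kappa_ge by (intro mult_right_mono raL_nonneg) auto
  also have "\<dots> \<le> 1^2" using rho_small by simp
  finally have 1: "80 * (kappa^2 * sqrt (rho * (3 * aL))) \<le> 1" by (rule power2_le_imp_le) simp
  have "2 * sg j * sqrt (rho * (3 * aL)) \<le> 2 * (kappa^2 * lam j) * sqrt (rho * (3 * aL))"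
    using rho_pos aL_nonneg by (intro mult_right_mono mult_left_mono cond_ratio j) auto
  also have "\<dots> = lam j / 40 * (80 * (kappa^2 * sqrt (rho * (3 * aL))))" by simp
  also have "\<dots> \<le> lam j / 40 * 1" by (intro mult_left_mono 1) simp
  finally show ?thesis by simp
qed

section \<open>Average residual over the modes and number of modes without incoherence\<close>

abbreviation "RW j \<equiv> rand_subset (wedge_triples (n ! j) (Ndim n j)) p"
abbreviation "PW \<equiv> Pi_pmf {..<k} {} RW"

lemma finite_PW: "finite (set_pmf PW)"
  by (intro finite_set_Pi_pmf finite_set_rand_subset finite_wedge_triples) auto

lemma exp_neg_aL: "exp (- aL) = nmax powr (- a)"
  using nmax by (simp add: powr_def)

text \<open>The variance for \<open>EUj j W / lam j\<close>, the same for all modes once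
  \<open>sg j\<close> is replaced by \<open>kappa^2 * lam j\<close>.\<close>

definition "vstar = 2 * r * kappa ^ 4 * rho"

definition avgEU :: "(nat \<Rightarrow> triples) \<Rightarrow> real" where
  "avgEU Wf = (\<Sum>j<k. EUj j (Wf j) / lam j) / k"

lemma vstar_pos: "0 < vstar" using r kappa_ge rho_pos by (simp add: vstar_def)

lemma avgEU_tail: "pr PW {Wf. avgEU Wf > 2 * sqrt (vstar * aL)} \<le> 2 * nmax powr (- a)"
proof -
  let ?L = aL
  have k0: "0 < k" using k by linarith
  have int: "integrable (measure_pmf PW) f" for f :: "_ \<Rightarrow> real"
    by (intro integrable_measure_pmf_finite finite_PW)
  have mode: "expect PW (\<lambda>Wf. cosh (sqrt (?L / vstar) * (EUj j (Wf j) / lam j))) \<le> exp ?L"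
    if j: "j < k" for j
  proof -
    interpret M: svd_mode "n ! j" "Ndim n j" r "Am j" "Um j" "Vm j" "sm j" "lam j" "sg j" "u2 j" "v2 j" p
      by (rule svd_mode_j[OF j])
    have "real (2 * r) * (sg j)^2 * rho \<le> real (2 * r) * (kappa^2 * lam j)^2 * rho"
      using rho_pos cond_ratio(1)[OF j] by (intro mult_right_mono mult_left_mono power_mono) auto
    also have "\<dots> = vstar * (lam j)^2" by (simp add: vstar_def power_mult_distrib flip: power_mult)
    finally have "expect (RW j)
        (\<lambda>W. cosh (sqrt (?L / (vstar * (lam j)^2)) * EUj j W)) \<le> exp ?L"
      by (intro M.EU_cosh_moment) (simp_all only: rho_j[OF j] aL_nonneg rho_L)
    moreover have "sqrt (?L / (vstar * (lam j)^2)) * x = sqrt (?L / vstar) * (x / lam j)" for x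
    proof -
      have "sqrt (c / (vstar * l^2)) = sqrt (c / vstar) / l" if "0 < l" for c l :: real
        using that by (simp add: real_sqrt_divide real_sqrt_mult)
      from this[OF lam_pos[OF j]] show ?thesis by simp
    qed
    ultimately have "expect (RW j)
        (\<lambda>W. cosh (sqrt (?L / vstar) * (EUj j W / lam j))) \<le> exp ?L" by simp
    then show ?thesis
      using expectation_Pi_pmf_component[of "{..<k}" j "{}" RW
          "\<lambda>W. cosh (sqrt (?L / vstar) * (EUj j W / lam j))"] j by simp
  qed
  have "expect PW (\<lambda>Wf. cosh (sqrt (?L / vstar) * avgEU Wf))
      \<le> expect PW (\<lambda>Wf. (\<Sum>j<k. cosh (sqrt (?L / vstar) * (EUj j (Wf j) / lam j))) / k)"
  proof (intro integral_mono int)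
    fix Wf
    have "sqrt (?L / vstar) * avgEU Wf = (\<Sum>j<k. sqrt (?L / vstar) * (EUj j (Wf j) / lam j)) / k"
      by (simp add: avgEU_def sum_distrib_left)
    then show "cosh (sqrt (?L / vstar) * avgEU Wf) \<le> (\<Sum>j<k. cosh (sqrt (?L / vstar) * (EUj j (Wf j) / lam j))) / k"
      using cosh_avg_le[OF k0] by simp
  qed
  also have "\<dots> = (\<Sum>j<k. expect PW (\<lambda>Wf. cosh (sqrt (?L / vstar) * (EUj j (Wf j) / lam j)))) / k"
    using int by (simp add: Bochner_Integration.integral_sum)
  also have "\<dots> \<le> (\<Sum>j<k. exp ?L) / k"
    using mode by (intro divide_right_mono sum_mono) auto
  also have "\<dots> = exp ?L" using k0 by simp
  finally have "pr PW {Wf. avgEU Wf > 2 * sqrt (vstar * ?L)} \<le> 2 * exp (- ?L)"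
    by (intro prob_gt_le_of_cosh_moment finite_PW vstar_pos aL_nonneg)
  then show ?thesis by (simp only: exp_neg_aL)
qed

definition badj :: "nat \<Rightarrow> triples \<Rightarrow> bool" where
  "badj j W \<longleftrightarrow> (\<exists>a<n ! j. \<not> goodj j a W)"

definition nbad :: "(nat \<Rightarrow> triples) \<Rightarrow> real" where
  "nbad Wf = (\<Sum>j<k. if badj j (Wf j) then 1 else 0)"

text \<open>A union bound over the modes would cost a factor \<open>k\<close>; a few bad modes are harmless, so
  Markov's inequality for their number suffices.\<close>
lemma nbad_tail: "pr PW {Wf. nbad Wf > k / (4 * Lg)} \<le> 8 * nmax powr (- a)"
proof -
  \<comment> \<open>The union over rows costs a factor \<open>nmax\<close>, and Markov at level
    \<open>k / (4 * Lg)\<close> costs a multiple of \<open>Lg\<close>, itself at most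
    \<open>nmax\<close>. The surplus \<open>2 * aL\<close> in the exponent pays for both.\<close>
  let ?L = "3 * aL"
  have k0: "0 < real k" using k by linarith
  have int: "integrable (measure_pmf PW) f" for f :: "_ \<Rightarrow> real"
    by (intro integrable_measure_pmf_finite finite_PW)
  have mode: "expect PW (\<lambda>Wf. if badj j (Wf j) then 1 else 0) \<le> nmax * (2 * exp (- ?L))"
    if j: "j < k" for j
  proof -
    interpret M: svd_mode "n ! j" "Ndim n j" r "Am j" "Um j" "Vm j" "sm j" "lam j" "sg j" "u2 j" "v2 j" p
      by (rule svd_mode_j[OF j])
    have "expect PW (\<lambda>Wf. if badj j (Wf j) then 1 else 0 :: real)
        = expect (RW j) (\<lambda>W. if badj j W then 1 else 0)"
      using j expectation_Pi_pmf_component[of "{..<k}" j "{}" RW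
          "\<lambda>W. if badj j W then 1 else 0"] by simp
    also have "\<dots> = expect (RW j) (indicator {W. badj j W})"
      by (intro Bochner_Integration.integral_cong refl) (auto simp: indicator_def)
    also have "\<dots> = pr (RW j) {W. badj j W}" by simp
    also have "\<dots> \<le> real (n ! j) * (2 * exp (- ?L))"
      unfolding badj_def
    proof (rule M.some_row_bad_prob)
      show "0 \<le> ?L" using aL_nonneg by simp
      show "M.\<rho> * ?L \<le> 1" unfolding rho_j[OF j] by (rule rho_L)
      show "2 * sg j * sqrt (M.\<rho> * ?L) \<le> lam j / 40" unfolding rho_j[OF j] by (rule row_small[OF j])
    qed
    also have "\<dots> \<le> nmax * (2 * exp (- ?L))" by (intro mult_right_mono nmax j) auto
    finally show ?thesis .
  qed
  have E: "expect PW nbad \<le> k * (nmax * (2 * exp (- ?L)))"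
  proof -
    have "expect PW nbad = (\<Sum>j<k. expect PW (\<lambda>Wf. if badj j (Wf j) then 1 else 0))"
      unfolding nbad_def[abs_def] using int by (intro Bochner_Integration.integral_sum)
    also have "\<dots> \<le> (\<Sum>j<k. nmax * (2 * exp (- ?L)))" using mode by (intro sum_mono) auto
    finally show ?thesis by simp
  qed
  let ?A = "{Wf. nbad Wf > k / (4 * Lg)}"
  have "pr PW ?A = expect PW (indicator ?A)" by simp
  also have "\<dots> \<le> expect PW (\<lambda>Wf. (4 * Lg / k) * nbad Wf)"
  proof (intro integral_mono int)
    fix Wf
    have "0 \<le> nbad Wf" by (simp add: nbad_def sum_nonneg)
    then show "indicator ?A Wf \<le> (4 * Lg / k) * nbad Wf"
      using k0 Lg_pos by (cases "Wf \<in> ?A") (auto simp: field_simps)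
  qed
  also have "\<dots> = (4 * Lg / k) * expect PW nbad" by simp
  also have "\<dots> \<le> (4 * Lg / k) * (k * (nmax * (2 * exp (- ?L))))"
    using Lg_pos k0 by (intro mult_left_mono E) auto
  also have "\<dots> = 8 * (Lg * nmax * exp (- ?L))" using k0 by simp
  also have "\<dots> \<le> 8 * (exp Lg * exp Lg * exp (- ?L))"
  proof -
    have "Lg \<le> exp Lg" using exp_ge_add_one_self[of Lg] by linarith
    moreover have "nmax = exp Lg" using nmax by simp
    ultimately show ?thesis using nmax by (intro mult_left_mono mult_right_mono) auto
  qed
  also have "\<dots> = 8 * exp (2 * Lg - ?L)" by (simp add: exp_add[symmetric] exp_diff[symmetric] algebra_simps)
  also have "\<dots> \<le> 8 * exp (- aL)"
  proof -
    have "2 * Lg \<le> a * Lg" using a Lg_pos by (intro mult_right_mono) auto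
    then show ?thesis using aL_nonneg by simp
  qed
  finally show ?thesis by (simp only: exp_neg_aL)
qed

end

section \<open>From the spectral-norm condition to eigenbases and mode residuals\<close>

context tensor_setup
begin

abbreviation "GE j W \<equiv> (\<lambda>i l. Gj j i l + Ej j W i l)"

abbreviation "E_small j W x \<equiv> nrm (n ! j) (mv (n ! j) (Ej j W) x) \<le> lam j / 4 * nrm (n ! j) x"

abbreviation "pnt w s t \<equiv> pn (n ! t) r (w t) (ev (s ! t))"

abbreviation "error_level \<equiv>
  4 * (k * sqrt r * kappa^2 * sqrt (a * mu1 * mu2 * (real r)^2 * Lg / (p * ntot))
    + 2 ^ k * r powr (1.5 + k / 2) * kappa ^ (2 * k)
      * sqrt (a * (real k - 1) * mu1 ^ (k + 1) * mu2 * Lg / (q * ntot))) * fro_norm n T"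

lemma wE_unfold:
  assumes "i < n ! j" "l < n ! j"
  shows "wE p (Ndim n j) (\<lambda>i l. unfold n j T $$ (i, l)) W i l = Ej j W i l"
  unfolding wE_def using assms by (intro sum.cong refl) (simp add: unfold_fibre)

lemma gram_unfold:
  assumes j: "j < k" and il: "i < n ! j" "l < n ! j"
  shows "(\<Sum>c<Ndim n j. unfold n j T $$ (i, c) * unfold n j T $$ (l, c)) = Gj j i l"
  unfolding svd_mode.gram_rows[OF svd_mode_j[OF j] il, symmetric]
  using il by (intro sum.cong refl) (simp add: unfold_fibre)

lemma Zj_entry:
  assumes j: "j < k" and il: "i < n ! j" "l < n ! j"
  shows "Zj j W $$ (i, l) = Gj j i l + Ej j W i l"
  using wedge_matrix_entry[of i "unfold n j T" l p W] gram_unfold[OF j il] wE_unfold[OF il] il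
  by (simp add: unfold_dim)

lemma E_bound:
  assumes j: "j < k"
    and sp: "4 * spec_norm (Zj j W - unfold n j T * transpose_mat (unfold n j T)) \<le> lam j"
  shows "E_small j W x"
proof -
  let ?A = "unfold n j T"
  let ?M = "Zj j W - ?A * transpose_mat ?A"
  have A: "?A \<in> carrier_mat (n ! j) (Ndim n j)" by (simp add: unfold_def)
  have Z: "Zj j W \<in> carrier_mat (n ! j) (n ! j)" using wedge_matrix_carrier[of ?A p W] by (simp add: unfold_dim)
  have M: "?M \<in> carrier_mat (n ! j) (n ! j)" using A Z by (intro minus_carrier_mat) simp
  have "?M $$ (i, l) = Ej j W i l" if il: "i < n ! j" "l < n ! j" for i l
  proof -
    have "(?A * transpose_mat ?A) $$ (i, l) = (\<Sum>c<Ndim n j. ?A $$ (i, c) * ?A $$ (l, c))"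
      using A il by (simp add: scalar_prod_def lessThan_atLeast0)
    then show ?thesis using Zj_entry[OF j il] gram_unfold[OF j il] A Z il by simp
  qed
  then have "nrm (n ! j) (mv (n ! j) (Ej j W) x) = nrm (n ! j) (mv (n ! j) (\<lambda>i l. ?M $$ (i, l)) x)"
    by (intro L2_set_cong refl mv_cong) auto
  also have "\<dots> \<le> spec_norm ?M * nrm (n ! j) x" by (rule nrm_mv_le_spec_norm[OF M])
  also have "\<dots> \<le> lam j / 4 * nrm (n ! j) x" using sp by (intro mult_right_mono) auto
  finally show ?thesis .
qed

lemma top_eigvecs_mode:
  assumes j: "j < k" and te: "top_eigvecs (Zj j W) r Uh"
  shows "\<exists>w \<mu>. eigsys (n ! j) (GE j W) w \<mu> \<and> proj_on (n ! j) r w (Uh * transpose_mat Uh)"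
proof -
  have Z: "Zj j W \<in> carrier_mat (n ! j) (n ! j)"
    using wedge_matrix_carrier[of "unfold n j T" p W] by (simp add: unfold_dim)
  obtain w \<mu> where w: "eigsys (n ! j) (\<lambda>i l. Zj j W $$ (i, l)) w \<mu>" "proj_on (n ! j) r w (Uh * transpose_mat Uh)"
    using top_eigvecs_eigsys[OF te Z] by blast
  have "eigsys (n ! j) (GE j W) w \<mu>"
    using Zj_entry[OF j] by (intro eigsys_cong[OF _ w(1)])
  then show ?thesis using w(2) by blast
qed

lemma T_norm: "j < k \<Longrightarrow> (fro_norm n T)^2 = (\<Sum>i<n ! j. \<Sum>l<Ndim n j. (Am j i l)^2)"
  unfolding fro_norm_fibre[of j] L2_set_squared by (rule sum.swap)

lemma sg_le_T: "j < k \<Longrightarrow> sg j \<le> (fro_norm n T)^2"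
  unfolding T_norm svd_mode.fro_eq[OF svd_mode_j] using r by (intro member_le_sum[of 0]) auto

lemma T_pos: "0 < fro_norm n T"
proof -
  have j: "0 < k" using k by linarith
  have "0 < sg 0" using S_pos[OF j, of 0] r by auto
  then have "0 < (fro_norm n T)^2" using sg_le_T[OF j] by linarith
  then show ?thesis using fro_norm_nonneg[of n T] by (simp add: less_le)
qed

lemma mode_residual_le:
  assumes j: "j < k" and Eb: "\<And>x. E_small j W x"
    and w: "eigsys (n ! j) (GE j W) w \<mu>" and Q: "proj_on (n ! j) r w Q"
  shows "fro_norm n (\<lambda>i. T i - mode_prod n T j Q i) \<le> 4 / 3 * (EUj j W / lam j) * fro_norm n T"
proof (rule power2_le_imp_le)
  interpret M: svd_mode "n ! j" "Ndim n j" r "Am j" "Um j" "Vm j" "sm j" "lam j" "sg j" "u2 j" "v2 j" p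
    by (rule svd_mode_j[OF j])
  have "(fro_norm n (\<lambda>i. T i - mode_prod n T j Q i))^2 \<le> (4 / (3 * lam j) * EUj j W)^2 * (fro_norm n T)^2"
    unfolding mode_prod_residual[OF j Q] T_norm[OF j] by (rule M.residual_bound[OF Eb w])
  also have "\<dots> = (4 / 3 * (EUj j W / lam j) * fro_norm n T)^2" by (simp add: power_mult_distrib power_divide)
  finally show "(fro_norm n (\<lambda>i. T i - mode_prod n T j Q i))^2 \<le> (4 / 3 * (EUj j W / lam j) * fro_norm n T)^2" .
  show "0 \<le> 4 / 3 * (EUj j W / lam j) * fro_norm n T" by (simp add: M.EU_def)
qed

section \<open>Entry bounds, incoherence of the product projection, and the sampling error\<close>

definition "tmax2 = mu1 * mu2 * (real r)^2 / ntot * (fro_norm n T)^2"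

text \<open>Every entry of \<open>T\<close> is an entry of its first unfolding, where Cauchy-Schwarz
  between the rows of the two singular factors applies.\<close>

lemma T_entry: 
  assumes s: "s \<in> idx n" shows "(T s)^2 \<le> tmax2"
proof -
  have j: "0 < k" using k by linarith
  interpret M: svd_mode "n ! 0" "Ndim n 0" r "Am 0" "Um 0" "Vm 0" "sm 0" "lam 0" "sg 0" "u2 0" "v2 0" p
    by (rule svd_mode_j[OF j])
  have "remove_at 0 s \<in> idx (remove_at 0 n)" by (rule remove_at_in_idx[OF j s])
  then obtain c where c: "c < Ndim n 0" "remove_at 0 s = dec (remove_at 0 n) c"
    using bij_betw_dec[of "remove_at 0 n"] by (auto simp: bij_betw_def Ndim_def)
  have l: "0 < length s" "s ! 0 < n ! 0" using s j by (auto simp: idx_def)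
  have "Am 0 (s ! 0) c = T s"
    unfolding fibre_def c(2)[symmetric] by (simp only: insert_at_remove_at[OF l(1)])
  then have "(T s)^2 \<le> sg 0 * (u2 0 * v2 0)" using M.entry_sq[OF l(2) c(1)] by simp
  also have "\<dots> \<le> (fro_norm n T)^2 * (u2 0 * v2 0)"
    using sg_le_T[OF j] M.u2_pos M.v2_pos by (intro mult_right_mono mult_nonneg_nonneg) auto
  also have "\<dots> = tmax2" unfolding tmax2_def ntot_eq[OF j] by (simp add: power2_eq_square mult_ac)
  finally show ?thesis .
qed

text \<open>The product over the modes of the ideal squared row bounds
  \<open>kappa ^ 4 * mu1 * r / n ! t\<close>, enlarged by 4 per mode.\<close>

definition "Gc = 4 ^ k * kappa ^ (4 * k) * mu1 ^ k * real r ^ k / ntot"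

lemma Gc_pos: "0 < Gc"
  using kappa_ge mu1_ge r ntot_pos by (simp add: Gc_def)

text \<open>A good mode contributes \<open>3 * B / n ! t\<close>. A bad one contributes at most 1,
  hence at most \<open>nmax\<close> times as much since \<open>n ! t \<le> nmax\<close> and
  \<open>1 \<le> B\<close>. The excess factors multiply to
  \<open>exp (nbad Wf * Lg)\<close>.\<close>

lemma prod_incoherence:
  assumes Eb: "\<And>j x. j < k \<Longrightarrow> E_small j (Wf j) x"
    and w: "\<And>j. j < k \<Longrightarrow> eigsys (n ! j) (GE j (Wf j)) (w j) (\<mu> j)"
    and few: "nbad Wf \<le> k / (4 * Lg)" and s: "s \<in> idx n"
  shows "(\<Prod>t<k. (pnt w s t)^2) \<le> Gc"
proof -
  define \<beta> where "\<beta> t = (if badj t (Wf t) then 1 else 0 :: real)" for t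
  define B where "B = kappa ^ 4 * (mu1 * real r)"
  have B1: "1 \<le> B"
  proof -
    have "1 * 1 \<le> mu1 * real r" using mu1_ge r by (intro mult_mono) auto
    then have "1 * 1 \<le> kappa ^ 4 * (mu1 * real r)" using kappa_ge by (intro mult_mono) auto
    then show ?thesis by (simp add: B_def)
  qed
  have one: "(pnt w s t)^2 \<le> B / real (n ! t) * (3 * exp (\<beta> t * Lg))"
    if t: "t < k" for t
  proof -
    interpret M: svd_mode "n ! t" "Ndim n t" r "Am t" "Um t" "Vm t" "sm t" "lam t" "sg t" "u2 t" "v2 t" p
      by (rule svd_mode_j[OF t])
    have st: "s ! t < n ! t" using s t by (auto simp: idx_def)
    have nt: "0 < real (n ! t)" using dims_pos[OF t] by simp
    show ?thesis
    proof (cases "badj t (Wf t)")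
      case False
      have "(pnt w s t)^2 \<le> (17 / 10)^2 * (sg t / lam t)^2 * u2 t"
        using False by (intro M.good_incoherence[OF Eb[OF t] w[OF t] _ st]) (auto simp: badj_def)
      also have "\<dots> \<le> 3 * kappa ^ 4 * u2 t"
        using cond_ratio(2)[OF t] M.u2_pos by (intro mult_right_mono mult_mono) (auto simp: power2_eq_square)
      also have "\<dots> = B / real (n ! t) * 3" by (simp add: B_def)
      finally show ?thesis using False by (simp add: \<beta>_def)
    next
      case True
      have on: "onsys (n ! t) (n ! t) (w t)" using w[OF t] by (simp add: eigsys_def)
      have "pnt w s t \<le> 1"
        using pn_le_nrm[OF on onsys_dim_le[OF M.U], of "ev (s ! t)"] by (simp add: nrm_ev[OF st])
      then have "(pnt w s t)^2 \<le> 1" by (simp add: power_le_one)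
      also have "1 \<le> B / real (n ! t) * (3 * nmax)"
      proof -
        have "real (n ! t) * 1 \<le> (3 * nmax) * B" using nmax(2)[OF t] nmax(1) B1 by (intro mult_mono) auto
        then show ?thesis using nt by (simp add: field_simps)
      qed
      also have "\<dots> = B / real (n ! t) * (3 * exp (\<beta> t * Lg))" using True nmax(1) by (simp add: \<beta>_def)
      finally show ?thesis .
    qed
  qed
  have "(\<Prod>t<k. (pnt w s t)^2) \<le> (\<Prod>t<k. B / real (n ! t) * (3 * exp (\<beta> t * Lg)))"
    using one by (intro prod_mono) auto
  also have "\<dots> = B ^ k / ntot * (3 ^ k * exp (nbad Wf * Lg))"
  proof -
    have "(\<Prod>t<k. exp (\<beta> t * Lg)) = exp (nbad Wf * Lg)"
      unfolding nbad_def sum_distrib_right \<beta>_def[symmetric] by (simp add: exp_sum)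
    then show ?thesis
      by (simp only: prod.distrib prod_dividef prod_constant card_lessThan prod_list_prod)
  qed
  also have "\<dots> \<le> B ^ k / ntot * (3 ^ k * (4 / 3) ^ k)"
  proof -
    have "nbad Wf * Lg \<le> k / (4 * Lg) * Lg" using few Lg_pos by (intro mult_right_mono) auto
    then have "exp (nbad Wf * Lg) \<le> exp (k * (1 / 4))" using Lg_pos by simp
    also have "\<dots> = exp (1 / 4) ^ k" by (rule exp_of_nat_mult)
    also have "\<dots> \<le> (4 / 3) ^ k"
    proof (intro power_mono)
      \<comment> \<open>The budget \<open>k / (4 * Lg)\<close> for bad modes is chosen so that the
        excess per mode is \<open>exp (1 / 4)\<close>; below 4/3 it completes the factor 3 to
        4.\<close>
      have "3 / 4 \<le> exp (- (1 / 4) :: real)" using exp_ge_add_one_self[of "- (1 / 4)"] by simp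
      then show "exp (1 / 4) \<le> (4 / 3 :: real)" by (simp add: exp_minus field_simps)
    qed simp
    finally show ?thesis using B1 ntot_pos by (intro mult_left_mono) auto
  qed
  also have "3 ^ k * (4 / 3) ^ k = (4 :: real) ^ k" by (subst power_mult_distrib[symmetric]) simp
  also have "B ^ k / ntot * 4 ^ k = Gc" by (simp add: Gc_def B_def power_mult_distrib power_mult[symmetric])
  finally show ?thesis .
qed

text \<open>The true variance is at most \<open>Gc * (fro_norm n T)^2 / q\<close>. The factor
  \<open>mu1 * mu2 * (real r)^2\<close>, at least 1, is inserted so that \<open>v3\<close> also
  dominates the squared size of a single term times \<open>aL\<close>.\<close>

definition "v3 = Gc * (mu1 * mu2 * (real r)^2) * (fro_norm n T)^2 / q"

abbreviation "tau3 \<equiv> 2 * sqrt (v3 * aL)"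

lemma omega_tail:
  assumes Q: "\<And>j. j < k \<Longrightarrow> proj_on (n ! j) r (w j) (Q j)"
    and inc: "\<And>s. s \<in> idx n \<Longrightarrow> (\<Prod>t<k. (pnt w s t)^2) \<le> Gc"
  shows "pr (rand_subset (idx n) q)
      {Om. L2_set (noise q (idx n) (zT n Q T) Om) (idx n) > tau3} \<le> 2 * nmax powr (- a)"
proof -
  have mm: "1 \<le> mu1 * mu2 * (real r)^2"
  proof -
    have "1 * 1 \<le> mu1 * mu2" using mu1_ge mu2_ge by (intro mult_mono) auto
    then have "1 * 1 \<le> mu1 * mu2 * (real r)^2" using r by (intro mult_mono) auto
    then show ?thesis by simp
  qed
  have zn: "(L2_set (zT n Q T s) (idx n))^2 \<le> (T s)^2 * Gc" if s: "s \<in> idx n" for s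
  proof -
    have "(L2_set (zT n Q T s) (idx n))^2 = (T s)^2 * (\<Prod>t<k. (pnt w s t)^2)"
      using mmp_unit_norm[OF s Q] unfolding zT_def[abs_def] L2_set_scale power_mult_distrib by simp
    also have "\<dots> \<le> (T s)^2 * Gc" by (intro mult_left_mono inc s) simp
    finally show ?thesis .
  qed
  have tm0: "0 \<le> tmax2" using mu1_ge mu2_ge ntot_pos by (simp add: tmax2_def)
  have "pr (rand_subset (idx n) q)
      {Om. L2_set (noise q (idx n) (zT n Q T) Om) (idx n) > tau3} \<le> 2 * exp (- aL)"
  proof (rule noise_tail[OF finite_idx q])
    show "0 < v3" using Gc_pos mm T_pos q by (simp add: v3_def)
    show "0 \<le> aL" by (rule aL_nonneg)
    show "L2_set (zT n Q T s) (idx n) / q \<le> sqrt (tmax2 * Gc) / q" if s: "s \<in> idx n" for s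
    proof -
      have "(L2_set (zT n Q T s) (idx n))^2 \<le> tmax2 * Gc"
        using zn[OF s] mult_right_mono[OF T_entry[OF s], of Gc] Gc_pos by linarith
      then have "L2_set (zT n Q T s) (idx n) \<le> sqrt (tmax2 * Gc)" by (rule real_le_rsqrt)
      then show ?thesis using q by (intro divide_right_mono) auto
    qed
    have "(sqrt (tmax2 * Gc) / q)^2 * aL = tmax2 * Gc / q^2 * aL"
      using tm0 Gc_pos by (simp add: power_divide)
    also have "\<dots> = v3 * (a * Lg / (q * ntot))"
      by (simp add: v3_def tmax2_def power2_eq_square mult_ac)
    also have "\<dots> \<le> v3 * 1"
    proof (intro mult_left_mono)
      have "a * Lg * 1 \<le> a * Lg * (real k - 1)" using k aL_nonneg by (intro mult_left_mono) auto
      also have "\<dots> \<le> q * ntot" using q_ge ntot_pos by (simp add: divide_le_eq mult_ac)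
      finally show "a * Lg / (q * ntot) \<le> 1" using q ntot_pos by (simp add: divide_le_eq)
      show "0 \<le> v3" using Gc_pos mm T_pos q by (simp add: v3_def)
    qed
    finally show "(sqrt (tmax2 * Gc) / q)^2 * aL \<le> v3" by simp
    have "(\<Sum>s\<in>idx n. (L2_set (zT n Q T s) (idx n))^2) \<le> (\<Sum>s\<in>idx n. (T s)^2 * Gc)"
      using zn by (intro sum_mono) auto
    also have "\<dots> = Gc * 1 * (fro_norm n T)^2"
      unfolding fro_norm_L2 L2_set_squared by (simp add: sum_distrib_left mult.commute)
    also have "\<dots> \<le> Gc * (mu1 * mu2 * (real r)^2) * (fro_norm n T)^2"
      using mm Gc_pos by (intro mult_right_mono mult_left_mono) auto
    finally show "(\<Sum>s\<in>idx n. (L2_set (zT n Q T s) (idx n))^2) / q \<le> v3"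
      unfolding v3_def using q by (intro divide_right_mono) auto
  qed
  then show ?thesis by (simp only: exp_neg_aL)
qed

text \<open>The uniqueness of the projections is known only entrywise within the dimensions; the
  noise sees no other values.\<close>

lemma zT_cong:
  assumes "\<And>j x y. j < k \<Longrightarrow> x < n ! j \<Longrightarrow> y < n ! j \<Longrightarrow> Q j $$ (x, y) = Q' j $$ (x, y)"
    and "i \<in> idx n"
  shows "noise q (idx n) (zT n Q T) Om i = noise q (idx n) (zT n Q' T) Om i"
  unfolding noise_def
proof (intro sum.cong refl)
  fix s assume s: "s \<in> idx n"
  have "(\<Prod>t<k. Q t $$ (i ! t, s ! t)) = (\<Prod>t<k. Q' t $$ (i ! t, s ! t))"
    using assms s by (intro prod.cong refl) (auto simp: idx_def)
  then have "zT n Q T s i = zT n Q' T s i"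
    unfolding zT_def mmp_unit[OF s order_refl assms(2)] by simp
  then show "((if s \<in> Om then 1 / q else 0) - 1) * zT n Q T s i = ((if s \<in> Om then 1 / q else 0) - 1) * zT n Q' T s i"
    by simp
qed

section \<open>Uniqueness of the projections over all choices of eigenvectors\<close>

definition admissible :: "(nat \<Rightarrow> triples) \<Rightarrow> (nat \<Rightarrow> real mat) \<Rightarrow> bool" where
  "admissible Wf Uh \<longleftrightarrow> (\<forall>j<k. lam j \<ge> 4 * spec_norm (Zj j (Wf j) - unfold n j T * transpose_mat (unfold n j T))) \<and>
     (\<forall>j<k. top_eigvecs (Zj j (Wf j)) r (Uh j))"

abbreviation "Qh Uh \<equiv> (\<lambda>j. Uh j * transpose_mat (Uh j))"

lemma admissible_eigsys:
  assumes "admissible Wf Uh"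
  shows "\<exists>w \<mu>. \<forall>j<k. eigsys (n ! j) (GE j (Wf j)) (w j) (\<mu> j)
      \<and> proj_on (n ! j) r (w j) (Qh Uh j)"
proof -
  have "\<forall>j\<in>{..<k}. \<exists>z. eigsys (n ! j) (GE j (Wf j)) (fst z) (snd z)
      \<and> proj_on (n ! j) r (fst z) (Qh Uh j)"
  proof
    fix j assume "j \<in> {..<k}"
    then have "\<exists>w \<mu>. eigsys (n ! j) (GE j (Wf j)) w \<mu> \<and> proj_on (n ! j) r w (Qh Uh j)"
      using assms by (intro top_eigvecs_mode) (auto simp: admissible_def)
    then obtain w \<mu> where "eigsys (n ! j) (GE j (Wf j)) w \<mu> \<and> proj_on (n ! j) r w (Qh Uh j)"
      by blast
    then show "\<exists>z. eigsys (n ! j) (GE j (Wf j)) (fst z) (snd z)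
      \<and> proj_on (n ! j) r (fst z) (Qh Uh j)" by (intro exI[of _ "(w, \<mu>)"]) simp
  qed
  from bchoice[OF this] obtain z where z: "\<forall>j\<in>{..<k}. eigsys (n ! j) (GE j (Wf j)) (fst (z j)) (snd (z j))
      \<and> proj_on (n ! j) r (fst (z j)) (Qh Uh j)" by blast
  then show ?thesis by (intro exI[of _ "\<lambda>j. fst (z j)"] exI[of _ "\<lambda>j. snd (z j)"]) auto
qed

lemma admissible_E_bound:
  assumes "admissible Wf Uh" "j < k"
  shows "E_small j (Wf j) x"
  using assms by (intro E_bound) (auto simp: admissible_def)

lemma admissible_unique:
  assumes U1: "admissible Wf Uh" and U2: "admissible Wf Uh'" and j: "j < k" and xy: "x < n ! j" "y < n ! j"
  shows "Qh Uh j $$ (x, y) = Qh Uh' j $$ (x, y)"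
proof -
  have sp: "spike (n ! j) r (\<lambda>d. (sm j d)^2) (Um j) (Ej j (Wf j)) (lam j)"
    by (rule svd_mode.spike_E[OF svd_mode_j[OF j] admissible_E_bound[OF U1 j]])
  obtain w \<mu> where ex: "\<forall>j<k. eigsys (n ! j) (GE j (Wf j)) (w j) (\<mu> j)
      \<and> proj_on (n ! j) r (w j) (Qh Uh j)"
    using admissible_eigsys[OF U1] by blast
  then have w: "eigsys (n ! j) (GE j (Wf j)) (w j) (\<mu> j)" "proj_on (n ! j) r (w j) (Qh Uh j)"
    using j by auto
  obtain w' \<mu>' where ex: "\<forall>j<k. eigsys (n ! j) (GE j (Wf j)) (w' j) (\<mu>' j)
      \<and> proj_on (n ! j) r (w' j) (Qh Uh' j)"
    using admissible_eigsys[OF U2] by blast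
  then have w': "eigsys (n ! j) (GE j (Wf j)) (w' j) (\<mu>' j)" "proj_on (n ! j) r (w' j) (Qh Uh' j)"
    using j by auto
  have "(\<Sum>c<r. w j c x * w j c y) = (\<Sum>c<r. w' j c x * w' j c y)"
    by (rule spike.top_projection_unique[OF sp w(1) w'(1) xy])
  then show ?thesis using w(2) w'(2) xy unfolding proj_on_def by metis
qed

abbreviation "omega_noise Uh Om \<equiv> L2_set (noise q (idx n) (zT n (Qh Uh) T) Om) (idx n)"

text \<open>The matrices \<open>Uh\<close> may be picked after seeing \<open>Om\<close>, so a tail
  bound for fixed \<open>Uh\<close> is not enough by itself. All admissible choices yield the same
  noise, which reduces the event to one fixed choice; if there is none, the event is empty.\<close>

lemma omega_tail_admissible:
  assumes few: "nbad Wf \<le> k / (4 * Lg)"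
  shows "pr (rand_subset (idx n) q)
      {Om. \<exists>Uh. admissible Wf Uh \<and> omega_noise Uh Om > tau3} \<le> 2 * nmax powr (- a)"
proof (cases "\<exists>Uh. admissible Wf Uh")
  case True
  then obtain Uh where Uh: "admissible Wf Uh" by blast
  obtain w \<mu> where ex: "\<forall>j<k. eigsys (n ! j) (GE j (Wf j)) (w j) (\<mu> j)
      \<and> proj_on (n ! j) r (w j) (Qh Uh j)"
    using admissible_eigsys[OF Uh] by blast
  then have w: "\<And>j. j < k \<Longrightarrow> eigsys (n ! j) (GE j (Wf j)) (w j) (\<mu> j)"
    and Q: "\<And>j. j < k \<Longrightarrow> proj_on (n ! j) r (w j) (Qh Uh j)"
    by auto
  have eq: "omega_noise Uh' Om = omega_noise Uh Om" if "admissible Wf Uh'" for Uh' Om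
    using admissible_unique[OF that Uh] by (intro L2_set_cong refl zT_cong) auto
  then have "{Om. \<exists>Uh. admissible Wf Uh \<and> omega_noise Uh Om > tau3}
      \<subseteq> {Om. omega_noise Uh Om > tau3}" by auto
  then have "pr (rand_subset (idx n) q) {Om. \<exists>Uh. admissible Wf Uh \<and> omega_noise Uh Om > tau3}
      \<le> pr (rand_subset (idx n) q) {Om. omega_noise Uh Om > tau3}"
    by (rule measure_pmf.finite_measure_mono) simp
  also have "\<dots> \<le> 2 * nmax powr (- a)"
    using prod_incoherence[OF admissible_E_bound[OF Uh] w few] by (intro omega_tail[OF Q]) auto
  finally show ?thesis .
qed (use nmax in auto)

text \<open>\<open>vstar\<close> contributes \<open>sqrt 2\<close>, rounded up to 3/2, and
  \<open>4 / 3 * 2 * (3 / 2) = 4\<close>.\<close>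

lemma first_term_eq: "4 / 3 * (k * (2 * sqrt (vstar * aL)))
    \<le> 4 * (k * sqrt r * kappa^2 * sqrt (a * mu1 * mu2 * (real r)^2 * Lg / (p * ntot)))"
proof -
  let ?y = "a * mu1 * mu2 * (real r)^2 * Lg / (p * ntot)"
  have "vstar * aL = 2 * (r * (kappa^2)^2 * ?y)"
    by (simp add: vstar_def rho_def power_mult[symmetric] mult_ac)
  then have "sqrt (vstar * aL) = sqrt 2 * (sqrt r * kappa^2 * sqrt ?y)"
    by (simp only: real_sqrt_mult real_sqrt_abs) simp
  moreover have "sqrt 2 \<le> 3 / 2" by (rule real_le_lsqrt) (auto simp: power2_eq_square)
  then have "sqrt 2 * x \<le> 3 / 2 * x" if "0 \<le> x" for x using that by (rule mult_right_mono)
  moreover have "0 \<le> sqrt r * kappa^2 * sqrt ?y"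
    using a mu1_ge mu2_ge Lg_pos p ntot_pos by (intro mult_nonneg_nonneg real_sqrt_ge_zero divide_nonneg_nonneg) auto
  ultimately have "sqrt (vstar * aL) \<le> 3 / 2 * (sqrt r * kappa^2 * sqrt ?y)"
    by metis
  then have "real k * sqrt (vstar * aL) \<le> real k * (3 / 2 * (sqrt r * kappa^2 * sqrt ?y))"
    by (rule mult_left_mono) simp
  then show ?thesis by simp
qed

text \<open>\<open>Gc\<close> supplies \<open>r ^ k\<close> and the entry bound
  \<open>r ^ 2\<close>. The stated rate squares to \<open>r ^ (k + 3)\<close>, one power more, and
  to an extra factor \<open>k - 1\<close>, which is at least 1.\<close>

lemma second_term_eq: "tau3
    \<le> 4 * (2 ^ k * r powr (1.5 + k / 2) * kappa ^ (2 * k)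
        * sqrt (a * (real k - 1) * mu1 ^ (k + 1) * mu2 * Lg / (q * ntot))) * fro_norm n T"
proof -
  define R where "R = r powr (1.5 + k / 2)"
  define y where "y = a * mu1 ^ (k + 1) * mu2 * Lg / (q * ntot)"
  have y0: "0 \<le> y" using a mu1_ge mu2_ge Lg_pos q ntot_pos by (simp add: y_def)
  have R2: "R^2 = real r ^ (k + 3)"
  proof -
    have "R^2 = r powr (real (k + 3))"
      unfolding R_def power2_eq_square powr_add[symmetric] by (rule arg_cong[of _ _ "\<lambda>x. r powr x"]) simp
    then show ?thesis using r by (simp only: powr_realpow)
  qed
  have "v3 * aL = 4 ^ k * kappa ^ (4 * k) * real r ^ (k + 2) * y * (fro_norm n T)^2"
    by (simp add: v3_def Gc_def y_def power_add power2_eq_square mult_ac)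
  also have "\<dots> \<le> 4 ^ k * kappa ^ (4 * k) * real r ^ (k + 3) * (y * (real k - 1)) * (fro_norm n T)^2"
  proof (intro mult_right_mono mult_mono mult_left_mono)
    show "real r ^ (k + 2) \<le> real r ^ (k + 3)" using r by (intro power_increasing) auto
    show "y \<le> y * (real k - 1)" using mult_left_mono[of 1 "real k - 1" y] k y0 by simp
  qed (use y0 kappa_ge k in auto)
  also have "\<dots> = (2 ^ k * R * kappa ^ (2 * k) * sqrt (y * (real k - 1)) * fro_norm n T)^2"
  proof -
    have "(2 ^ k)^2 = (4 ^ k :: real)" by (simp add: power_mult[symmetric] mult.commute[of k 2] power_mult[of 2 2 k])
    moreover have "(kappa ^ (2 * k))^2 = kappa ^ (4 * k)" by (simp add: power_mult[symmetric])
    moreover have "(sqrt (y * (real k - 1)))^2 = y * (real k - 1)" using y0 k by simp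
    ultimately show ?thesis by (simp only: power_mult_distrib R2) (simp add: mult_ac)
  qed
  finally have le: "sqrt (v3 * aL) \<le> 2 ^ k * R * kappa ^ (2 * k) * sqrt (y * (real k - 1)) * fro_norm n T"
    using y0 kappa_ge k R_def
    by (intro real_le_lsqrt mult_nonneg_nonneg real_sqrt_ge_zero) auto
  have eq: "y * (real k - 1) = a * (real k - 1) * mu1 ^ (k + 1) * mu2 * Lg / (q * ntot)"
    by (simp add: y_def mult_ac)
  have "0 \<le> 2 ^ k * R * kappa ^ (2 * k) * sqrt (y * (real k - 1)) * fro_norm n T"
    using y0 kappa_ge k by (intro mult_nonneg_nonneg real_sqrt_ge_zero) (auto simp: R_def)
  then show ?thesis using le unfolding R_def[symmetric] eq[symmetric] mult.assoc[of 4] by linarith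
qed

section \<open>Assembly of the error bound\<close>

abbreviation "That Uh Om \<equiv> multi_mode_prod n (\<lambda>i. P_Omega Om T i / q) (Qh Uh)"

lemma error_bound:
  assumes Uh: "admissible Wf Uh" and 1: "avgEU Wf \<le> 2 * sqrt (vstar * aL)"
    and 2: "omega_noise Uh Om \<le> tau3"
  shows "fro_norm n (\<lambda>i. T i - That Uh Om i) \<le>
      error_level"
proof -
  obtain w \<mu> where ex: "\<forall>j<k. eigsys (n ! j) (GE j (Wf j)) (w j) (\<mu> j)
      \<and> proj_on (n ! j) r (w j) (Qh Uh j)"
    using admissible_eigsys[OF Uh] by blast
  then have w: "\<And>j. j < k \<Longrightarrow> eigsys (n ! j) (GE j (Wf j)) (w j) (\<mu> j)"
    and Q: "\<And>j. j < k \<Longrightarrow> proj_on (n ! j) r (w j) (Qh Uh j)"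
    by auto
  have k0: "0 < real k" using k by linarith
  have "(\<Sum>j<k. fro_norm n (\<lambda>i. T i - mode_prod n T j (Qh Uh j) i)) \<le> (\<Sum>j<k. 4 / 3 * (EUj j (Wf j) / lam j) * fro_norm n T)"
    using mode_residual_le[OF _ admissible_E_bound[OF Uh] w Q] by (intro sum_mono) auto
  also have "\<dots> = 4 / 3 * (k * avgEU Wf) * fro_norm n T"
  proof -
    have "real k * avgEU Wf = (\<Sum>j<k. EUj j (Wf j) / lam j)" using k0 by (simp add: avgEU_def)
    then show ?thesis by (simp only: sum_distrib_left sum_distrib_right)
  qed
  also have "\<dots> \<le> 4 / 3 * (k * (2 * sqrt (vstar * aL))) * fro_norm n T"
    using 1 k0 by (intro mult_right_mono mult_left_mono) auto
  also have "\<dots> \<le> 4 * (k * sqrt r * kappa^2 * sqrt (a * mu1 * mu2 * (real r)^2 * Lg / (p * ntot))) * fro_norm n T"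
    by (intro mult_right_mono first_term_eq) simp
  finally have A: "(\<Sum>j<k. fro_norm n (\<lambda>i. T i - mode_prod n T j (Qh Uh j) i))
      \<le> 4 * (k * sqrt r * kappa^2 * sqrt (a * mu1 * mu2 * (real r)^2 * Lg / (p * ntot))) * fro_norm n T" .
  show ?thesis
    using estimate_error_split[OF Q, of T Om q] A order_trans[OF 2 second_term_eq]
    unfolding distrib_left[of 4] distrib_right by linarith
qed

text \<open>The failures \<open>2 + 8 + 2\<close> come from the average residual, the number of bad
  modes and the sampling noise. The third event is intersected with few bad modes, so that its
  conditional probability is bounded for every wedge sample.\<close>

lemma main_prob:
  "pr (pair_pmf PW (rand_subset (idx n) q))
    {(Wf, Om). \<forall>Uh. admissible Wf Uh \<longrightarrow>
       fro_norm n (\<lambda>i. T i - That Uh Om i) \<le>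
        error_level}
   \<ge> 1 - 12 * nmax powr (- a)"
  (is "pr ?M ?G \<ge> _")
proof -
  let ?B1 = "{Wf. avgEU Wf > 2 * sqrt (vstar * aL)}"
  let ?B2 = "{Wf. nbad Wf > k / (4 * Lg)}"
  let ?B3 = "{(Wf, Om). nbad Wf \<le> k / (4 * Lg) \<and> (\<exists>Uh. admissible Wf Uh \<and> omega_noise Uh Om > tau3)}"
  have "- ?G \<subseteq> {z. fst z \<in> ?B1} \<union> {z. fst z \<in> ?B2} \<union> ?B3"
  proof
    fix z assume "z \<in> - ?G"
    then obtain Wf Om Uh where z: "z = (Wf, Om)" "admissible Wf Uh" and
      f: "\<not> fro_norm n (\<lambda>i. T i - That Uh Om i) \<le>
        error_level"
      by (cases z) blast
    have "avgEU Wf > 2 * sqrt (vstar * aL) \<or> omega_noise Uh Om > tau3"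
      using error_bound[OF z(2), of Om] f not_less by blast
    then show "z \<in> {z. fst z \<in> ?B1} \<union> {z. fst z \<in> ?B2} \<union> ?B3"
      using z not_less by auto
  qed
  then have "pr ?M (- ?G) \<le> pr ?M ({z. fst z \<in> ?B1} \<union> {z. fst z \<in> ?B2} \<union> ?B3)"
    by (rule measure_pmf.finite_measure_mono) simp
  also have "\<dots> \<le> pr ?M ({z. fst z \<in> ?B1} \<union> {z. fst z \<in> ?B2}) + pr ?M ?B3"
    by (rule measure_Un_le) auto
  also have "\<dots> \<le> (pr ?M {z. fst z \<in> ?B1} + pr ?M {z. fst z \<in> ?B2}) + pr ?M ?B3"
    by (intro add_right_mono measure_Un_le) auto
  also have "\<dots> \<le> (2 * nmax powr (- a) + 8 * nmax powr (- a)) + 2 * nmax powr (- a)"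
  proof (intro add_mono)
    show "pr ?M {z. fst z \<in> ?B1} \<le> 2 * nmax powr (- a)"
      unfolding prob_pair_fst by (rule avgEU_tail)
    show "pr ?M {z. fst z \<in> ?B2} \<le> 8 * nmax powr (- a)"
      unfolding prob_pair_fst by (rule nbad_tail)
    show "pr ?M ?B3 \<le> 2 * nmax powr (- a)"
    proof (rule prob_pair_le[OF finite_PW finite_set_rand_subset[OF finite_idx]])
      fix Wf
      show "pr (rand_subset (idx n) q) {Om. (Wf, Om) \<in> ?B3} \<le> 2 * nmax powr (- a)"
        using omega_tail_admissible[of Wf] by (cases "nbad Wf \<le> k / (4 * Lg)") auto
    qed
  qed
  finally have "pr ?M (- ?G) \<le> 12 * nmax powr (- a)" by simp
  moreover have "pr ?M (- ?G) = 1 - pr ?M ?G"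
    using measure_pmf.prob_compl[of ?G ?M] by (simp add: Compl_eq_Diff_UNIV)
  ultimately show ?thesis by linarith
qed

end


lemma tensor_estimate_prob:
  fixes n :: "nat list" and T :: tensor and a :: real and r :: nat
    and U S V :: "nat \<Rightarrow> real mat" and mu1 mu2 p q :: real
  defines "kap \<equiv> Max ((\<lambda>j. S j $$ (0, 0) / S j $$ (r - 1, r - 1)) ` {..<length n})"
    and "nmax \<equiv> real (Max (set n))"
  assumes k: "2 \<le> length n" and a: "2 \<le> a" and r: "1 \<le> r"
    and p: "0 < p" "p \<le> 1" and q: "0 < q" "q \<le> 1"
    and svd: "\<forall>j<length n. compact_svd (unfold n j T) r (U j) (S j) (V j)"
    and inc: "\<forall>j<length n. (norm_2inf (U j))^2 \<le> mu1 * r / real (n ! j) \<and>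
          (norm_2inf (V j))^2 \<le> mu2 * r / real (Ndim n j)"
    and p_ge: "20000 * kap ^ 4 * a * mu1 * mu2 * r^2 * ln nmax / real (prod_list n) \<le> p"
    and q_ge: "a * (length n - 1) * ln nmax / real (prod_list n) \<le> q"
  shows "1 - 12 * nmax powr (- a) \<le> pr (pair_pmf (Pi_pmf {..<length n} {} (\<lambda>j. rand_subset (wedge_triples (n ! j) (Ndim n j)) p)) (rand_subset (idx n) q))
     {(Wf, Om).
        (\<forall>j<length n. (S j $$ (r - 1, r - 1))^2 \<ge> 4 * spec_norm (wedge_matrix (unfold n j T) p (Wf j) - unfold n j T * transpose_mat (unfold n j T))) \<longrightarrow>
        (\<forall>Uh. (\<forall>j<length n. top_eigvecs (wedge_matrix (unfold n j T) p (Wf j)) r (Uh j)) \<longrightarrow>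
            fro_norm n (\<lambda>i. T i - multi_mode_prod n (\<lambda>i. P_Omega Om T i / q) (\<lambda>j. Uh j * transpose_mat (Uh j)) i) \<le>
               4 * (length n * sqrt r * kap^2 * sqrt (a * mu1 * mu2 * r^2 * ln nmax / (p * real (prod_list n)))
                    + 2 ^ length n * r powr (1.5 + length n / 2) * kap ^ (2 * length n)
                      * sqrt (a * (length n - 1) * mu1 ^ (length n + 1) * mu2 * ln nmax / (q * real (prod_list n))))
                 * fro_norm n T)}"
proof -
  have k1: "real (length n - 1) = real (length n) - 1" using k by (simp add: of_nat_diff)
  have j0: "0 < length n" using k by linarith
  have "onsys (n ! 0) r (\<lambda>d i. U 0 $$ (i, d))"
    using svd j0 by (intro onsys_of_mat) (auto simp: compact_svd_def unfold_def)
  then have "1 \<le> n ! 0" using onsys_dim_le r by (meson order_trans)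
  moreover have le: "n ! j \<le> Max (set n)" if "j < length n" for j using that by simp
  ultimately have m1: "1 \<le> Max (set n)" using j0 order_trans by blast
  show ?thesis
  proof (cases "Max (set n) = 1")
    \<comment> \<open>With all dimensions equal to 1 the power \<open>nmax powr (- a)\<close> is 1
      and the lower bound is negative.\<close>
    case True
    then show ?thesis by (simp add: nmax_def) (rule order_trans[OF _ measure_nonneg], simp)
  next
    case False
    interpret tensor_setup n T a r U S V mu1 mu2 p q kap nmax
    proof
      show "S j $$ (0, 0) / S j $$ (r - 1, r - 1) \<le> kap" if "j < length n" for j
        unfolding kap_def using that by (intro Max_ge) auto
      show "2 \<le> nmax" using False m1 by (simp add: nmax_def)
      show "real (n ! j) \<le> nmax" if "j < length n" for j using le[OF that] by (simp add: nmax_def)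
      show "20000 * kap ^ 4 * a * mu1 * mu2 * (real r)^2 * ln nmax / real (prod_list n) \<le> p"
        using p_ge by simp
      show "a * (real (length n) - 1) * ln nmax / real (prod_list n) \<le> q"
        using q_ge by (simp only: k1)
    qed (use k a r p q svd inc in auto)
    show ?thesis
      unfolding k1 of_nat_power using main_prob unfolding admissible_def imp_conjL all_simps .
  qed
qed

theorem theoremC3:
  "\<exists>C0 > 0. \<exists>C > 0. \<exists>C' > 0.
   \<forall>(n :: nat list) (T :: tensor) (a :: real) (r :: nat) (U :: nat \<Rightarrow> real mat)
     (S :: nat \<Rightarrow> real mat) (V :: nat \<Rightarrow> real mat) (mu1 :: real) (mu2 :: real) (p :: real) (q :: real).
   let k = length n;
       A = (\<lambda>j. unfold n j T);
       kappa = Max ((\<lambda>j. S j $$ (0, 0) / S j $$ (r - 1, r - 1)) ` {..<k});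
       lam = (\<lambda>j. (S j $$ (r - 1, r - 1))\<^sup>2);
       ntot = real (prod_list n);
       nmax = real (Max (set n));
       Z = (\<lambda>Wf j. wedge_matrix (A j) p (Wf j));
       M = pair_pmf (Pi_pmf {..<k} {} (\<lambda>j. rand_subset (wedge_triples (n ! j) (Ndim n j)) p))
                    (rand_subset (idx n) q)
   in
   k \<ge> 2 \<longrightarrow> a \<ge> 2 \<longrightarrow> r \<ge> 1 \<longrightarrow>
   0 < p \<longrightarrow> p \<le> 1 \<longrightarrow> 0 < q \<longrightarrow> q \<le> 1 \<longrightarrow>
   (\<forall>j<k. vec_space.rank (n ! j) (A j) = r) \<longrightarrow>
   (\<forall>j<k. compact_svd (A j) r (U j) (S j) (V j)) \<longrightarrow>
   (\<forall>j<k. (norm_2inf (U j))\<^sup>2 \<le> mu1 * r / real (n ! j) \<and>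
          (norm_2inf (V j))\<^sup>2 \<le> mu2 * r / real (Ndim n j)) \<longrightarrow>
   p \<ge> C0 * kappa ^ 4 * a * mu1 * mu2 * r\<^sup>2 * ln nmax / ntot \<longrightarrow>
   q \<ge> a * (k - 1) * ln nmax / ntot \<longrightarrow>
   measure_pmf.prob M
     {(Wf, Om).
        (\<forall>j<k. lam j \<ge> 4 * spec_norm (Z Wf j - A j * transpose_mat (A j))) \<longrightarrow>
        (\<forall>Uh. (\<forall>j<k. top_eigvecs (Z Wf j) r (Uh j)) \<longrightarrow>
           (let Q = (\<lambda>j. Uh j * transpose_mat (Uh j));
                Y = (\<lambda>i. P_Omega Om T i / q);
                That = multi_mode_prod n Y Q
            in fro_norm n (\<lambda>i. T i - That i) \<le>
               C * (k * sqrt r * kappa\<^sup>2 * sqrt (a * mu1 * mu2 * r\<^sup>2 * ln nmax / (p * ntot))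
                    + 2 ^ k * r powr (1.5 + k / 2) * kappa ^ (2 * k)
                      * sqrt (a * (k - 1) * mu1 ^ (k + 1) * mu2 * ln nmax / (q * ntot)))
                 * fro_norm n T))}
     \<ge> 1 - C' * nmax powr (- a)"
  by (rule exI[of _ "20000 :: real"], rule conjI, simp, rule exI[of _ "4 :: real"], rule conjI, simp,
      rule exI[of _ "12 :: real"], rule conjI, simp, unfold Let_def, intro allI impI, rule tensor_estimate_prob)

end
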